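(* If an NDD tuple $(\mathfrak g,\mathfrak h,\mathcal O)$ is minimal, then $(\mathfrak g,\mathfrak h)\simeq(\mathfrak{sl}(2,\mathbb R),\mathbb R)$, where $\mathbb R$ means the subalgebra of diagonal matrices in $\mathfrak{sl}(2,\mathbb R)$.
   Context: Conventions. $\mathfrak g$ is a real reductive Lie algebra with Cartan involution $\theta$; $G$ is a connected reductive Lie group with Lie algebra $\mathfrak g$ and a Cartan involution whose differential is $\theta$; $\mathfrak k=\mathfrak g^\theta$, $K=G^\theta$; $W^{-\theta}$ denotes the $(-1)$-eigenspace of $\theta$ in a $\theta$-stable $W$. Fix a $G$-invariant non-degenerate symmetric bilinear form $(\cdot,\cdot)$ on $\mathfrak g$ with $-(\cdot,\theta(\cdot))$ positive definite and symmetric; $\perp$ is with respect to it. For a subalgebra of $\mathfrak g$, the corresponding capital Roman letter is the analytic subgroup of $G$ (not assumed closed). A $\theta$-stable subalgebra is compact if it is contained in $\mathfrak k$. For a representation $E$ of a Lie group $L$, $\mathcal N(E,L)=\{v\in E:0\in\overline{L\cdot v}\}$. NDD tuple: a triple $(\mathfrak g,\mathfrak h,\mathcal O)$, with $\mathfrak h$ a $\theta$-stable reductive subalgebra of $\mathfrak g$ and $\mathcal O$ a nilpotent $G$-orbit in $\mathfrak g$, is NDD if $\overline{\mathcal O}\cap\mathcal N(\mathfrak h^\perp,H)\neq\{0\}$ (this does not depend on the form). Let $\mathfrak a_H$ be a maximal abelian subspace of $\mathfrak h^{-\theta}$. Reductions of an NDD tuple $(\mathfrak g,\mathfrak h,\mathcal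 O)$: (a) Let $\mathfrak g'$ be the smallest ideal of $\mathfrak g$ containing $\mathcal O$ and $\mathfrak h'$ the orthogonal projection of $\mathfrak h$ to $\mathfrak g'$; replace the tuple by $(\mathfrak g',\mathfrak h',\mathcal O)$. (b) Let $\mathfrak i$ be the sum of all compact ideals of $\mathfrak h$ and $\mathfrak h'$ the orthogonal complement of $\mathfrak i$ in $\mathfrak h$; replace the tuple by $(\mathfrak g,\mathfrak h',\mathcal O)$. (c) Choose a $G$-invariant non-degenerate symmetric bilinear form $(\cdot,\cdot)$ on $\mathfrak g$ such that $-(\cdot,\theta(\cdot))$ is positive definite and symmetric (with $\perp$ in (c) taken with respect to this form), and an $\mathfrak a_H$-weight vector $X\in\overline{\mathcal O}\cap\mathcal N(\mathfrak h^\perp,H)$ with non-zero weight. Let $\mathfrak g'$ be the smallest subalgebra of $\mathfrak g$ that contains $\mathfrak a_H$, $X$, $\theta(X)$ and satisfies $\mathfrak g'=(\mathfrak g'\cap\mathfrak h)\oplus(\mathfrak g'\cap\mathfrak h^\perp)$, and $\mathfrak h'=\mathfrak g'\cap\mathfrak h$; replace the tuple by $(\mathfrak g',\mathfrak h',\mathrm{Ad}(G')X)$. Minimal: an NDD tuple is minimal if it is unchanged under every choice of the reductions (a), (b), (c). *)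

theory Defs
  imports "HOL-Analysis.Analysis" "HOL-Algebra.Generated_Groups"
begin

text \<open>
  The ambient Lie algebra is a whole type \<open>'a\<close> of class \<open>euclidean_space\<close> with a bracket \<open>br\<close>.
  The class only supplies the topology of a finite-dimensional real vector space; its inner
  product plays no role.
\<close>

section \<open>Lie algebras\<close>

definition lie_algebra :: "('a::euclidean_space \<Rightarrow> 'a \<Rightarrow> 'a) \<Rightarrow> bool" where
  "lie_algebra br \<longleftrightarrow> bilinear br \<and> (\<forall>X. br X X = 0) \<and>
     (\<forall>X Y Z. br X (br Y Z) + br Y (br Z X) + br Z (br X Y) = 0)"

definition lie_subalgebra :: "('a::euclidean_space \<Rightarrow> 'a \<Rightarrow> 'a) \<Rightarrow> 'a set \<Rightarrow> bool" where
  "lie_subalgebra br s \<longleftrightarrow> subspace s \<and> (\<forall>X\<in>s. \<forall>Y\<in>s. br X Y \<in> s)"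

definition lie_ideal :: "('a::euclidean_space \<Rightarrow> 'a \<Rightarrow> 'a) \<Rightarrow> 'a set \<Rightarrow> 'a set \<Rightarrow> bool" where
  "lie_ideal br s I \<longleftrightarrow> subspace I \<and> I \<subseteq> s \<and> (\<forall>X\<in>s. \<forall>Y\<in>I. br X Y \<in> I)"

definition direct_sum :: "'a::real_vector set \<Rightarrow> 'a set \<Rightarrow> 'a set \<Rightarrow> bool" where
  "direct_sum V U W \<longleftrightarrow> V = {u + w | u w. u \<in> U \<and> w \<in> W} \<and> U \<inter> W = {0}"

definition lie_reductive :: "('a::euclidean_space \<Rightarrow> 'a \<Rightarrow> 'a) \<Rightarrow> 'a set \<Rightarrow> bool" where
  "lie_reductive br s \<longleftrightarrow>
     (\<forall>I. lie_ideal br s I \<longrightarrow> (\<exists>J. lie_ideal br s J \<and> direct_sum s I J))"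

text \<open>Nilpotent elements of a reductive Lie algebra are required to lie in the derived algebra,
  so that nonzero central elements do not count as nilpotent.\<close>

definition lie_nilpotent :: "('a::euclidean_space \<Rightarrow> 'a \<Rightarrow> 'a) \<Rightarrow> 'a \<Rightarrow> bool" where
  "lie_nilpotent br X \<longleftrightarrow> X \<in> span {br Y Z | Y Z. True} \<and> (\<exists>n. \<forall>Y. (br X ^^ n) Y = 0)"

definition plus_space :: "('a::euclidean_space \<Rightarrow> 'a) \<Rightarrow> 'a set \<Rightarrow> 'a set" where
  "plus_space \<theta> W = {X \<in> W. \<theta> X = X}"

definition minus_space :: "('a::euclidean_space \<Rightarrow> 'a) \<Rightarrow> 'a set \<Rightarrow> 'a set" where
  "minus_space \<theta> W = {X \<in> W. \<theta> X = - X}"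

definition max_abelian_subspace ::
    "('a::euclidean_space \<Rightarrow> 'a \<Rightarrow> 'a) \<Rightarrow> 'a set \<Rightarrow> 'a set \<Rightarrow> bool" where
  "max_abelian_subspace br W \<aa> \<longleftrightarrow>
     (let ab = (\<lambda>V. subspace V \<and> V \<subseteq> W \<and> (\<forall>X\<in>V. \<forall>Y\<in>V. br X Y = 0))
      in ab \<aa> \<and> (\<forall>V. ab V \<and> \<aa> \<subseteq> V \<longrightarrow> V = \<aa>))"

definition weight_vector ::
    "('a::euclidean_space \<Rightarrow> 'a \<Rightarrow> 'a) \<Rightarrow> 'a set \<Rightarrow> ('a \<Rightarrow> real) \<Rightarrow> 'a \<Rightarrow> bool" where
  "weight_vector br \<aa> \<mu> X \<longleftrightarrow> linear \<mu> \<and> X \<noteq> 0 \<and> (\<forall>Y\<in>\<aa>. br Y X = \<mu> Y *\<^sub>R X)"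


section \<open>Bilinear forms and Cartan involutions\<close>

definition cartan_form ::
    "('a::euclidean_space \<Rightarrow> 'a) \<Rightarrow> ('a \<Rightarrow> 'a \<Rightarrow> real) \<Rightarrow> bool" where
  "cartan_form \<theta> B \<longleftrightarrow> bilinear B \<and> (\<forall>X Y. B X Y = B Y X) \<and>
     (\<forall>X. (\<forall>Y. B X Y = 0) \<longrightarrow> X = 0) \<and>
     (\<forall>X Y. - B X (\<theta> Y) = - B Y (\<theta> X)) \<and> (\<forall>X. X \<noteq> 0 \<longrightarrow> - B X (\<theta> X) > 0)"

definition cartan_involution ::
    "('a::euclidean_space \<Rightarrow> 'a \<Rightarrow> 'a) \<Rightarrow> ('a \<Rightarrow> 'a) \<Rightarrow> bool" where
  "cartan_involution br \<theta> \<longleftrightarrow> linear \<theta> \<and> (\<forall>X. \<theta> (\<theta> X) = X) \<and>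
     (\<forall>X Y. \<theta> (br X Y) = br (\<theta> X) (\<theta> Y)) \<and>
     (\<exists>B. cartan_form \<theta> B \<and> (\<forall>X Y Z. B (br X Y) Z = - B Y (br X Z)))"

definition perp :: "('a::euclidean_space \<Rightarrow> 'a \<Rightarrow> real) \<Rightarrow> 'a set \<Rightarrow> 'a set" where
  "perp B V = {X. \<forall>Y\<in>V. B X Y = 0}"

definition orth_projection ::
    "('a::euclidean_space \<Rightarrow> 'a \<Rightarrow> real) \<Rightarrow> 'a set \<Rightarrow> 'a set \<Rightarrow> 'a set" where
  "orth_projection B V S = {Y \<in> V. \<exists>Z\<in>S. Z - Y \<in> perp B V}"


section \<open>Lie groups\<close>

definition topological_group :: "'b monoid \<Rightarrow> 'b topology \<Rightarrow> bool" where
  "topological_group G T \<longleftrightarrow> group G \<and> topspace T = carrier G \<and>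
     continuous_map (prod_topology T T) T (\<lambda>(a, b). a \<otimes>\<^bsub>G\<^esub> b) \<and>
     continuous_map T T (\<lambda>a. inv\<^bsub>G\<^esub> a)"

definition exp_ad :: "('a::euclidean_space \<Rightarrow> 'a \<Rightarrow> 'a) \<Rightarrow> 'a \<Rightarrow> 'a \<Rightarrow> 'a" where
  "exp_ad br X Y = (\<Sum>n. (br X ^^ n) Y /\<^sub>R fact n)"

text \<open>
  \<open>G\<close> is a connected Lie group with Lie algebra \<open>('a, br)\<close>, exponential map \<open>Exp\<close> and adjoint
  representation \<open>Ad\<close>. Instead of an atlas we use the exponential map: it is a local homeomorphism
  at \<open>0\<close>, so \<open>G\<close> is a locally Euclidean group and hence carries a unique Lie group structure. The
  one-parameter subgroups of \<open>G\<close> are identified with \<open>'a\<close> through \<open>Exp\<close>, the Trotter formula makes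
  this identification linear, and \<open>Ad (Exp X) = exp_ad br X\<close> makes it an isomorphism for the brackets.
\<close>

definition connected_lie_group ::
    "('a::euclidean_space \<Rightarrow> 'a \<Rightarrow> 'a) \<Rightarrow> 'b monoid \<Rightarrow> 'b topology \<Rightarrow> ('a \<Rightarrow> 'b) \<Rightarrow> ('b \<Rightarrow> 'a \<Rightarrow> 'a) \<Rightarrow> bool"
  where
  "connected_lie_group br G T Exp Ad \<longleftrightarrow>
     topological_group G T \<and> Hausdorff_space T \<and> connected_space T \<and>
     (\<forall>X. Exp X \<in> carrier G) \<and>
     (\<forall>s t X. Exp ((s + t) *\<^sub>R X) = Exp (s *\<^sub>R X) \<otimes>\<^bsub>G\<^esub> Exp (t *\<^sub>R X)) \<and>
     (\<exists>U. open U \<and> 0 \<in> U \<and> openin T (Exp ` U) \<and>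
        homeomorphic_map (top_of_set U) (subtopology T (Exp ` U)) Exp) \<and>
     (\<forall>X Y. limitin T
        (\<lambda>n::nat. (Exp (X /\<^sub>R real n) \<otimes>\<^bsub>G\<^esub> Exp (Y /\<^sub>R real n)) [^]\<^bsub>G\<^esub> n) (Exp (X + Y)) sequentially) \<and>
     (\<forall>a\<in>carrier G. linear (Ad a) \<and> (\<forall>X. a \<otimes>\<^bsub>G\<^esub> Exp X \<otimes>\<^bsub>G\<^esub> inv\<^bsub>G\<^esub> a = Exp (Ad a X))) \<and>
     (\<forall>X Y. Ad (Exp X) Y = exp_ad br X Y)"

text \<open>\<open>Theta\<close> is a Cartan involution of \<open>G\<close> with differential \<open>\<theta>\<close>: an involutive automorphism with
  fixed group \<open>K\<close> for which the global Cartan decomposition \<open>G = K exp(\<pp>)\<close> holds.\<close>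

definition group_cartan_involution ::
    "('a::euclidean_space \<Rightarrow> 'a) \<Rightarrow> 'b monoid \<Rightarrow> 'b topology \<Rightarrow> ('a \<Rightarrow> 'b) \<Rightarrow> ('b \<Rightarrow> 'b) \<Rightarrow> bool" where
  "group_cartan_involution \<theta> G T Exp Theta \<longleftrightarrow>
     Theta \<in> hom G G \<and> continuous_map T T Theta \<and>
     (\<forall>a\<in>carrier G. Theta (Theta a) = a) \<and> (\<forall>X. Theta (Exp X) = Exp (\<theta> X)) \<and>
     homeomorphic_map
       (prod_topology (subtopology T {a \<in> carrier G. Theta a = a}) (top_of_set (minus_space \<theta> UNIV)))
       T (\<lambda>(k, X). k \<otimes>\<^bsub>G\<^esub> Exp X)"

text \<open>A connected Lie group is generated by the image of its exponential map.\<close>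

definition analytic_subgroup :: "'b monoid \<Rightarrow> ('a \<Rightarrow> 'b) \<Rightarrow> 'a set \<Rightarrow> 'b set" where
  "analytic_subgroup G Exp s = generate G (Exp ` s)"

definition orbit :: "('b \<Rightarrow> 'a \<Rightarrow> 'a) \<Rightarrow> 'b set \<Rightarrow> 'a \<Rightarrow> 'a set" where
  "orbit Ad L X = (\<lambda>a. Ad a X) ` L"

definition null_cone :: "('b \<Rightarrow> 'a::euclidean_space \<Rightarrow> 'a) \<Rightarrow> 'a set \<Rightarrow> 'b set \<Rightarrow> 'a set" where
  "null_cone Ad E L = {v \<in> E. 0 \<in> closure (orbit Ad L v)}"

definition invariant_cartan_form ::
    "'b monoid \<Rightarrow> ('b \<Rightarrow> 'a::euclidean_space \<Rightarrow> 'a) \<Rightarrow> ('a \<Rightarrow> 'a) \<Rightarrow> ('a \<Rightarrow> 'a \<Rightarrow> real) \<Rightarrow> bool" where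
  "invariant_cartan_form G Ad \<theta> B \<longleftrightarrow>
     cartan_form \<theta> B \<and> (\<forall>a\<in>carrier G. \<forall>X Y. B (Ad a X) (Ad a Y) = B X Y)"


section \<open>NDD tuples, their reductions, and minimality\<close>

definition ndd_tuple ::
    "('a::euclidean_space \<Rightarrow> 'a \<Rightarrow> 'a) \<Rightarrow> ('a \<Rightarrow> 'a) \<Rightarrow> 'b monoid \<Rightarrow> ('a \<Rightarrow> 'b) \<Rightarrow> ('b \<Rightarrow> 'a \<Rightarrow> 'a) \<Rightarrow>
     ('a \<Rightarrow> 'a \<Rightarrow> real) \<Rightarrow> 'a set \<Rightarrow> 'a set \<Rightarrow> bool" where
  "ndd_tuple br \<theta> G Exp Ad B \<hh> Orb \<longleftrightarrow>
     lie_subalgebra br \<hh> \<and> lie_reductive br \<hh> \<and> \<theta> ` \<hh> = \<hh> \<and>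
     (\<exists>X. lie_nilpotent br X \<and> Orb = orbit Ad (carrier G) X) \<and>
     closure Orb \<inter> null_cone Ad (perp B \<hh>) (analytic_subgroup G Exp \<hh>) \<noteq> {0}"

definition reduction_a ::
    "('a::euclidean_space \<Rightarrow> 'a \<Rightarrow> 'a) \<Rightarrow> ('a \<Rightarrow> 'a \<Rightarrow> real) \<Rightarrow> 'a set \<Rightarrow> 'a set \<Rightarrow>
     'a set \<times> 'a set \<times> 'a set" where
  "reduction_a br B \<hh> Orb =
     (let \<gg>' = lie_ideal br UNIV hull Orb in (\<gg>', orth_projection B \<gg>' \<hh>, Orb))"

definition compact_ideal_sum ::
    "('a::euclidean_space \<Rightarrow> 'a \<Rightarrow> 'a) \<Rightarrow> ('a \<Rightarrow> 'a) \<Rightarrow> 'a set \<Rightarrow> 'a set" where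
  "compact_ideal_sum br \<theta> \<hh> = span (\<Union>{I. lie_ideal br \<hh> I \<and> I \<subseteq> plus_space \<theta> UNIV})"

definition reduction_b ::
    "('a::euclidean_space \<Rightarrow> 'a \<Rightarrow> 'a) \<Rightarrow> ('a \<Rightarrow> 'a) \<Rightarrow> ('a \<Rightarrow> 'a \<Rightarrow> real) \<Rightarrow> 'a set \<Rightarrow> 'a set \<Rightarrow>
     'a set \<times> 'a set \<times> 'a set" where
  "reduction_b br \<theta> B \<hh> Orb = (UNIV, \<hh> \<inter> perp B (compact_ideal_sum br \<theta> \<hh>), Orb)"

definition reduction_c_choice ::
    "('a::euclidean_space \<Rightarrow> 'a \<Rightarrow> 'a) \<Rightarrow> ('a \<Rightarrow> 'a) \<Rightarrow> 'b monoid \<Rightarrow> ('a \<Rightarrow> 'b) \<Rightarrow> ('b \<Rightarrow> 'a \<Rightarrow> 'a) \<Rightarrow>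
     'a set \<Rightarrow> 'a set \<Rightarrow> 'a set \<Rightarrow> ('a \<Rightarrow> 'a \<Rightarrow> real) \<Rightarrow> 'a \<Rightarrow> bool" where
  "reduction_c_choice br \<theta> G Exp Ad \<aa> \<hh> Orb B X \<longleftrightarrow>
     invariant_cartan_form G Ad \<theta> B \<and>
     X \<in> closure Orb \<inter> null_cone Ad (perp B \<hh>) (analytic_subgroup G Exp \<hh>) \<and>
     (\<exists>\<mu>. weight_vector br \<aa> \<mu> X \<and> (\<exists>Y\<in>\<aa>. \<mu> Y \<noteq> 0))"

definition reduction_c ::
    "('a::euclidean_space \<Rightarrow> 'a \<Rightarrow> 'a) \<Rightarrow> ('a \<Rightarrow> 'a) \<Rightarrow> 'b monoid \<Rightarrow> ('a \<Rightarrow> 'b) \<Rightarrow> ('b \<Rightarrow> 'a \<Rightarrow> 'a) \<Rightarrow>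
     'a set \<Rightarrow> 'a set \<Rightarrow> ('a \<Rightarrow> 'a \<Rightarrow> real) \<Rightarrow> 'a \<Rightarrow> 'a set \<times> 'a set \<times> 'a set" where
  "reduction_c br \<theta> G Exp Ad \<aa> \<hh> B X =
     (let \<gg>' = (\<lambda>V. lie_subalgebra br V \<and> direct_sum V (V \<inter> \<hh>) (V \<inter> perp B \<hh>))
                 hull (\<aa> \<union> {X, \<theta> X})
      in (\<gg>', \<gg>' \<inter> \<hh>, orbit Ad (analytic_subgroup G Exp \<gg>') X))"

text \<open>The form \<open>B\<close> fixed in advance is used in the first two reductions only; the third one
  ranges over all forms \<open>B'\<close>.\<close>

definition ndd_minimal ::
    "('a::euclidean_space \<Rightarrow> 'a \<Rightarrow> 'a) \<Rightarrow> ('a \<Rightarrow> 'a) \<Rightarrow> 'b monoid \<Rightarrow> ('a \<Rightarrow> 'b) \<Rightarrow> ('b \<Rightarrow> 'a \<Rightarrow> 'a) \<Rightarrow>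
     ('a \<Rightarrow> 'a \<Rightarrow> real) \<Rightarrow> 'a set \<Rightarrow> 'a set \<Rightarrow> 'a set \<Rightarrow> bool" where
  "ndd_minimal br \<theta> G Exp Ad B \<aa> \<hh> Orb \<longleftrightarrow>
     reduction_a br B \<hh> Orb = (UNIV, \<hh>, Orb) \<and>
     reduction_b br \<theta> B \<hh> Orb = (UNIV, \<hh>, Orb) \<and>
     (\<forall>B' X. reduction_c_choice br \<theta> G Exp Ad \<aa> \<hh> Orb B' X \<longrightarrow>
        reduction_c br \<theta> G Exp Ad \<aa> \<hh> B' X = (UNIV, \<hh>, Orb))"


section \<open>The model pair\<close>

definition sl2 :: "(real^2^2) set" where
  "sl2 = {A. trace A = 0}"

definition sl2_diag :: "(real^2^2) set" where
  "sl2_diag = {A \<in> sl2. \<forall>i j. i \<noteq> j \<longrightarrow> A $ i $ j = 0}"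

definition commutator :: "real^2^2 \<Rightarrow> real^2^2 \<Rightarrow> real^2^2" where
  "commutator A C = A ** C - C ** A"

definition lie_pair_iso ::
    "('a::real_vector \<Rightarrow> 'a \<Rightarrow> 'a) \<Rightarrow> 'a set \<Rightarrow> 'a set \<Rightarrow>
     ('c::real_vector \<Rightarrow> 'c \<Rightarrow> 'c) \<Rightarrow> 'c set \<Rightarrow> 'c set \<Rightarrow> bool" where
  "lie_pair_iso br \<gg> \<hh> br' \<gg>' \<hh>' \<longleftrightarrow>
     (\<exists>\<phi>. linear \<phi> \<and> bij_betw \<phi> \<gg> \<gg>' \<and>
        (\<forall>X\<in>\<gg>. \<forall>Y\<in>\<gg>. \<phi> (br X Y) = br' (\<phi> X) (\<phi> Y)) \<and> \<phi> ` \<hh> = \<hh>')"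

end

theory Submission
  imports Defs
begin

text \<open>
  Let \<open>\<qq> = \<hh>\<^sup>\<bottom>\<close> and let \<open>\<CC>\<close> be the closure of the orbit, which is a cone because a nilpotent \<open>X\<close> has the
  form \<open>[D, X]\<close>. If \<open>w \<in> \<CC> \<inter> \<qq>\<close>, then the extreme components of \<open>w\<close> with respect to an element of \<open>\<aa>\<close>
  stay in \<open>\<CC> \<inter> \<qq>\<close>; this produces weight vectors. Since the centralizer of the kernel of a weight
  satisfies the conditions of reduction (c), \<open>\<aa>\<close> is spanned by one element \<open>A\<close>, and likewise the
  eigenvalues of \<open>ad A\<close> are integers between \<open>-2\<close> and \<open>2\<close> when some \<open>X \<in> \<CC> \<inter> \<qq>\<close> has weight 1.

  Now minimise the norm of \<open>[X, \<theta> X]\<close> over unit vectors \<open>X \<in> \<CC> \<inter> \<qq>\<close> of weight 1. If the Lagrange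
  multiplier for the constraint \<open>X \<in> \<qq>\<close> vanishes, then \<open>[[X, \<theta> X], X]\<close> is a multiple of \<open>X\<close>, the span of
  \<open>A\<close>, \<open>X\<close>, \<open>\<theta> X\<close> and \<open>[X, \<theta> X]\<close> is everything, and the pair is the model pair. If the multiplier
  \<open>y \<in> \<hh>\<close> does not vanish, it decomposes into pieces generating commuting copies of \<open>sl2\<close> whose sum is
  everything. Two pieces occur in \<open>X\<close> with opposite signs; their difference lies in \<open>\<CC>\<close> and becomes
  orthogonal to \<open>\<hh>\<close> after the invariant form is rescaled on one of the ideals, which leads back to the
  first case.
\<close>

section \<open>Positive definite forms\<close>

text \<open>The obstacle is the constraint that X stays in \<open>\<qq>\<close>. Since
  \<open>\<CC>\<close> need not be smooth, only flows preserving it serve as variations. In degree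
  one these are exp(ad Z) with Z of degree zero, and they leave \<open>\<qq>\<close>; so a growing
  penalty replaces the constraint.

  Two mechanisms recur. Maximality of \<open>\<aa>\<close> makes every degree zero element of
  \<open>\<hh>\<close> that \<theta> negates a multiple of A, so a nonzero y in \<open>\<hh>\<close>
  of nonzero degree spans a copy of sl2 with \<theta> y and A. Since degrees stop at 2, exp(ad Z) X
  = X + [Z, X] for Z and X of degree one; hence [Z, X] lies in \<open>\<CC>\<close>, and it vanishes
  as soon as it lies in \<open>\<qq>\<close>, where only the nonzero degrees 1 and -1 occur in
  \<open>\<CC>\<close>.

  The opposite signs come from orthogonality: X is a multiple of [u, y] with u = [y, \<theta> X], ad
  u is self-adjoint, and X is orthogonal to y; so the eigenvalues of ad u, weighted by the squared
  lengths of the pieces of y, sum to zero. The difference of two pieces is orthogonal to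
  \<open>\<hh>\<close> for a suitable form only, which is why reduction (c) has to range over all
  invariant forms.\<close>

lemma linear_term_zero:
  fixes a b :: real
  assumes "\<And>t. 0 \<le> a * t + b * t\<^sup>2"
  shows "a = 0"
proof (rule ccontr)
  assume a: "a \<noteq> 0"
  define \<beta> where "\<beta> = \<bar>b\<bar> + 1"
  define t where "t = - a / (2 * \<beta>)"
  have \<beta>: "\<beta> > 0" "b \<le> \<beta>" by (auto simp: \<beta>_def)
  have "a * t + b * t\<^sup>2 \<le> a * t + \<beta> * t\<^sup>2"
    using \<beta> by (intro add_left_mono mult_right_mono) auto
  also have "\<dots> = - (a\<^sup>2 / (4 * \<beta>))"
    unfolding t_def using \<beta> by (simp add: field_simps power2_eq_square)
  also have "\<dots> < 0" using a \<beta> by simp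
  finally show False using assms[of t] by simp
qed

lemma bilinear_sum_left: "bilinear h \<Longrightarrow> h (\<Sum>i\<in>S. f i) y = (\<Sum>i\<in>S. h (f i) y)"
  by (rule linear_sum[of "\<lambda>x. h x y", simplified]) (simp add: bilinear_def)

lemma bilinear_sum_right: "bilinear h \<Longrightarrow> h x (\<Sum>i\<in>S. f i) = (\<Sum>i\<in>S. h x (f i))"
  by (rule linear_sum[of "h x", simplified]) (simp add: bilinear_def)

lemma bilinear_continuous_on:
  fixes h :: "'a::euclidean_space \<Rightarrow> 'b::euclidean_space \<Rightarrow> 'c::real_normed_vector"
  assumes "bilinear h" "continuous_on S f" "continuous_on S g"
  shows "continuous_on S (\<lambda>x. h (f x) (g x))"
  using bounded_bilinear.continuous_on[OF bilinear_conv_bounded_bilinear[THEN iffD1, OF assms(1)]] assms by blast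

text \<open>The geometry of the problem is that of \<open>- B X (\<theta> Y)\<close>, not of the
  inner product of the type class. Projections, eigenvectors and traces are therefore developed for
  an abstract positive definite form.\<close>

locale inner_form =
  fixes ip :: "'a::euclidean_space \<Rightarrow> 'a \<Rightarrow> real"
  assumes ip_bilinear: "bilinear ip"
    and ip_commute: "ip x y = ip y x"
    and ip_pos: "x \<noteq> 0 \<Longrightarrow> ip x x > 0"
begin

lemmas ip_add_left = bilinear_ladd[OF ip_bilinear]
  and ip_add_right = bilinear_radd[OF ip_bilinear]
  and ip_scale_left = bilinear_lmul[OF ip_bilinear, simplified]
  and ip_scale_right = bilinear_rmul[OF ip_bilinear, simplified]
  and ip_minus_left = bilinear_lneg[OF ip_bilinear]
  and ip_minus_right = bilinear_rneg[OF ip_bilinear]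
  and ip_diff_left = bilinear_lsub[OF ip_bilinear]
  and ip_diff_right = bilinear_rsub[OF ip_bilinear]
  and ip_zero_left = bilinear_lzero[OF ip_bilinear]
  and ip_zero_right = bilinear_rzero[OF ip_bilinear]
  and ip_sum_left = bilinear_sum_left[OF ip_bilinear]
  and ip_sum_right = bilinear_sum_right[OF ip_bilinear]

lemmas ip_simps = ip_add_left ip_add_right ip_scale_left ip_scale_right ip_minus_left
  ip_minus_right ip_diff_left ip_diff_right ip_zero_left ip_zero_right

lemma ip_eq_zero_iff: "ip x x = 0 \<longleftrightarrow> x = 0"
  using ip_pos[of x] ip_zero_left by fastforce

lemma ip_nonneg: "ip x x \<ge> 0"
  using ip_pos[of x] ip_zero_left[of 0] by (cases "x = 0") auto

lemma ip_span_zero: "x \<in> span S \<Longrightarrow> (\<And>s. s \<in> S \<Longrightarrow> ip s y = 0) \<Longrightarrow> ip x y = 0"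
  by (induction rule: span_induct_alt) (auto simp: ip_simps)

lemma ip_perp_all: "(\<And>y. ip x y = 0) \<Longrightarrow> x = 0"
  using ip_eq_zero_iff by blast

lemma projection_span:
  assumes "finite S"
  shows "\<exists>w\<in>span S. \<forall>v\<in>span S. ip (x - w) v = 0"
  using assms
proof (induction S arbitrary: x)
  case empty
  show ?case by (auto simp: ip_simps)
next
  case (insert b S)
  obtain p where p: "p \<in> span S" "\<forall>v\<in>span S. ip (b - p) v = 0" using insert.IH[of b] by blast
  obtain w where w: "w \<in> span S" "\<forall>v\<in>span S. ip (x - w) v = 0" using insert.IH[of x] by blast
  define b' where "b' = b - p"
  define c where "c = ip x b' / ip b' b'"
  have sub: "span S \<subseteq> span (insert b S)" by (simp add: span_mono subset_insertI)
  have b'in: "b' \<in> span (insert b S)"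
    unfolding b'_def using p(1) sub by (meson in_mono insertI1 span_base span_diff)
  have b'S: "ip b' v = 0" if "v \<in> span S" for v using p(2) that by (simp add: b'_def)
  \<comment> \<open>If b already lies in \<open>span S\<close>, then b' = 0 and c = 0 by division by
    zero, so both sides vanish.\<close>
  have cb: "c * ip b' b' = ip x b'"
    using ip_eq_zero_iff[of b'] by (cases "b' = 0") (auto simp: c_def ip_simps)
  have 1: "ip (x - (w + c *\<^sub>R b')) v = 0" if "v \<in> span S" for v
    using w(2) that b'S[OF that] by (simp add: ip_simps)
  have 2: "ip (x - (w + c *\<^sub>R b')) b' = 0"
    using b'S[OF w(1)] cb by (simp add: ip_simps ip_commute[of w])
  have 3: "ip (x - (w + c *\<^sub>R b')) v = 0" if "v \<in> span (insert b S)" for v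
  proof -
    obtain k where "v - k *\<^sub>R b \<in> span S" using \<open>v \<in> span (insert b S)\<close> span_breakdown_eq by blast
    then have "v - k *\<^sub>R b' \<in> span S"
      using span_add[OF _ span_scale[OF p(1), of k], of "v - k *\<^sub>R b"]
      by (simp add: b'_def algebra_simps)
    from 1[OF this] 2 show ?thesis by (simp add: ip_simps)
  qed
  have "w + c *\<^sub>R b' \<in> span (insert b S)"
    using w(1) sub b'in by (meson in_mono span_add span_scale)
  with 3 show ?case by blast
qed

lemma projection_exists:
  assumes "subspace W"
  shows "\<exists>w\<in>W. \<forall>v\<in>W. ip (x - w) v = 0"
proof -
  obtain S where "finite S" "span S = W"
    by (metis assms basis_subspace_exists)
  then show ?thesis using projection_span by blast
qed

definition proj :: "'a set \<Rightarrow> 'a \<Rightarrow> 'a" where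
  "proj W x = (SOME w. w \<in> W \<and> (\<forall>v\<in>W. ip (x - w) v = 0))"

lemma proj:
  assumes "subspace W"
  shows proj_in: "proj W x \<in> W" and proj_perp: "v \<in> W \<Longrightarrow> ip (x - proj W x) v = 0"
proof -
  have "proj W x \<in> W \<and> (\<forall>v\<in>W. ip (x - proj W x) v = 0)"
    unfolding proj_def by (rule someI_ex) (use projection_exists[OF assms, of x] in blast)
  then show "proj W x \<in> W" "v \<in> W \<Longrightarrow> ip (x - proj W x) v = 0" by auto
qed

lemma proj_unique:
  assumes "subspace W" "w \<in> W" "\<And>v. v \<in> W \<Longrightarrow> ip (x - w) v = 0"
  shows "proj W x = w"
proof -
  have d: "proj W x - w \<in> W" using assms proj_in subspace_diff by blast
  have "ip (proj W x - w) (proj W x - w)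
      = ip (x - w) (proj W x - w) - ip (x - proj W x) (proj W x - w)"
    by (simp add: ip_simps)
  also have "\<dots> = 0" using assms(3)[OF d] proj_perp[OF assms(1) d] by simp
  finally show ?thesis using ip_eq_zero_iff by simp
qed

lemma proj_linear: assumes W: "subspace W" shows "linear (proj W)"
proof (rule linearI)
  show "proj W (x + y) = proj W x + proj W y" for x y
  proof (rule proj_unique[OF W])
    show "ip (x + y - (proj W x + proj W y)) v = 0" if "v \<in> W" for v
      using proj_perp[OF W that, of x] proj_perp[OF W that, of y] by (simp add: ip_simps)
  qed (use W proj_in subspace_add in blast)
  show "proj W (c *\<^sub>R x) = c *\<^sub>R proj W x" for c x
  proof (rule proj_unique[OF W])
    show "ip (c *\<^sub>R x - c *\<^sub>R proj W x) v = 0" if "v \<in> W" for v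
      using proj_perp[OF W that, of x] by (simp add: ip_simps)
  qed (use W proj_in subspace_scale in blast)
qed

lemma proj_id: "subspace W \<Longrightarrow> x \<in> W \<Longrightarrow> proj W x = x"
  by (rule proj_unique) (auto simp: ip_simps)

lemma ip_continuous: "continuous_on S f \<Longrightarrow> continuous_on S g \<Longrightarrow> continuous_on S (\<lambda>x. ip (f x) (g x))"
  by (rule bilinear_continuous_on[OF ip_bilinear])

text \<open>Dividing by the power of \<open>ip\<close> makes f invariant under scaling. The quotient
  is minimised on the Euclidean unit sphere, which is compact, and the minimiser is then rescaled to
  \<open>ip\<close>-length one.\<close>

lemma homogeneous_minimum:
  fixes f :: "'a \<Rightarrow> real"
  assumes "closed C" and cone: "\<And>x t. x \<in> C \<Longrightarrow> t > 0 \<Longrightarrow> t *\<^sub>R x \<in> C"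
    and "w \<in> C" "w \<noteq> 0" and cont: "continuous_on UNIV f"
    and hom: "\<And>t x. f (t *\<^sub>R x) = t ^ (2 * k) * f x"
  shows "\<exists>x m. x \<in> C \<and> ip x x = 1 \<and> f x = m \<and> (\<forall>z\<in>C. m * ip z z ^ k \<le> f z)"
proof -
  define g where "g x = f x / ip x x ^ k" for x
  have "compact (sphere 0 1 \<inter> C)" using assms(1) by (simp add: compact_Int_closed)
  moreover have "(1 / norm w) *\<^sub>R w \<in> sphere 0 1 \<inter> C" using assms(3,4) cone[of w "1 / norm w"] by auto
  moreover have "continuous_on (sphere 0 1 \<inter> C) g"
    unfolding g_def
    by (rule continuous_on_divide[OF continuous_on_subset[OF cont subset_UNIV]
          continuous_on_power[OF ip_continuous[OF continuous_on_id continuous_on_id]]])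
      (auto simp: ip_eq_zero_iff)
  ultimately obtain x0 where x0: "x0 \<in> sphere 0 1 \<inter> C" "\<And>z. z \<in> sphere 0 1 \<inter> C \<Longrightarrow> g x0 \<le> g z"
    using continuous_attains_inf[of "sphere 0 1 \<inter> C" g] by blast
  have ghom: "g (t *\<^sub>R z) = g z" if "t > 0" for t z
    unfolding g_def hom using that by (simp add: ip_simps power_mult power_mult_distrib power2_eq_square)
  have x0n: "x0 \<noteq> 0" using x0(1) by auto
  define x where "x = (1 / sqrt (ip x0 x0)) *\<^sub>R x0"
  have p: "ip x0 x0 > 0" using ip_pos[OF x0n] .
  have xx: "ip x x = 1" unfolding x_def using p by (simp add: ip_simps)
  have gx: "f x = g x0" using ghom[of "1 / sqrt (ip x0 x0)" x0] p xx unfolding x_def[symmetric] by (simp add: g_def)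
  have "f x * ip z z ^ k \<le> f z" if z: "z \<in> C" for z
  proof (cases "z = 0")
    case True
    have "f 0 = 0 ^ (2*k) * f 0" using hom[of 0 0] unfolding scaleR_zero_left .
    show ?thesis
    \<comment> \<open>For k = 0 the factor \<open>ip z z ^ k\<close> is 1 even at z = 0, and f is
      constant along rays including the origin.\<close>
    proof (cases "k = 0")
      case True
      have "f 0 = f x" using hom[of 0 x] True by simp
      with True \<open>z = 0\<close> show ?thesis by simp
    next
      case False
      then have "(0::real) ^ (2 * k) = 0" by simp
      with \<open>f 0 = 0 ^ (2*k) * f 0\<close> have "f 0 = 0" by (metis mult_zero_left)
      with False \<open>z = 0\<close> show ?thesis by (simp add: ip_simps power_0_left)
    qed
  next
    case False
    have "g x0 \<le> g ((1 / norm z) *\<^sub>R z)" using False z cone[of z "1 / norm z"] by (intro x0(2)) auto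
    also have "\<dots> = g z" using False by (intro ghom) auto
    finally have "f x \<le> f z / ip z z ^ k" using gx by (simp add: g_def)
    then show ?thesis using ip_pos[OF False] by (simp add: field_simps)
  qed
  moreover have "x \<in> C" unfolding x_def using cone[of x0 "1 / sqrt (ip x0 x0)"] x0 p by auto
  ultimately show ?thesis using xx by blast
qed

subsection \<open>Self-adjoint operators\<close>

text \<open>A minimiser x of the Rayleigh quotient is an eigenvector: the residual
  \<open>f x - m x\<close> is itself an admissible direction, and the first-order term in that
  direction is twice its squared length.\<close>

lemma selfadjoint_has_eigenvector:
  assumes "linear f" and sa: "\<And>x y. ip (f x) y = ip x (f y)"
    and W: "subspace W" "\<And>x. x \<in> W \<Longrightarrow> f x \<in> W" "W \<noteq> {0}"
  shows "\<exists>v\<in>W. \<exists>s. v \<noteq> 0 \<and> f v = s *\<^sub>R v"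
proof -
  obtain w where w: "w \<in> W" "w \<noteq> 0" using W(1,3) subspace_0 by blast
  have "\<exists>x m. x \<in> W \<and> ip x x = 1 \<and> ip (f x) x = m \<and> (\<forall>z\<in>W. m * ip z z ^ 1 \<le> ip (f z) z)"
  proof (rule homogeneous_minimum[OF _ _ w])
    show "closed W" using W(1) by (rule closed_subspace)
    show "continuous_on UNIV (\<lambda>x. ip (f x) x)"
      by (rule ip_continuous[OF linear_continuous_on continuous_on_id])
        (use assms(1) linear_conv_bounded_linear in blast)
    show "ip (f (t *\<^sub>R x)) (t *\<^sub>R x) = t ^ (2 * 1) * ip (f x) x" for t x
      using assms(1) by (simp add: linear_scale ip_simps power2_eq_square)
  qed (use W(1) subspace_scale in blast)
  then obtain x m where x: "x \<in> W" "ip x x = 1" "ip (f x) x = m"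
    and m: "\<And>z. z \<in> W \<Longrightarrow> m * ip z z \<le> ip (f z) z" by auto
  define d where "d = f x - m *\<^sub>R x"
  have dW: "d \<in> W" unfolding d_def using W x by (simp add: subspace_diff subspace_scale)
  have "0 \<le> (2 * ip d d) * t + (ip (f d) d - m * ip d d) * t\<^sup>2" for t
  proof -
    have "m * ip (x + t *\<^sub>R d) (x + t *\<^sub>R d) \<le> ip (f (x + t *\<^sub>R d)) (x + t *\<^sub>R d)"
      using m W(1) x(1) dW subspace_add subspace_scale by blast
    moreover have "ip (f d) x = ip (f x) d" by (metis sa ip_commute)
    moreover have "ip (f x) d = ip d d + m * ip x d"
    proof -
      have "f x = d + m *\<^sub>R x" by (simp add: d_def)
      then show ?thesis by (simp only: ip_simps)
    qed
    ultimately show ?thesis using x(2,3) assms(1)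
      by (simp add: linear_add linear_scale ip_simps power2_eq_square algebra_simps ip_commute[of d x])
  qed
  then have "2 * ip d d = 0" by (rule linear_term_zero)
  then have "d = 0" by (simp add: ip_eq_zero_iff)
  then have "f x = m *\<^sub>R x" by (simp add: d_def)
  moreover have "x \<noteq> 0" using x(2) ip_zero_left[of 0] by auto
  ultimately show ?thesis using x(1) by blast
qed

lemma selfadjoint_span_eigenvectors:
  assumes "linear f" and sa: "\<And>x y. ip (f x) y = ip x (f y)"
  shows "span {v. \<exists>s. f v = s *\<^sub>R v} = UNIV"
proof (rule ccontr)
  define E where "E = span {v. \<exists>s. f v = s *\<^sub>R v}"
  define W where "W = {x. \<forall>v\<in>E. ip x v = 0}"
  assume "span {v. \<exists>s. f v = s *\<^sub>R v} \<noteq> UNIV"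
  then obtain x where x: "x \<notin> E" unfolding E_def by blast
  have sE: "subspace E" by (simp add: E_def)
  have fE: "f v \<in> E" if "v \<in> E" for v
    using that unfolding E_def
  proof (induction rule: span_induct_alt)
    case base
    show ?case using assms(1) by (simp add: linear_0 span_zero)
  next
    case (step c x y)
    then obtain s where s: "f x = s *\<^sub>R x" by blast
    have "x \<in> span {v. \<exists>s. f v = s *\<^sub>R v}" using step(1) by (rule span_base)
    moreover have "f (c *\<^sub>R x + y) = (c * s) *\<^sub>R x + f y" using assms(1) s by (simp add: linear_add linear_scale)
    ultimately show ?case using step(2) by (simp add: span_add span_scale)
  qed
  have "subspace W" unfolding W_def subspace_def by (auto simp: ip_simps)
  moreover have "f x \<in> W" if "x \<in> W" for x using that fE by (auto simp: W_def sa)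
  moreover have "W \<noteq> {0}"
  proof -
    have "x - proj E x \<in> W" using proj_perp[OF sE] by (auto simp: W_def)
    moreover have "x - proj E x \<noteq> 0" using x proj_in[OF sE, of x] by auto
    ultimately show ?thesis by blast
  qed
  ultimately obtain v s where v: "v \<in> W" "v \<noteq> 0" "f v = s *\<^sub>R v"
    using selfadjoint_has_eigenvector[OF assms, of W] by blast
  then have "v \<in> E" by (auto simp: E_def intro: span_base)
  then have "ip v v = 0" using v(1) by (auto simp: W_def)
  then show False using v(2) ip_eq_zero_iff by blast
qed

text \<open>Components are indexed by their own eigenvalues. Distinct indices are thus orthogonal
  automatically, and extreme components are those at \<open>Max S\<close> and
  \<open>Min S\<close>.\<close>

lemma eigen_decomposition:
  assumes "linear f" and sa: "\<And>x y. ip (f x) y = ip x (f y)"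
  obtains S c where "finite S" "x = (\<Sum>s\<in>S. c s)" "\<And>s. s \<in> S \<Longrightarrow> f (c s) = s *\<^sub>R c s"
    "\<And>s. s \<in> S \<Longrightarrow> c s \<noteq> 0"
proof -
  have "x \<in> span {v. \<exists>s. f v = s *\<^sub>R v}" using selfadjoint_span_eigenvectors[OF assms] by blast
  then have "\<exists>S c. finite S \<and> x = (\<Sum>s\<in>S. c s) \<and> (\<forall>s\<in>S. f (c s) = s *\<^sub>R c s)"
  proof (induction rule: span_induct_alt)
    case base
    show ?case by (rule exI[of _ "{}"]) auto
  next
    case (step k v y)
    obtain r where r: "f v = r *\<^sub>R v" using step by blast
    obtain S c where S: "finite S" "y = (\<Sum>s\<in>S. c s)" "\<forall>s\<in>S. f (c s) = s *\<^sub>R c s" using step by blast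
    define c' where "c' s = (if s \<in> S then c s else 0) + (if s = r then k *\<^sub>R v else 0)" for s
    have "(\<Sum>s\<in>insert r S. c' s) = y + k *\<^sub>R v"
      unfolding c'_def sum.distrib using S(1,2)
      by (simp add: sum.inter_restrict[symmetric] sum.If_cases Int_absorb1 subset_insertI)
    moreover have "f (c' s) = s *\<^sub>R c' s" if "s \<in> insert r S" for s
      using S(3) r assms(1) by (auto simp: c'_def linear_add linear_scale linear_0 scaleR_add_right)
    ultimately show ?case using S(1) by (intro exI[of _ "insert r S"] exI[of _ c']) (auto simp: add.commute)
  qed
  then obtain S c where S: "finite S" "x = (\<Sum>s\<in>S. c s)" "\<forall>s\<in>S. f (c s) = s *\<^sub>R c s" by blast
  show ?thesis
  proof (rule that[of "{s\<in>S. c s \<noteq> 0}" c])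
    show "x = (\<Sum>s\<in>{s \<in> S. c s \<noteq> 0}. c s)" unfolding S(2) using S(1)
      by (intro sum.mono_neutral_right) auto
  qed (use S in auto)
qed

lemma eigenvectors_orthogonal:
  assumes "\<And>x y. ip (f x) y = ip x (f y)" "f v = s *\<^sub>R v" "f w = t *\<^sub>R w" "s \<noteq> t"
  shows "ip v w = 0"
  using assms(1)[of v w] assms(2-4) by (simp add: ip_simps)

subsection \<open>Orthonormal bases and traces of nilpotent operators\<close>

definition orthonormal_set :: "'a set \<Rightarrow> bool" where
  "orthonormal_set E \<longleftrightarrow> finite E \<and> (\<forall>e\<in>E. \<forall>e'\<in>E. ip e e' = (if e = e' then 1 else 0))"

lemma orthonormal_ip_sum:
  assumes "orthonormal_set E" "e \<in> E"
  shows "ip (\<Sum>x\<in>E. k x *\<^sub>R x) e = k e"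
proof -
  have "ip (\<Sum>x\<in>E. k x *\<^sub>R x) e = (\<Sum>x\<in>E. if x = e then k x else 0)"
    unfolding ip_sum_left using assms by (intro sum.cong) (auto simp: orthonormal_set_def ip_simps)
  also have "\<dots> = k e" using assms by (simp add: orthonormal_set_def)
  finally show ?thesis .
qed

lemma orthonormal_independent: assumes "orthonormal_set E" shows "independent E"
proof -
  have "k e = 0" if "(\<Sum>x\<in>E. k x *\<^sub>R x) = 0" "e \<in> E" for k e
    using orthonormal_ip_sum[OF assms that(2), of k] that by (simp add: ip_simps)
  then show ?thesis using assms independent_explicit unfolding orthonormal_set_def by blast
qed

lemma orthonormal_expand:
  assumes "orthonormal_set E" "x \<in> span E"
  shows "x = (\<Sum>e\<in>E. ip x e *\<^sub>R e)"
proof -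
  obtain k where "x = (\<Sum>e\<in>E. k e *\<^sub>R e)"
    using assms span_finite[of E] by (auto simp: orthonormal_set_def)
  then show ?thesis using orthonormal_ip_sum[OF assms(1), of _ k] by simp
qed

lemma orthonormal_extend:
  assumes "orthonormal_set E" "E \<subseteq> W" "subspace W"
  obtains E' where "orthonormal_set E'" "E \<subseteq> E'" "span E' = W"
proof -
  define P where "P F \<longleftrightarrow> orthonormal_set F \<and> E \<subseteq> F \<and> F \<subseteq> W" for F
  have "P E" using assms by (simp add: P_def)
  moreover have "card F \<le> DIM('a)" if "P F" for F
    using independent_card_le[OF orthonormal_independent] that by (simp add: P_def)
  ultimately obtain F where F: "P F" "\<And>F'. P F' \<Longrightarrow> card F' \<le> card F"
    using ex_has_greatest_nat[of P E card "Suc DIM('a)"] le_imp_less_Suc by metis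
  have "span F = W"
  proof (rule ccontr)
    assume "span F \<noteq> W"
    moreover have "span F \<subseteq> W" using F(1) assms(3) by (simp add: P_def span_minimal)
    ultimately obtain x where x: "x \<in> W" "x \<notin> span F" by blast
    define d where "d = x - proj (span F) x"
    have d0: "d \<noteq> 0" using x proj_in[of "span F" x] by (auto simp: d_def)
    have dW: "d \<in> W" using x \<open>span F \<subseteq> W\<close> proj_in[of "span F" x] assms(3) by (auto simp: d_def intro: subspace_diff)
    have dF: "ip d v = 0" if "v \<in> F" for v
      unfolding d_def using proj_perp[of "span F" v x] that by (simp add: span_base)
    define e where "e = (1 / sqrt (ip d d)) *\<^sub>R d"
    have ee: "ip e e = 1" using ip_pos[OF d0] by (simp add: e_def ip_simps)
    have eF: "ip e v = 0" "ip v e = 0" if "v \<in> F" for v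
      using dF[OF that] by (auto simp: e_def ip_simps ip_commute[of v])
    have "e \<notin> F" using ee eF by auto
    have "P (insert e F)"
      using F(1) ee eF dW assms(3) \<open>e \<notin> F\<close> by (auto simp: P_def orthonormal_set_def e_def subspace_scale)
    then have "card (insert e F) \<le> card F" by (rule F(2))
    then show False using \<open>e \<notin> F\<close> F(1) by (simp add: P_def orthonormal_set_def)
  qed
  then show ?thesis using that F(1) unfolding P_def by blast
qed

lemma nilpotent_traceless_basis:
  assumes "linear f" "\<And>x. (f ^^ n) x = 0" "subspace W" "f ` W \<subseteq> W"
  shows "\<exists>E. orthonormal_set E \<and> span E = W \<and> (\<forall>e\<in>E. ip (f e) e = 0)"
  using assms(3,4)
proof (induction "dim W" arbitrary: W rule: less_induct)
  case less
  show ?case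
  proof (cases "f ` W = W")
    case True
    have "(f ^^ k) ` W = W" for k
    proof (induction k)
      case (Suc k)
      have "(f ^^ Suc k) ` W = f ` ((f ^^ k) ` W)" by (simp add: image_comp)
      then show ?case by (simp only: Suc True)
    qed simp
    then have "W = (f ^^ n) ` W" by simp
    also have "\<dots> \<subseteq> {0}" using assms(2) by auto
    finally have "W \<subseteq> {0}" .
    then have "W = {0}" using less.prems(1) subspace_0 by blast
    then show ?thesis by (intro exI[of _ "{}"]) (simp add: orthonormal_set_def)
  next
    case False
    have s: "subspace (f ` W)" using assms(1) less.prems(1) by (rule linear_subspace_image)
    have "dim (f ` W) < dim W"
      using False less.prems s by (intro dim_psubset) (metis span_eq_iff psubsetI)
    then obtain E where E: "orthonormal_set E" "span E = f ` W" "\<forall>e\<in>E. ip (f e) e = 0"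
      using less.hyps[OF _ s] less.prems by blast
    have "E \<subseteq> W" using E(2) less.prems(2) span_superset by blast
    then obtain E' where E': "orthonormal_set E'" "E \<subseteq> E'" "span E' = W"
      using orthonormal_extend[OF E(1) _ less.prems(1)] by blast
    have "ip (f e) e = 0" if "e \<in> E'" for e
    proof (cases "e \<in> E")
      case False
      have "f e \<in> span E" using that E'(3) E(2) span_base by blast
      then show ?thesis
        by (rule ip_span_zero) (use False that E' in \<open>auto simp: orthonormal_set_def\<close>)
    qed (use E in auto)
    then show ?thesis using E' by blast
  qed
qed

lemma trace_commute:
  assumes "linear f" "linear g" "orthonormal_set E" "span E = UNIV"
  shows "(\<Sum>e\<in>E. ip (f (g e)) e) = (\<Sum>e\<in>E. ip (g (f e)) e)"
proof -
  have ex: "ip (f (g e)) e = (\<Sum>e'\<in>E. ip (g e) e' * ip (f e') e)" if "linear f" for f g e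
  proof -
    have "g e = (\<Sum>e'\<in>E. ip (g e) e' *\<^sub>R e')" by (rule orthonormal_expand) (simp_all add: assms(3,4))
    then have "f (g e) = f (\<Sum>e'\<in>E. ip (g e) e' *\<^sub>R e')" by (rule arg_cong)
    also have "\<dots> = (\<Sum>e'\<in>E. ip (g e) e' *\<^sub>R f e')" using that by (simp add: linear_sum linear_scale)
    finally have "f (g e) = (\<Sum>e'\<in>E. ip (g e) e' *\<^sub>R f e')" .
    then show ?thesis by (simp add: ip_sum_left ip_simps)
  qed
  have "(\<Sum>e\<in>E. ip (f (g e)) e) = (\<Sum>e\<in>E. \<Sum>e'\<in>E. ip (g e) e' * ip (f e') e)"
    by (intro sum.cong refl ex assms(1))
  also have "\<dots> = (\<Sum>e'\<in>E. \<Sum>e\<in>E. ip (g e) e' * ip (f e') e)" by (rule sum.swap)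
  also have "\<dots> = (\<Sum>e'\<in>E. ip (g (f e')) e')"
    using ex[OF assms(2), where g=f] by (simp only: mult.commute)
  finally show ?thesis .
qed

end

section \<open>The exponential of the adjoint representation\<close>

lemma funpow_scaleR_linear:
  fixes f :: "'a::real_vector \<Rightarrow> 'a"
  assumes "linear f"
  shows "((\<lambda>x. t *\<^sub>R f x) ^^ n) x = t ^ n *\<^sub>R (f ^^ n) x"
  by (induction n) (simp_all add: linear_scale[OF assms])

lemma exp_ad_summable_norm:
  fixes br :: "'a::euclidean_space \<Rightarrow> 'a \<Rightarrow> 'a"
  assumes "bilinear br"
  shows "summable (\<lambda>n. norm ((br X ^^ n) Y /\<^sub>R fact n))"
proof -
  have "linear (br X)" using assms by (simp add: bilinear_def)
  then obtain K where K: "K > 0" "\<And>x. norm (br X x) \<le> K * norm x" using linear_bounded_pos by blast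
  have b: "norm ((br X ^^ n) Y) \<le> K ^ n * norm Y" for n
  proof (induction n)
    case (Suc n)
    have "norm ((br X ^^ Suc n) Y) \<le> K * norm ((br X ^^ n) Y)" using K(2) by simp
    also have "\<dots> \<le> K * (K ^ n * norm Y)" using Suc K(1) by simp
    finally show ?case by (simp add: mult.assoc)
  qed simp
  have "summable (\<lambda>n. (K ^ n /\<^sub>R fact n) * norm Y)"
    by (intro summable_mult2 summable_exp_generic)
  then show ?thesis
  proof (rule summable_comparison_test'[where N=0])
    show "norm (norm ((br X ^^ n) Y /\<^sub>R fact n)) \<le> K ^ n /\<^sub>R fact n * norm Y" if "n \<ge> 0" for n
      using b[of n] by (simp add: mult.assoc mult_left_mono)
  qed
qed

lemmas exp_ad_summable = exp_ad_summable_norm[THEN summable_norm_cancel]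

lemma exp_ad_linear:
  fixes br :: "'a::euclidean_space \<Rightarrow> 'a \<Rightarrow> 'a"
  assumes "bilinear br"
  shows "linear (exp_ad br X)"
proof -
  have l: "linear (br X ^^ n)" for n
  proof (induction n)
    case (Suc n)
    have "linear (br X)" using assms by (simp add: bilinear_def)
    from linear_compose[OF Suc this] show ?case by (simp add: o_def)
  qed (simp add: linear_id id_def[symmetric])
  show ?thesis
  proof (rule linearI)
    show "exp_ad br X (x + y) = exp_ad br X x + exp_ad br X y" for x y
      unfolding exp_ad_def
      by (subst suminf_add[OF exp_ad_summable exp_ad_summable, OF assms assms])
        (simp add: linear_add[OF l] scaleR_add_right)
    show "exp_ad br X (c *\<^sub>R x) = c *\<^sub>R exp_ad br X x" for c x
      unfolding exp_ad_def
      using suminf_scaleR_right[OF exp_ad_summable[OF assms], of c X x]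
      by (simp add: linear_scale[OF l] mult.commute)
  qed
qed

lemma exp_ad_power_series:
  fixes br :: "'a::euclidean_space \<Rightarrow> 'a \<Rightarrow> 'a"
  assumes "bilinear br"
  shows "exp_ad br (t *\<^sub>R X) Y = (\<Sum>n. t ^ n *\<^sub>R ((br X ^^ n) Y /\<^sub>R fact n))"
proof -
  have "br (t *\<^sub>R X) = (\<lambda>x. t *\<^sub>R br X x)" using assms by (auto simp: bilinear_lmul)
  moreover have "linear (br X)" using assms by (simp add: bilinear_def)
  ultimately show ?thesis unfolding exp_ad_def by (simp add: funpow_scaleR_linear mult.commute)
qed

text \<open>The series from degree two on is bounded by a constant times the square of t for t in
  [-1, 1], which leaves the linear term as derivative.\<close>

lemma exp_ad_has_vector_derivative:
  fixes br :: "'a::euclidean_space \<Rightarrow> 'a \<Rightarrow> 'a"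
  assumes "bilinear br"
  shows "((\<lambda>t. exp_ad br (t *\<^sub>R X) Y) has_vector_derivative br X Y) (at 0)"
proof -
  define a where "a n = (br X ^^ n) Y /\<^sub>R fact n" for n
  have sa: "summable (\<lambda>n. norm (a (n + 2)))"
    unfolding a_def by (rule summable_ignore_initial_segment[OF exp_ad_summable_norm[OF assms]])
  define M where "M = (\<Sum>n. norm (a (n + 2)))"
  have est: "norm (exp_ad br (t *\<^sub>R X) Y - Y - t *\<^sub>R br X Y) \<le> t\<^sup>2 * M" if t: "\<bar>t\<bar> \<le> 1" for t
  proof -
    have le: "norm (t ^ (n + 2) *\<^sub>R a (n + 2)) \<le> t\<^sup>2 * norm (a (n + 2))" for n
    proof -
      have "\<bar>t\<bar> ^ n * (t\<^sup>2 * norm (a (n+2))) \<le> 1 * (t\<^sup>2 * norm (a (n+2)))"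
        using t by (intro mult_right_mono power_le_one) auto
      moreover have "norm (t ^ (n + 2) *\<^sub>R a (n + 2)) = \<bar>t\<bar> ^ n * (t\<^sup>2 * norm (a (n+2)))"
        by (simp only: norm_scaleR power_add abs_mult power_abs mult.assoc power2_abs)
      ultimately show ?thesis by (simp only: mult_1)
    qed
    have sn: "summable (\<lambda>n. norm (t ^ (n + 2) *\<^sub>R a (n + 2)))"
      by (rule summable_comparison_test'[OF summable_mult[OF sa, of "t\<^sup>2"], where N=0]) (use le in auto)
    have "summable (\<lambda>n. t ^ n *\<^sub>R a n)"
      using summable_norm_cancel[OF sn] summable_iff_shift[of "\<lambda>n. t ^ n *\<^sub>R a n" 2] by simp
    then have "exp_ad br (t *\<^sub>R X) Y = (\<Sum>n. t ^ (n + 2) *\<^sub>R a (n + 2)) + (\<Sum>i<2. t ^ i *\<^sub>R a i)"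
      unfolding exp_ad_power_series[OF assms] a_def[symmetric] by (rule suminf_split_initial_segment)
    also have "(\<Sum>i<2. t ^ i *\<^sub>R a i) = Y + t *\<^sub>R br X Y" by (simp add: numeral_2_eq_2 a_def)
    finally have "exp_ad br (t *\<^sub>R X) Y - Y - t *\<^sub>R br X Y = (\<Sum>n. t ^ (n + 2) *\<^sub>R a (n + 2))" by simp
    also have "norm \<dots> \<le> (\<Sum>n. norm (t ^ (n + 2) *\<^sub>R a (n + 2)))" by (rule summable_norm[OF sn])
    also have "\<dots> \<le> (\<Sum>n. t\<^sup>2 * norm (a (n + 2)))"
      by (rule suminf_le[OF le sn summable_mult[OF sa]])
    also have "\<dots> = t\<^sup>2 * M" unfolding M_def by (rule suminf_mult[OF sa])
    finally show ?thesis .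
  qed
  have e0: "exp_ad br (0 *\<^sub>R X) Y = Y" using est[of 0] by simp
  have "((\<lambda>t. norm (exp_ad br (t *\<^sub>R X) Y - Y - t *\<^sub>R br X Y) / norm t) \<longlongrightarrow> 0) (at 0)"
  proof (rule tendsto_sandwich[of "\<lambda>_. 0" _ _ "\<lambda>t. \<bar>t\<bar> * M"])
    show "\<forall>\<^sub>F t in at 0. norm (exp_ad br (t *\<^sub>R X) Y - Y - t *\<^sub>R br X Y) / norm t \<le> \<bar>t\<bar> * M"
    proof -
      have "\<forall>\<^sub>F t in at (0::real). \<bar>t\<bar> < 1 \<and> t \<noteq> 0"
        unfolding eventually_at by (intro exI[of _ 1]) auto
      then show ?thesis
      proof eventually_elim
        case (elim t)
        then have "norm (exp_ad br (t *\<^sub>R X) Y - Y - t *\<^sub>R br X Y) / norm t \<le> t\<^sup>2 * M / \<bar>t\<bar>"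
          using est[of t] by (simp add: divide_right_mono)
        also have "\<dots> = \<bar>t\<bar> * M" using elim by (simp add: power2_eq_square abs_if)
        finally show ?case .
      qed
    qed
    show "((\<lambda>t. \<bar>t\<bar> * M) \<longlongrightarrow> 0) (at 0)" by (auto intro!: tendsto_eq_intros)
  qed auto
  then show ?thesis
    unfolding has_vector_derivative_def has_derivative_at using e0 by (simp add: bounded_linear_scaleR_left)
qed

lemma exp_ad_in_subspace:
  fixes br :: "'a::euclidean_space \<Rightarrow> 'a \<Rightarrow> 'a"
  assumes "bilinear br" "subspace W" "\<And>w. w \<in> W \<Longrightarrow> br X w \<in> W" "Y \<in> W"
  shows "exp_ad br X Y \<in> W"
proof -
  have "(br X ^^ n) Y /\<^sub>R fact n \<in> W" for n
  proof -
    have "(br X ^^ n) Y \<in> W" by (induction n) (use assms in auto)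
    then show ?thesis using assms(2) by (simp add: subspace_scale)
  qed
  then have "(\<Sum>i<n. (br X ^^ i) Y /\<^sub>R fact i) \<in> W" for n using assms(2) by (simp add: subspace_sum)
  moreover have "(\<lambda>n. \<Sum>i<n. (br X ^^ i) Y /\<^sub>R fact i) \<longlonglongrightarrow> exp_ad br X Y"
    unfolding exp_ad_def by (rule summable_LIMSEQ[OF exp_ad_summable[OF assms(1)]])
  ultimately show ?thesis by (rule closed_sequentially[OF closed_subspace[OF assms(2)]])
qed

lemma exp_ad_eigenvector:
  fixes br :: "'a::euclidean_space \<Rightarrow> 'a \<Rightarrow> 'a"
  assumes "bilinear br" "br X Y = s *\<^sub>R Y"
  shows "exp_ad br X Y = exp s *\<^sub>R Y"
proof -
  have p: "(br X ^^ n) Y = s ^ n *\<^sub>R Y" for n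
    by (induction n) (use assms in \<open>simp_all add: bilinear_rmul\<close>)
  have "(\<lambda>n. (s ^ n /\<^sub>R fact n) *\<^sub>R Y) sums (exp s *\<^sub>R Y)"
    by (intro sums_scaleR_left exp_converges)
  then show ?thesis unfolding exp_ad_def p by (simp add: sums_iff)
qed

lemma exp_ad_zero:
  fixes br :: "'a::euclidean_space \<Rightarrow> 'a \<Rightarrow> 'a"
  assumes "bilinear br"
  shows "exp_ad br 0 Y = Y"
  using exp_ad_eigenvector[OF assms, of 0 Y 0] bilinear_lzero[OF assms] by simp

lemma exp_ad_two_terms:
  fixes br :: "'a::euclidean_space \<Rightarrow> 'a \<Rightarrow> 'a"
  assumes "bilinear br" "br X (br X Y) = 0"
  shows "exp_ad br X Y = Y + br X Y"
proof -
  have "(br X ^^ n) Y /\<^sub>R fact n = 0" if "n \<notin> {0, 1}" for n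
  proof -
    have "n \<noteq> 0" "n \<noteq> 1" using that by auto
    then have "2 \<le> n" by arith
    then obtain m where m: "n = Suc (Suc m)" using le_Suc_ex[of 2 n] by auto
    have "(br X ^^ m) 0 = 0" for m by (induction m) (use assms in \<open>auto simp: bilinear_rzero\<close>)
    then show ?thesis unfolding m funpow_Suc_right using assms(2) by simp
  qed
  then have "exp_ad br X Y = (\<Sum>n\<in>{0,1}. (br X ^^ n) Y /\<^sub>R fact n)"
    unfolding exp_ad_def by (intro suminf_finite) auto
  then show ?thesis by simp
qed

lemma exp_ad_sum_eigenvectors:
  fixes br :: "'a::euclidean_space \<Rightarrow> 'a \<Rightarrow> 'a"
  assumes "bilinear br" "\<And>s. s \<in> S \<Longrightarrow> br X (c s) = k s *\<^sub>R c s"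
  shows "exp_ad br (t *\<^sub>R X) (\<Sum>s\<in>S. c s) = (\<Sum>s\<in>S. exp (t * k s) *\<^sub>R c s)"
  unfolding linear_sum[OF exp_ad_linear[OF assms(1)]]
  by (intro sum.cong refl exp_ad_eigenvector[OF assms(1)])
    (use assms in \<open>simp add: bilinear_lmul\<close>)

text \<open>Flow along \<epsilon> X and divide by the growth rate of the dominant component: all
  other components decay, and a closed cone contains the limit. The sign of \<epsilon> decides
  whether the largest or the smallest eigenvalue dominates.\<close>

lemma extreme_component_in_cone:
  fixes br :: "'a::euclidean_space \<Rightarrow> 'a \<Rightarrow> 'a"
  assumes br: "bilinear br" and S: "finite S" "s0 \<in> S" "\<And>s. s \<in> S \<Longrightarrow> br X (c s) = k s *\<^sub>R c s"
    and max: "\<And>s. s \<in> S \<Longrightarrow> s \<noteq> s0 \<Longrightarrow> \<epsilon> * k s < \<epsilon> * k s0"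
    and C: "closed C" "\<And>x t. x \<in> C \<Longrightarrow> t > 0 \<Longrightarrow> t *\<^sub>R x \<in> C"
    and stable: "\<And>t. exp_ad br (t *\<^sub>R X) (\<Sum>s\<in>S. c s) \<in> C"
  shows "c s0 \<in> C"
proof -
  define u where "u n = exp (- (real n * (\<epsilon> * k s0))) *\<^sub>R exp_ad br ((real n * \<epsilon>) *\<^sub>R X) (\<Sum>s\<in>S. c s)" for n :: nat
  have uC: "u n \<in> C" for n unfolding u_def by (intro C(2) stable) simp
  have u: "u n = (\<Sum>s\<in>S. exp (real n * (\<epsilon> * k s - \<epsilon> * k s0)) *\<^sub>R c s)" for n
  proof -
    have "u n = (\<Sum>s\<in>S. exp (- (real n * (\<epsilon> * k s0))) *\<^sub>R (exp (real n * \<epsilon> * k s) *\<^sub>R c s))"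
      unfolding u_def using S(3) by (subst exp_ad_sum_eigenvectors[OF br, where k=k]) (auto simp: scaleR_sum_right)
    also have "\<dots> = (\<Sum>s\<in>S. exp (real n * (\<epsilon> * k s - \<epsilon> * k s0)) *\<^sub>R c s)"
      by (rule sum.cong) (simp_all add: exp_add[symmetric] algebra_simps)
    finally show ?thesis .
  qed
  have "(\<lambda>n. \<Sum>s\<in>S. exp (real n * (\<epsilon> * k s - \<epsilon> * k s0)) *\<^sub>R c s)
      \<longlonglongrightarrow> (\<Sum>s\<in>S. (if s = s0 then 1 else 0) *\<^sub>R c s)"
  proof (intro tendsto_sum tendsto_scaleR tendsto_const)
    fix s assume s: "s \<in> S"
    show "(\<lambda>n. exp (real n * (\<epsilon> * k s - \<epsilon> * k s0))) \<longlonglongrightarrow> (if s = s0 then 1 else 0)"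
    proof (cases "s = s0")
      case False
      define d where "d = \<epsilon> * k s - \<epsilon> * k s0"
      have "d < 0" using max[OF s False] by (simp add: d_def)
      then have "(\<lambda>n. exp d ^ n) \<longlonglongrightarrow> 0" by (intro LIMSEQ_power_zero) simp
      then show ?thesis using False by (simp add: d_def exp_of_nat_mult)
    qed simp
  qed
  moreover have "(\<Sum>s\<in>S. (if s = s0 then 1 else 0) *\<^sub>R c s) = c s0"
  proof -
    have "(\<Sum>s\<in>S. (if s = s0 then 1 else 0) *\<^sub>R c s) = (\<Sum>s\<in>S. if s = s0 then c s else 0)"
      by (rule sum.cong) auto
    then show ?thesis using S by simp
  qed
  ultimately have "u \<longlonglongrightarrow> c s0" unfolding u by simp
  with uC show ?thesis by (rule closed_sequentially[OF C(1)])
qed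

section \<open>Lie algebras with a Cartan involution\<close>

locale lie_cartan =
  fixes br :: "'a::euclidean_space \<Rightarrow> 'a \<Rightarrow> 'a" and \<theta> :: "'a \<Rightarrow> 'a" and B :: "'a \<Rightarrow> 'a \<Rightarrow> real"
  assumes lie: "lie_algebra br"
    and theta_linear: "linear \<theta>"
    and theta_theta [simp]: "\<theta> (\<theta> X) = X"
    and theta_br: "\<theta> (br X Y) = br (\<theta> X) (\<theta> Y)"
    and form: "cartan_form \<theta> B"
    and invariant: "B (br X Y) Z = - B Y (br X Z)"
begin

lemma br_bilinear: "bilinear br"
  using lie by (simp add: lie_algebra_def)

lemmas br_add_left = bilinear_ladd[OF br_bilinear]
  and br_add_right = bilinear_radd[OF br_bilinear]
  and br_scale_left = bilinear_lmul[OF br_bilinear]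
  and br_scale_right = bilinear_rmul[OF br_bilinear]
  and br_minus_left = bilinear_lneg[OF br_bilinear]
  and br_minus_right = bilinear_rneg[OF br_bilinear]
  and br_diff_left = bilinear_lsub[OF br_bilinear]
  and br_diff_right = bilinear_rsub[OF br_bilinear]
  and br_zero_left = bilinear_lzero[OF br_bilinear]
  and br_zero_right = bilinear_rzero[OF br_bilinear]
  and br_sum_left = bilinear_sum_left[OF br_bilinear]
  and br_sum_right = bilinear_sum_right[OF br_bilinear]

lemmas br_simps = br_add_left br_add_right br_scale_left br_scale_right br_minus_left
  br_minus_right br_diff_left br_diff_right br_zero_left br_zero_right

lemma br_linear_right: "linear (br X)" and br_linear_left: "linear (\<lambda>X. br X Y)"
  using br_bilinear by (simp_all add: bilinear_def)

lemma br_self [simp]: "br X X = 0"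
  using lie by (simp add: lie_algebra_def)

lemma br_anti: "br X Y = - br Y X"
proof -
  have "br (X + Y) (X + Y) = br X Y + br Y X"
    unfolding br_add_left br_add_right by simp
  then show ?thesis by (simp add: eq_neg_iff_add_eq_0)
qed

lemma jacobi: "br X (br Y Z) = br (br X Y) Z + br Y (br X Z)"
proof -
  have "br X (br Y Z) + br Y (br Z X) + br Z (br X Y) = 0"
    using lie by (simp add: lie_algebra_def)
  then show ?thesis using br_anti[of Z X] br_anti[of Z "br X Y"] by (simp add: br_simps algebra_simps)
qed

lemma jacobi_left: "br (br X Y) Z = br X (br Y Z) - br Y (br X Z)"
  using jacobi[of X Y Z] by simp

lemma form_bilinear: "bilinear B"
  using form by (simp add: cartan_form_def)

lemma form_commute: "B X Y = B Y X"
  using form by (simp add: cartan_form_def)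

lemmas form_simps = bilinear_ladd[OF form_bilinear] bilinear_radd[OF form_bilinear]
  bilinear_lmul[OF form_bilinear, simplified] bilinear_rmul[OF form_bilinear, simplified]
  bilinear_lneg[OF form_bilinear] bilinear_rneg[OF form_bilinear]
  bilinear_lsub[OF form_bilinear] bilinear_rsub[OF form_bilinear]
  bilinear_lzero[OF form_bilinear] bilinear_rzero[OF form_bilinear]

lemmas theta_simps = linear_add[OF theta_linear] linear_scale[OF theta_linear]
  linear_neg[OF theta_linear] linear_diff[OF theta_linear] linear_0[OF theta_linear]

lemma theta_eq_iff: "\<theta> X = \<theta> Y \<longleftrightarrow> X = Y"
  using theta_theta by metis

lemma theta_eq_0_iff: "\<theta> X = 0 \<longleftrightarrow> X = 0"
  using theta_eq_iff[of X 0] by (simp add: theta_simps)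

lemma form_theta_swap: "B (\<theta> X) Y = B X (\<theta> Y)"
  using form form_commute[of "\<theta> X" Y] by (simp add: cartan_form_def)

lemma form_right: "B X (br Y Z) = B (br X Y) Z"
  using invariant[of Y X Z] br_anti[of X Y] by (simp add: form_simps)

definition ip :: "'a \<Rightarrow> 'a \<Rightarrow> real" where "ip X Y = - B X (\<theta> Y)"

sublocale inner_form ip
proof
  show "bilinear ip"
    unfolding bilinear_def ip_def by (auto intro!: linearI simp: form_simps theta_simps)
  show "ip x y = ip y x" for x y
    using form by (simp add: ip_def cartan_form_def)
  show "x \<noteq> 0 \<Longrightarrow> 0 < ip x x" for x
    using form by (simp add: ip_def cartan_form_def)
qed

lemma form_eq_ip: "B X Y = - ip X (\<theta> Y)"
  by (simp add: ip_def)

lemma form_nondegenerate: "(\<And>Y. B X Y = 0) \<Longrightarrow> X = 0"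
  using ip_perp_all[of X] by (simp add: ip_def)

lemma ip_theta: "ip (\<theta> X) (\<theta> Y) = ip X Y"
  by (simp add: ip_def form_theta_swap)

text \<open>The adjoint of ad X is - ad(\<theta> X). Hence ad X is self-adjoint when \<theta> X = -
  X, and the kernel of ad(\<theta> X) is orthogonal to the image of ad X.\<close>

lemma ip_br: "ip (br X Y) Z = - ip Y (br (\<theta> X) Z)"
  by (simp add: ip_def invariant theta_br)

lemma ip_br_minus: "\<theta> A = - A \<Longrightarrow> ip (br A X) Y = ip X (br A Y)"
  by (simp add: ip_br br_simps ip_simps)

text \<open>A fragment of the Jacobson-Morozov theorem, proved by traces. Let R be the part of X
  orthogonal to [g, X] and Z = \<theta> R. The trace of ad R ad Z vanishes, but it is also minus the
  squared norm of ad Z. So Z is central; R lies in the derived algebra, to which the centre is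
  B-orthogonal, and hence R = 0.\<close>

lemma nilpotent_eq_bracket:
  assumes X: "lie_nilpotent br X"
  obtains D where "br D X = X"
proof -
  from X obtain n where Xs: "X \<in> span {br Y Z | Y Z. True}" and n: "\<And>Y. (br X ^^ n) Y = 0"
    by (auto simp: lie_nilpotent_def)
  define W where "W = range (\<lambda>D. br D X)"
  have W: "subspace W" unfolding W_def using linear_subspace_image[OF br_linear_left subspace_UNIV] .
  define R where "R = X - proj W X"
  obtain D where D: "proj W X = br D X" using proj_in[OF W, of X] by (auto simp: W_def)
  define Z where "Z = \<theta> R"
  have XZ: "br X Z = 0"
  proof (rule form_nondegenerate)
    fix Y
    have "ip R (br Y X) = 0" unfolding R_def by (rule proj_perp[OF W]) (simp add: W_def)
    then have "B (br Y X) Z = 0" using ip_commute[of R "br Y X"] by (simp add: ip_def Z_def)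
    then show "B (br X Z) Y = 0" by (simp add: form_right[symmetric] form_commute[of _ Y])
  qed
  have comm: "br X (br Z Y) = br Z (br X Y)" for Y
    using jacobi[of X Z Y] XZ by (simp add: br_simps)
  define h where "h x = br X (br Z x)" for x
  have h_linear: "linear h"
    unfolding h_def by (intro linearI) (simp_all add: br_simps)
  have pow: "(br X ^^ k) (br Z Y) = br Z ((br X ^^ k) Y)" for k Y
    by (induction k) (simp_all add: comm)
  have "(h ^^ k) Y = (br Z ^^ k) ((br X ^^ k) Y)" for k Y
  proof (induction k arbitrary: Y)
    case (Suc k)
    have "(h ^^ Suc k) Y = (h ^^ k) (br Z (br X Y))" by (simp add: funpow_Suc_right h_def comm del: funpow.simps)
    also have "\<dots> = (br Z ^^ Suc k) ((br X ^^ Suc k) Y)"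
      unfolding Suc.IH by (simp only: funpow_Suc_right pow o_apply)
    finally show ?case .
  qed simp
  moreover have "(br Z ^^ k) 0 = 0" for k by (induction k) (simp_all add: br_simps)
  ultimately have hn: "(h ^^ n) Y = 0" for Y using n by simp
  obtain E where E: "orthonormal_set E" "span E = UNIV" "\<And>e. e \<in> E \<Longrightarrow> ip (h e) e = 0"
    using nilpotent_traceless_basis[OF h_linear hn subspace_UNIV] by auto
  \<comment> \<open>Since R = X - [D, X], the trace is that of h, which is zero, minus that of the
    commutator of ad D and ad X times ad Z. The latter vanishes by cyclicity and because ad Z
    commutes with ad X.\<close>
  have "(\<Sum>e\<in>E. ip (br R (br Z e)) e) = 0"
  proof -
    have "X = br D X + R" by (simp add: R_def D)
    then have he: "h e = br (br D X) (br Z e) + br R (br Z e)" for e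
      unfolding h_def by (metis br_add_left)
    have "br R (br Z e) = h e - (br D (h e) - br X (br D (br Z e)))" for e
    proof -
      have "br R (br Z e) = h e - br (br D X) (br Z e)" using he[of e] by simp
      also have "br (br D X) (br Z e) = br D (h e) - br X (br D (br Z e))"
        by (simp only: jacobi_left h_def)
      finally show ?thesis .
    qed
    then have "(\<Sum>e\<in>E. ip (br R (br Z e)) e)
        = (\<Sum>e\<in>E. ip (h e) e) - ((\<Sum>e\<in>E. ip (br D (h e)) e) - (\<Sum>e\<in>E. ip (br X (br D (br Z e))) e))"
      by (simp add: ip_simps sum_subtractf)
    also have "(\<Sum>e\<in>E. ip (br X (br D (br Z e))) e) = (\<Sum>e\<in>E. ip (br D (br Z (br X e))) e)"
      using trace_commute[OF br_linear_right[of X] linear_compose[OF br_linear_right br_linear_right, of D Z] E(1,2)]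
      by (simp add: o_def)
    also have "\<dots> = (\<Sum>e\<in>E. ip (br D (h e)) e)" by (simp add: h_def comm)
    finally show ?thesis using E(3) by simp
  qed
  then have "(\<Sum>e\<in>E. ip (br Z e) (br Z e)) = 0"
    by (simp add: ip_br[of R] Z_def sum_negf)
  then have "ip (br Z e) (br Z e) = 0" if "e \<in> E" for e
    using that E(1) ip_nonneg by (subst (asm) sum_nonneg_eq_0_iff) (auto simp: orthonormal_set_def)
  then have "br Z e = 0" if "e \<in> E" for e using that by (simp add: ip_eq_zero_iff)
  then have Zc: "br Z Y = 0" for Y
    using linear_eq_0_on_span[OF br_linear_right, of E Z Y] E(2) by simp
  have "B R' Z = 0" if "R' \<in> span {br Y Z | Y Z. True}" for R'
    using that
  proof (induction rule: span_induct_alt)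
    case (step c x y)
    then obtain P Q where "x = br P Q" by blast
    then have "B x Z = B P (br Q Z)" by (simp add: form_right)
    also have "br Q Z = 0" using Zc br_anti[of Q Z] by simp
    finally show ?case using step by (simp add: form_simps)
  qed (simp add: form_simps)
  moreover have "R \<in> span {br Y Z | Y Z. True}"
    unfolding R_def D by (intro span_diff Xs) (auto intro: span_base)
  ultimately have "ip R R = 0" by (simp add: ip_def Z_def)
  then have "R = 0" by (simp add: ip_eq_zero_iff)
  then show ?thesis using that[of D] by (simp add: R_def D)
qed

lemma centralizer_of_span:
  "x \<in> span S \<Longrightarrow> (\<And>s. s \<in> S \<Longrightarrow> br Z s = 0) \<Longrightarrow> br Z x = 0"
  using linear_eq_0_on_span[OF br_linear_right] by blast

end

text \<open>Taking the product of the vanishing sum with \<open>d t\<close> kills all other terms by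
  orthogonality. It serves to compare eigendecompositions component by component.\<close>

lemma (in inner_form) eigenvectors_sum_zero:
  assumes sa: "\<And>x y. ip (f x) y = ip x (f y)" and "finite S"
    and d: "\<And>s. s \<in> S \<Longrightarrow> f (d s) = s *\<^sub>R d s" and "(\<Sum>s\<in>S. d s) = 0" and "t \<in> S"
  shows "d t = 0"
proof -
  have "ip (d s) (d t) = (if s = t then ip (d t) (d t) else 0)" if "s \<in> S" for s
    using eigenvectors_orthogonal[OF sa d[OF that] d[OF \<open>t \<in> S\<close>]] by auto
  then have "ip (\<Sum>s\<in>S. d s) (d t) = (\<Sum>s\<in>S. if s = t then ip (d t) (d t) else 0)"
    unfolding ip_sum_left by (intro sum.cong) auto
  also have "\<dots> = ip (d t) (d t)" using assms by simp
  finally show ?thesis using assms(4) by (simp add: ip_simps ip_eq_zero_iff)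
qed

context lie_cartan begin

lemma span_lie_subalgebra:
  assumes "\<And>x y. x \<in> S \<Longrightarrow> y \<in> S \<Longrightarrow> br x y \<in> span S"
  shows "lie_subalgebra br (span S)"
  unfolding lie_subalgebra_def
proof (intro conjI ballI)
  fix x y assume x: "x \<in> span S" and y: "y \<in> span S"
  have "br s y \<in> span S" if "s \<in> S" for s
    using y by (induction rule: span_induct_alt)
      (auto simp: br_simps assms[OF that] intro!: span_add span_scale span_zero)
  with x show "br x y \<in> span S"
    by (induction rule: span_induct_alt) (auto simp: br_simps intro!: span_add span_scale span_zero)
qed simp

section \<open>Eigenspaces of ad A\<close>

definition gr :: "'a \<Rightarrow> real \<Rightarrow> 'a set" where "gr A s = {x. br A x = s *\<^sub>R x}"

lemma gr_subspace: "subspace (gr A s)"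
  by (auto simp: gr_def subspace_def br_simps algebra_simps)

lemma gr_br: "x \<in> gr A s \<Longrightarrow> y \<in> gr A t \<Longrightarrow> br x y \<in> gr A (s + t)"
  by (simp add: gr_def jacobi[of A] br_simps algebra_simps)

lemma gr_theta: "\<theta> A = - A \<Longrightarrow> x \<in> gr A s \<Longrightarrow> \<theta> x \<in> gr A (- s)"
proof -
  assume A: "\<theta> A = - A" and x: "x \<in> gr A s"
  have "br A (\<theta> x) = \<theta> (br (\<theta> A) x)" by (simp add: theta_br)
  also have "\<dots> = - (s *\<^sub>R \<theta> x)" using A x by (simp add: gr_def br_simps theta_simps)
  finally show ?thesis by (simp add: gr_def)
qed

lemma gr_orthogonal: "\<theta> A = - A \<Longrightarrow> x \<in> gr A s \<Longrightarrow> y \<in> gr A t \<Longrightarrow> s \<noteq> t \<Longrightarrow> ip x y = 0"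
  by (rule eigenvectors_orthogonal[of "br A" x s y t]) (auto simp: gr_def ip_br_minus)

end

section \<open>Pairs with a stable subalgebra\<close>

locale lie_pair = lie_cartan +
  fixes \<hh> :: "'a::euclidean_space set"
  assumes h_subalgebra: "lie_subalgebra br \<hh>" and h_theta_image: "\<theta> ` \<hh> = \<hh>"
begin

abbreviation "\<qq> \<equiv> perp B \<hh>"

lemma h_subspace: "subspace \<hh>"
  using h_subalgebra by (simp add: lie_subalgebra_def)

lemma h_br: "X \<in> \<hh> \<Longrightarrow> Y \<in> \<hh> \<Longrightarrow> br X Y \<in> \<hh>"
  using h_subalgebra by (simp add: lie_subalgebra_def)

lemma h_theta: "X \<in> \<hh> \<Longrightarrow> \<theta> X \<in> \<hh>"
  using h_theta_image by blast

text \<open>Stability of \<open>\<hh>\<close> under \<theta> makes the complement for B and the one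
  for \<open>ip\<close> coincide; therefore \<open>proj \<hh>\<close> is also the projection along
  \<open>\<qq>\<close>.\<close>

lemma q_iff_ip: "X \<in> \<qq> \<longleftrightarrow> (\<forall>Y\<in>\<hh>. ip X Y = 0)"
proof -
  have "X \<in> \<qq> \<longleftrightarrow> (\<forall>Y\<in>\<theta> ` \<hh>. B X Y = 0)" by (simp add: perp_def h_theta_image)
  then show ?thesis by (simp add: ip_def)
qed

lemma q_subspace: "subspace \<qq>"
  by (auto simp: perp_def subspace_def form_simps)

lemma q_theta: "X \<in> \<qq> \<Longrightarrow> \<theta> X \<in> \<qq>"
  by (auto simp: perp_def form_theta_swap h_theta)

lemma br_h_q: "X \<in> \<hh> \<Longrightarrow> Y \<in> \<qq> \<Longrightarrow> br X Y \<in> \<qq>"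
  by (simp add: perp_def invariant h_br)

lemma h_q_disjoint: "X \<in> \<hh> \<Longrightarrow> X \<in> \<qq> \<Longrightarrow> X = 0"
  using q_iff_ip ip_eq_zero_iff by blast

lemma proj_h_in: "proj \<hh> X \<in> \<hh>"
  by (rule proj_in[OF h_subspace])

lemma proj_q_in: "X - proj \<hh> X \<in> \<qq>"
  by (auto simp: q_iff_ip intro: proj_perp[OF h_subspace])

lemma proj_h_unique: "Y \<in> \<hh> \<Longrightarrow> X - Y \<in> \<qq> \<Longrightarrow> proj \<hh> X = Y"
  by (rule proj_unique[OF h_subspace]) (auto simp: q_iff_ip)

lemma proj_h_q: "X \<in> \<qq> \<Longrightarrow> proj \<hh> X = 0"
  by (rule proj_h_unique) (auto simp: subspace_0[OF h_subspace])

lemma proj_h_zero_iff: "proj \<hh> X = 0 \<longleftrightarrow> X \<in> \<qq>"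
  using proj_h_q proj_q_in[of X] by auto

lemma proj_h_theta: "proj \<hh> (\<theta> X) = \<theta> (proj \<hh> X)"
  using q_theta[OF proj_q_in[of X]] by (intro proj_h_unique) (auto simp: theta_simps h_theta proj_h_in)

lemma proj_h_br: "Z \<in> \<hh> \<Longrightarrow> proj \<hh> (br Z X) = br Z (proj \<hh> X)"
  using br_h_q[OF _ proj_q_in[of X]] by (intro proj_h_unique) (auto simp: br_simps h_br proj_h_in)

lemma proj_h_gr: "A \<in> \<hh> \<Longrightarrow> X \<in> gr A s \<Longrightarrow> proj \<hh> X \<in> gr A s"
  using proj_h_br[of A X] linear_scale[OF proj_linear[OF h_subspace]] by (simp add: gr_def)

text \<open>This turns the splitting condition of reduction (c) into stability under
  \<open>proj \<hh>\<close>, which can be checked on generators.\<close>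

lemma direct_sumI:
  assumes "subspace V" "\<And>x. x \<in> V \<Longrightarrow> proj \<hh> x \<in> V"
  shows "direct_sum V (V \<inter> \<hh>) (V \<inter> \<qq>)"
  unfolding direct_sum_def
proof (intro conjI equalityI subsetI)
  fix x assume x: "x \<in> V"
  then have "x - proj \<hh> x \<in> V \<inter> \<qq>" using assms subspace_diff proj_q_in by blast
  moreover have "proj \<hh> x \<in> V \<inter> \<hh>" using assms x proj_h_in by blast
  ultimately show "x \<in> {u + w |u w. u \<in> V \<inter> \<hh> \<and> w \<in> V \<inter> \<qq>}"
    by (intro CollectI exI[of _ "proj \<hh> x"] exI[of _ "x - proj \<hh> x"]) simp
next
  fix x assume "x \<in> {u + w |u w. u \<in> V \<inter> \<hh> \<and> w \<in> V \<inter> \<qq>}"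
  then show "x \<in> V" using assms(1) subspace_add by blast
next
  fix x assume "x \<in> V \<inter> \<hh> \<inter> (V \<inter> \<qq>)"
  then show "x \<in> {0}" using h_q_disjoint by blast
next
  fix x :: 'a assume "x \<in> {0}"
  then show "x \<in> V \<inter> \<hh> \<inter> (V \<inter> \<qq>)"
    using subspace_0[OF assms(1)] subspace_0[OF h_subspace] subspace_0[OF q_subspace] by simp
qed

lemma direct_sum_spanI:
  assumes "\<And>x. x \<in> S \<Longrightarrow> proj \<hh> x \<in> span S"
  shows "direct_sum (span S) (span S \<inter> \<hh>) (span S \<inter> \<qq>)"
proof (rule direct_sumI)
  fix x assume "x \<in> span S"
  then show "proj \<hh> x \<in> span S"
    by (induction rule: span_induct_alt)
      (auto simp: linear_0 linear_add linear_scale proj_linear[OF h_subspace] assms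
        intro!: span_add span_scale span_zero)
qed simp

lemma exp_ad_q: "Z \<in> \<hh> \<Longrightarrow> X \<in> \<qq> \<Longrightarrow> exp_ad br Z X \<in> \<qq>"
  by (rule exp_ad_in_subspace[OF br_bilinear q_subspace]) (auto simp: br_h_q)

end

text \<open>In the next locale \<open>\<CC>\<close> is the closure of the nilpotent orbit. The last assumption is minimality
  under the third reduction.\<close>

locale minimal_pair = lie_pair +
  fixes \<aa> \<CC> :: "'a::euclidean_space set"
  assumes a_max: "max_abelian_subspace br (minus_space \<theta> \<hh>) \<aa>"
    and C_closed: "closed \<CC>"
    and C_cone: "X \<in> \<CC> \<Longrightarrow> t > 0 \<Longrightarrow> t *\<^sub>R X \<in> \<CC>"
    and C_exp: "X \<in> \<CC> \<Longrightarrow> exp_ad br Z X \<in> \<CC>"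
    and C_derived: "\<CC> \<subseteq> span {br Y Z | Y Z. True}"
    and C_ideal: "lie_ideal br UNIV I \<Longrightarrow> \<CC> \<subseteq> I \<Longrightarrow> I = UNIV"
    and no_compact_ideal: "lie_ideal br \<hh> I \<Longrightarrow> (\<And>X. X \<in> I \<Longrightarrow> \<theta> X = X) \<Longrightarrow> X \<in> I \<Longrightarrow> X = 0"
    and C_not_fixed: "\<exists>v\<in>\<CC> \<inter> perp B \<hh>. \<exists>Z\<in>\<hh>. br Z v \<noteq> 0"
    and hull_UNIV: "cartan_form \<theta> B' \<Longrightarrow> (\<And>X Y Z. B' (br X Y) Z = - B' Y (br X Z)) \<Longrightarrow>
      X \<in> \<CC> \<inter> perp B' \<hh> \<Longrightarrow> X \<noteq> 0 \<Longrightarrow> linear \<mu> \<Longrightarrow> (\<And>Y. Y \<in> \<aa> \<Longrightarrow> br Y X = \<mu> Y *\<^sub>R X) \<Longrightarrow>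
      \<exists>Y\<in>\<aa>. \<mu> Y \<noteq> 0 \<Longrightarrow> lie_subalgebra br V \<Longrightarrow> direct_sum V (V \<inter> \<hh>) (V \<inter> perp B' \<hh>) \<Longrightarrow>
      \<aa> \<union> {X, \<theta> X} \<subseteq> V \<Longrightarrow> V = UNIV"
begin

section \<open>The maximal abelian subspace and its weight vectors\<close>

lemma a_subspace: "subspace \<aa>"
  and a_minus: "Y \<in> \<aa> \<Longrightarrow> Y \<in> \<hh>" "Y \<in> \<aa> \<Longrightarrow> \<theta> Y = - Y"
  and a_abelian: "Y \<in> \<aa> \<Longrightarrow> Z \<in> \<aa> \<Longrightarrow> br Y Z = 0"
  using a_max by (auto simp: max_abelian_subspace_def Let_def minus_space_def)

lemma a_maximal:
  assumes P: "P \<in> \<hh>" "\<theta> P = - P" "\<And>Y. Y \<in> \<aa> \<Longrightarrow> br P Y = 0"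
  shows "P \<in> \<aa>"
proof -
  define V where "V = span (insert P \<aa>)"
  have V: "\<exists>k. x - k *\<^sub>R P \<in> \<aa>" if "x \<in> V" for x
    using that a_subspace unfolding V_def span_breakdown_eq by (simp add: span_eq_iff[THEN iffD2])
  have "V \<subseteq> minus_space \<theta> \<hh>"
  proof
    fix x assume "x \<in> V"
    then obtain k where k: "x - k *\<^sub>R P \<in> \<aa>" using V by blast
    have "x = (x - k *\<^sub>R P) + k *\<^sub>R P" by simp
    then show "x \<in> minus_space \<theta> \<hh>"
      using a_minus[OF k] P(1,2) subspace_add[OF h_subspace _ subspace_scale[OF h_subspace], of "x - k *\<^sub>R P" P k]
      by (auto simp: minus_space_def theta_simps eq_neg_iff_add_eq_0 add.commute)
  qed
  moreover have "br x y = 0" if xy: "x \<in> V" "y \<in> V" for x y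
  proof -
    obtain k l where k: "x - k *\<^sub>R P \<in> \<aa>" "y - l *\<^sub>R P \<in> \<aa>" using V[OF xy(1)] V[OF xy(2)] by auto
    have "br x y = br (x - k *\<^sub>R P) (y - l *\<^sub>R P) + k *\<^sub>R br P (y - l *\<^sub>R P) + l *\<^sub>R br (x - k *\<^sub>R P) P"
      by (simp add: br_simps)
    then show ?thesis using k P(3) a_abelian br_anti[of "x - k *\<^sub>R P" P] by simp
  qed
  moreover have "\<aa> \<subseteq> V" "subspace V" by (auto simp: V_def intro: span_base)
  ultimately have "V = \<aa>" using a_max by (simp add: max_abelian_subspace_def Let_def)
  then show ?thesis by (auto simp: V_def intro: span_base)
qed

text \<open>The B-complement of a central Z is an ideal, and it contains the derived algebra, hence
  \<open>\<CC>\<close>. Minimality under (a) makes it everything, and B is non-degenerate.\<close>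

lemma center_trivial:
  assumes "\<And>Y. br Z Y = 0"
  shows "Z = 0"
proof -
  have s: "subspace {X. B X Z = 0}" by (auto simp: subspace_def form_simps)
  have c: "B (br X Y) Z = 0" for X Y using assms br_anti[of X Z] by (simp add: form_commute[of _ Z] form_right br_simps form_simps)
  have "lie_ideal br UNIV {X. B X Z = 0}"
    unfolding lie_ideal_def using s c by simp
  moreover have "\<CC> \<subseteq> {X. B X Z = 0}"
    by (rule subset_trans[OF C_derived span_minimal[OF _ s]]) (use c in auto)
  ultimately have "{X. B X Z = 0} = UNIV" by (rule C_ideal)
  then show ?thesis using form_nondegenerate[of Z] form_commute[of Z] by auto
qed

text \<open>The elements of \<open>\<hh>\<close> killing \<open>\<CC> \<inter> \<qq>\<close> form an ideal. If it contained \<open>\<aa>\<close>, a complement would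
  be a compact ideal by maximality of \<open>\<aa>\<close>.\<close>

lemma a_moves_C: "\<exists>w\<in>\<CC> \<inter> \<qq>. \<exists>Y\<in>\<aa>. br Y w \<noteq> 0"
proof (rule ccontr)
  assume neg: "\<not> ?thesis"
  define I where "I = {Y\<in>\<hh>. \<forall>w\<in>\<CC> \<inter> \<qq>. br Y w = 0 \<and> br (\<theta> Y) w = 0}"
  have aI: "\<aa> \<subseteq> I" using neg a_minus by (auto simp: I_def br_simps)
  have Isub: "subspace I"
    using h_subspace by (auto simp: I_def subspace_def br_simps theta_simps)
  \<comment> \<open>The curve exp(t ad Z) w stays in \<open>\<CC> \<inter> \<qq>\<close>, where Y
    acts by zero; differentiating at t = 0 gives the claim although \<open>\<CC>\<close> is not
    linear.\<close>
  have key: "br Y (br Z w) = 0"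
    if "w \<in> \<CC> \<inter> \<qq>" "Z \<in> \<hh>" "\<And>w. w \<in> \<CC> \<inter> \<qq> \<Longrightarrow> br Y w = 0" for Y Z w
  proof -
    have "((\<lambda>t. exp_ad br (t *\<^sub>R Z) w) has_vector_derivative br Z w) (at 0)"
      by (rule exp_ad_has_vector_derivative[OF br_bilinear])
    then have "((\<lambda>t. br Y (exp_ad br (t *\<^sub>R Z) w)) has_vector_derivative br Y (br Z w)) (at 0)"
      by (rule bounded_linear.has_vector_derivative[OF linear_conv_bounded_linear[THEN iffD1, OF br_linear_right]])
    moreover have "br Y (exp_ad br (t *\<^sub>R Z) w) = 0" for t
      using that C_exp exp_ad_q[of "t *\<^sub>R Z" w] h_subspace by (auto simp: subspace_scale)
    ultimately have "((\<lambda>t. 0) has_vector_derivative br Y (br Z w)) (at (0::real))" by simp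
    then show ?thesis using has_vector_derivative_const vector_derivative_unique_at by metis
  qed
  have Iid: "br Z Y \<in> I" if Z: "Z \<in> \<hh>" and Y: "Y \<in> I" for Z Y
  proof -
    have "br (br Z Y) w = 0" "br (br (\<theta> Z) (\<theta> Y)) w = 0" if w: "w \<in> \<CC> \<inter> \<qq>" for w
      using key[OF w Z, of Y] key[OF w h_theta[OF Z], of "\<theta> Y"] Y w
      by (auto simp: I_def jacobi_left br_simps)
    then show ?thesis using Z Y h_br by (auto simp: I_def theta_br)
  qed
  have It: "\<theta> Y \<in> I" if "Y \<in> I" for Y using that h_theta by (auto simp: I_def)
  define J where "J = {Z\<in>\<hh>. \<forall>Y\<in>I. B Z Y = 0}"
  have Jsub: "subspace J" using h_subspace by (auto simp: J_def subspace_def form_simps)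
  have Jt: "\<theta> Z \<in> J" if "Z \<in> J" for Z using that h_theta It by (auto simp: J_def form_theta_swap)
  have Jid: "br X Z \<in> J" if "X \<in> \<hh>" "Z \<in> J" for X Z
    using that h_br Iid by (auto simp: J_def invariant)
  have IJ: "Z = 0" if "Z \<in> I" "Z \<in> J" for Z
    using that It[of Z] ip_eq_zero_iff[of Z] by (auto simp: J_def ip_def)
  have IhJ: "I \<subseteq> \<hh>" "J \<subseteq> \<hh>" by (auto simp: I_def J_def)
  \<comment> \<open>For Y in \<open>\<aa>\<close> the bracket [P, Y] lies in both ideals I and J,
    hence vanishes. Maximality puts P into \<open>\<aa>\<close>, which is contained in I.\<close>
  have "P = 0" if P: "P \<in> J" "\<theta> P = - P" for P
  proof -
    have "br P Y = 0" if "Y \<in> \<aa>" for Y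
    proof (rule IJ)
      show "br P Y \<in> I" using Iid[of P Y] P that aI IhJ by blast
      show "br P Y \<in> J" using Jid[of Y P] br_anti[of P Y] P that a_minus Jsub by (simp add: subspace_neg)
    qed
    then have "P \<in> \<aa>" using a_maximal P IhJ by blast
    then show ?thesis using IJ P aI by blast
  qed
  then have "\<theta> Z = Z" if "Z \<in> J" for Z
    using that Jt Jsub subspace_diff[of J Z "\<theta> Z"] by (force simp: theta_simps)
  moreover have "lie_ideal br \<hh> J" using Jsub Jid IhJ by (simp add: lie_ideal_def)
  ultimately have J0: "Z = 0" if "Z \<in> J" for Z using no_compact_ideal that by blast
  have "Z \<in> I" if Z: "Z \<in> \<hh>" for Z
  proof -
    have "Z - proj I Z \<in> \<hh>" using Z proj_in[OF Isub] IhJ h_subspace by (blast intro: subspace_diff)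
    moreover have "B (Z - proj I Z) Y = 0" if "Y \<in> I" for Y
      using proj_perp[OF Isub It[OF that], of Z] by (simp add: ip_def)
    ultimately have "Z - proj I Z \<in> J" by (simp add: J_def)
    then have "Z = proj I Z" using J0[of "Z - proj I Z"] by simp
    then show ?thesis using proj_in[OF Isub] by metis
  qed
  then show False using C_not_fixed by (auto simp: I_def)
qed

lemma extreme_component_C:
  assumes "Y \<in> \<aa>" "w \<in> \<CC> \<inter> \<qq>" "finite S" "w = (\<Sum>s\<in>S. c s)" "\<And>s. s \<in> S \<Longrightarrow> br Y (c s) = s *\<^sub>R c s"
    and "s0 \<in> S" "\<And>s. s \<in> S \<Longrightarrow> s \<noteq> s0 \<Longrightarrow> \<epsilon> * s < \<epsilon> * s0"
  shows "c s0 \<in> \<CC> \<inter> \<qq>"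
proof (rule extreme_component_in_cone[OF br_bilinear assms(3,6), where k="\<lambda>s. s" and X=Y and \<epsilon>=\<epsilon>])
  show "closed (\<CC> \<inter> \<qq>)" using C_closed closed_subspace[OF q_subspace] by blast
  show "t *\<^sub>R x \<in> \<CC> \<inter> \<qq>" if "x \<in> \<CC> \<inter> \<qq>" "t > 0" for x t
    using that C_cone subspace_scale[OF q_subspace] by blast
  show "exp_ad br (t *\<^sub>R Y) (\<Sum>s\<in>S. c s) \<in> \<CC> \<inter> \<qq>" for t
    using assms(1,2,4) C_exp exp_ad_q[of "t *\<^sub>R Y" w] a_minus(1) subspace_scale[OF h_subspace] by auto
qed (use assms in auto)

text \<open>One step of simultaneous diagonalisation inside the non-linear set
  \<open>\<CC> \<inter> \<qq>\<close>. The last conclusion keeps eigenvalues already obtained,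
  because ad Z commutes with ad Y and respects its eigencomponents.\<close>

lemma a_eigenvector_refine:
  assumes "Y \<in> \<aa>" "w \<in> \<CC> \<inter> \<qq>" "w \<noteq> 0"
  obtains v s where "v \<in> \<CC> \<inter> \<qq>" "v \<noteq> 0" "br Y v = s *\<^sub>R v" "br Y w \<noteq> 0 \<Longrightarrow> s \<noteq> 0"
    "\<And>Z r. Z \<in> \<aa> \<Longrightarrow> br Z w = r *\<^sub>R w \<Longrightarrow> br Z v = r *\<^sub>R v"
proof -
  note sa = ip_br_minus[OF a_minus(2)[OF assms(1)]]
  obtain S c where S: "finite S" "w = (\<Sum>s\<in>S. c s)" "\<And>s. s \<in> S \<Longrightarrow> br Y (c s) = s *\<^sub>R c s"
    "\<And>s. s \<in> S \<Longrightarrow> c s \<noteq> 0"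
    using eigen_decomposition[OF br_linear_right sa] by blast
  have ne: "S \<noteq> {}" using S(2) assms(3) by auto
  have *: "br Z (c s) = r *\<^sub>R c s" if "Z \<in> \<aa>" "br Z w = r *\<^sub>R w" "s \<in> S" for Z r s
  proof -
    have "br Z (c s) - r *\<^sub>R c s = 0"
    proof (rule eigenvectors_sum_zero[OF sa S(1) _ _ that(3)])
      show "br Y (br Z (c t) - r *\<^sub>R c t) = t *\<^sub>R (br Z (c t) - r *\<^sub>R c t)" if "t \<in> S" for t
        using S(3)[OF that] jacobi[of Y Z "c t"] a_abelian[OF assms(1) \<open>Z \<in> \<aa>\<close>]
        by (simp add: br_simps algebra_simps)
      show "(\<Sum>t\<in>S. br Z (c t) - r *\<^sub>R c t) = 0"
        using that(2) by (simp add: sum_subtractf scaleR_sum_right[symmetric] br_sum_right[symmetric] S(2)[symmetric])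
    qed
    then show ?thesis by simp
  qed
  have ext: "c (Max S) \<in> \<CC> \<inter> \<qq>"
    by (rule extreme_component_C[OF assms(1,2) S(1,2,3), where \<epsilon>=1]) (use S(1) ne in \<open>auto simp: less_le\<close>)
  have ext': "c (Min S) \<in> \<CC> \<inter> \<qq>"
    by (rule extreme_component_C[OF assms(1,2) S(1,2,3), where \<epsilon>="-1"])
      (use S(1) ne Min_le[OF S(1)] in \<open>auto simp: less_le simp del: minus_Min_eq_Max\<close>)
  have mem: "Max S \<in> S" "Min S \<in> S" using S ne by auto
  show thesis
  \<comment> \<open>If the largest eigenvalue is zero, the smallest one is nonzero unless Y kills w,
    so one of the two extreme components always serves.\<close>
  proof (cases "Max S = 0 \<and> br Y w \<noteq> 0")
    case True
    have "Min S \<noteq> 0"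
    proof
      assume "Min S = 0"
      then have "s = 0" if "s \<in> S" for s using that True S(1) by (metis Max_ge Min_le order_antisym)
      then have "br Y (c s) = 0" if "s \<in> S" for s using S(3)[OF that] that by simp
      then have "br Y w = 0" using S(2) by (simp add: br_sum_right)
      then show False using True by simp
    qed
    then show thesis using that[of "c (Min S)" "Min S"] ext' mem(2) S(3,4) * by blast
  next
    case False
    then show thesis using that[of "c (Max S)" "Max S"] ext mem(1) S(3,4) * by blast
  qed
qed

text \<open>The refinement runs through a finite spanning set of \<open>\<aa>\<close>. The vector is
  first made an eigenvector of some Y with nonzero eigenvalue s, and this eigenvalue survives all
  later refinements.\<close>

lemma weight_vector_exists:
  obtains w \<mu> Y where "w \<in> \<CC> \<inter> \<qq>" "w \<noteq> 0" "linear \<mu>" "\<And>Z. Z \<in> \<aa> \<Longrightarrow> br Z w = \<mu> Z *\<^sub>R w"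
    "Y \<in> \<aa>" "\<mu> Y \<noteq> 0"
proof -
  obtain w0 Y where w0: "w0 \<in> \<CC> \<inter> \<qq>" "Y \<in> \<aa>" "br Y w0 \<noteq> 0" using a_moves_C by blast
  then have "w0 \<noteq> 0" by (auto simp: br_simps)
  then obtain w1 s where w1: "w1 \<in> \<CC> \<inter> \<qq>" "w1 \<noteq> 0" "br Y w1 = s *\<^sub>R w1" "s \<noteq> 0"
    using a_eigenvector_refine[OF w0(2,1)] w0(3) by metis
  have "\<exists>w\<in>\<CC> \<inter> \<qq>. w \<noteq> 0 \<and> br Y w = s *\<^sub>R w \<and> (\<forall>Z\<in>F. \<exists>r. br Z w = r *\<^sub>R w)"
    if "finite F" "F \<subseteq> \<aa>" for F
    using that
  proof (induction F)
    case empty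
    then show ?case using w1 by blast
  next
    case (insert Z F)
    then obtain w where w: "w \<in> \<CC> \<inter> \<qq>" "w \<noteq> 0" "br Y w = s *\<^sub>R w" "\<forall>Z\<in>F. \<exists>r. br Z w = r *\<^sub>R w" by blast
    obtain v t where v: "v \<in> \<CC> \<inter> \<qq>" "v \<noteq> 0" "br Z v = t *\<^sub>R v"
      "\<And>Z r. Z \<in> \<aa> \<Longrightarrow> br Z w = r *\<^sub>R w \<Longrightarrow> br Z v = r *\<^sub>R v"
      using a_eigenvector_refine[OF _ w(1,2), of Z] insert.prems by (metis insert_subset)
    have "\<forall>Z\<in>F. \<exists>r. br Z v = r *\<^sub>R v" using v(4) w(4) insert.prems by (metis insert_subset subsetD)
    then show ?case using v w(3) w0(2) by blast
  qed
  moreover obtain F where F: "finite F" "F \<subseteq> \<aa>" "span F = \<aa>"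
    using basis_subspace_exists[OF a_subspace] by metis
  ultimately obtain w where w: "w \<in> \<CC> \<inter> \<qq>" "w \<noteq> 0" "br Y w = s *\<^sub>R w" "\<forall>Z\<in>F. \<exists>r. br Z w = r *\<^sub>R w"
    by blast
  \<comment> \<open>A weight must be linear on the whole type; the Rayleigh quotient of ad Z at w
    extends it from \<open>\<aa>\<close> without choosing a complement.\<close>
  define \<mu> where "\<mu> Z = ip (br Z w) w / ip w w" for Z
  have ww: "ip w w \<noteq> 0" using w(2) by (simp add: ip_eq_zero_iff)
  have \<mu>I: "\<mu> Z = r" if "br Z w = r *\<^sub>R w" for Z r using that ww by (simp add: \<mu>_def ip_simps)
  have lin: "linear \<mu>" unfolding \<mu>_def by (intro linearI) (simp_all add: br_simps ip_simps add_divide_distrib)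
  have "br Z w = \<mu> Z *\<^sub>R w" if "Z \<in> \<aa>" for Z
    using that unfolding F(3)[symmetric]
  proof (induction rule: span_induct_alt)
    case base
    then show ?case using lin by (simp add: br_simps linear_0)
  next
    case (step c x y)
    have "br x w = \<mu> x *\<^sub>R w" using w(4) step(1) \<mu>I by metis
    then show ?case using step(2) lin by (simp add: br_simps linear_add linear_scale scaleR_add_left)
  qed
  moreover have "\<mu> Y \<noteq> 0" using \<mu>I[OF w(3)] w1(4) by simp
  ultimately show thesis using that w(1,2) lin w0(2) by blast
qed

lemma a_one_dimensional:
  obtains A X where "\<aa> = span {A}" "A \<in> \<hh>" "\<theta> A = - A" "X \<in> \<CC> \<inter> \<qq>" "X \<noteq> 0" "br A X = X"
proof -
  obtain X \<mu> Y where X: "X \<in> \<CC> \<inter> \<qq>" "X \<noteq> 0" "linear \<mu>" "\<And>Z. Z \<in> \<aa> \<Longrightarrow> br Z X = \<mu> Z *\<^sub>R X"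
    "Y \<in> \<aa>" "\<mu> Y \<noteq> 0" by (rule weight_vector_exists) blast
  have ker: "Z = 0" if Z: "Z \<in> \<aa>" "\<mu> Z = 0" for Z
  proof -
    define V where "V = {x. br Z x = 0}"
    have V: "subspace V" by (auto simp: V_def subspace_def br_simps)
    have "br Z (\<theta> X) = \<theta> (br (\<theta> Z) X)" by (simp add: theta_br)
    also have "\<dots> = 0" using a_minus(2)[OF Z(1)] X(4)[OF Z(1)] Z(2) by (simp add: br_simps theta_simps)
    finally have "\<aa> \<union> {X, \<theta> X} \<subseteq> V" using X(4) Z a_abelian by (auto simp: V_def)
    moreover have "br x y \<in> V" if "x \<in> V" "y \<in> V" for x y
      using that jacobi[of Z x y] by (simp add: V_def br_simps)
    then have "lie_subalgebra br V" using V by (simp add: lie_subalgebra_def)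
    moreover have "direct_sum V (V \<inter> \<hh>) (V \<inter> \<qq>)"
    proof (rule direct_sumI[OF V])
      show "proj \<hh> x \<in> V" if "x \<in> V" for x
        using that proj_h_br[OF a_minus(1)[OF Z(1)], of x] linear_0[OF proj_linear[OF h_subspace]]
        by (simp add: V_def)
    qed
    moreover have "\<exists>Y\<in>\<aa>. \<mu> Y \<noteq> 0" using X(5,6) by blast
    ultimately have "V = UNIV" using hull_UNIV[OF form invariant X(1,2,3,4)] by simp
    then have "br Z Y = 0" for Y unfolding V_def by blast
    then show "Z = 0" by (rule center_trivial)
  qed
  \<comment> \<open>Normalised so that X has weight 1; this fixes the unit of the later
    grading.\<close>
  define A where "A = (1 / \<mu> Y) *\<^sub>R Y"
  have A: "A \<in> \<aa>" unfolding A_def using a_subspace X(5) by (simp add: subspace_scale)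
  have \<mu>A: "\<mu> A = 1" using X(6) by (simp add: A_def linear_scale[OF X(3)])
  have "Z \<in> span {A}" if "Z \<in> \<aa>" for Z
  proof -
    have "Z - \<mu> Z *\<^sub>R A = 0"
    proof (rule ker)
      show "Z - \<mu> Z *\<^sub>R A \<in> \<aa>" using that A a_subspace by (simp add: subspace_diff subspace_scale)
      show "\<mu> (Z - \<mu> Z *\<^sub>R A) = 0" using \<mu>A by (simp add: linear_diff[OF X(3)] linear_scale[OF X(3)])
    qed
    then have "Z = \<mu> Z *\<^sub>R A" by simp
    then show ?thesis unfolding span_singleton by blast
  qed
  then have "\<aa> = span {A}" using span_minimal[of "{A}" \<aa>] A a_subspace by auto
  moreover have "br A X = X" using X(4)[OF A] \<mu>A by simp
  ultimately show thesis by (rule that[OF _ a_minus(1)[OF A] a_minus(2)[OF A] X(1,2)])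
qed

end

text \<open>Pairing the curve with the part z of d orthogonal to W gives a constant zero function,
  whose derivative is the squared length of z.\<close>

lemma (in inner_form) has_vector_derivative_in_subspace:
  fixes f :: "real \<Rightarrow> 'a"
  assumes "(f has_vector_derivative d) (at t)" "\<And>s. f s \<in> W" "subspace W"
  shows "d \<in> W"
proof -
  define z where "z = d - proj W d"
  have "linear (\<lambda>x. ip x z)" using ip_bilinear by (simp add: bilinear_def)
  then have "((\<lambda>s. ip (f s) z) has_vector_derivative ip d z) (at t)"
    by (intro bounded_linear.has_vector_derivative[OF _ assms(1)]) (simp add: linear_conv_bounded_linear)
  moreover have "ip (f s) z = 0" for s
    using proj_perp[OF assms(3,2), of d s] ip_commute[of "f s" z] by (simp add: z_def)
  ultimately have "((\<lambda>s. 0) has_vector_derivative ip d z) (at t)" by simp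
  then have "ip d z = 0" using has_vector_derivative_const vector_derivative_unique_at by metis
  moreover have "ip (proj W d) z = 0"
    using proj_perp[OF assms(3) proj_in[OF assms(3)], of d d] ip_commute[of "proj W d" z] by (simp add: z_def)
  ultimately have "ip z z = 0" by (simp add: z_def ip_simps)
  then have "d = proj W d" by (simp add: ip_eq_zero_iff z_def)
  then show ?thesis using proj_in[OF assms(3)] by metis
qed

section \<open>The model pair\<close>

text \<open>The structure constants are [A, X] = X, [A, Y] = - Y and [X, Y] = c A. Sending A to half
  of diag(1, -1) and X to the upper unit matrix forces the factor c / 2 in the image of Y.\<close>

lemma sl2_pair_iso:
  fixes br :: "'a::real_vector \<Rightarrow> 'a \<Rightarrow> 'a" and t r s :: "'a \<Rightarrow> real"
  assumes lin: "linear t" "linear r" "linear s"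
    and coord: "\<And>Z. Z = t Z *\<^sub>R A + r Z *\<^sub>R X + s Z *\<^sub>R Y"
    and ind: "\<And>a b d. t (a *\<^sub>R A + b *\<^sub>R X + d *\<^sub>R Y) = a" "\<And>a b d. r (a *\<^sub>R A + b *\<^sub>R X + d *\<^sub>R Y) = b"
      "\<And>a b d. s (a *\<^sub>R A + b *\<^sub>R X + d *\<^sub>R Y) = d"
    and br: "\<And>Z Z'. br Z Z' = (c * (r Z * s Z' - s Z * r Z')) *\<^sub>R A
        + (t Z * r Z' - r Z * t Z') *\<^sub>R X + (s Z * t Z' - t Z * s Z') *\<^sub>R Y"
    and c: "c \<noteq> 0" and h: "\<hh> = span {A}"
  shows "lie_pair_iso br UNIV \<hh> commutator sl2 sl2_diag"
proof -
  define \<phi> :: "'a \<Rightarrow> real^2^2" where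
    "\<phi> Z = vector [vector [t Z / 2, r Z], vector [c * s Z / 2, - t Z / 2]]" for Z
  have ent: "\<phi> Z $ 1 $ 1 = t Z / 2" "\<phi> Z $ 1 $ 2 = r Z" "\<phi> Z $ 2 $ 1 = c * s Z / 2" "\<phi> Z $ 2 $ 2 = - t Z / 2" for Z
    by (simp_all add: \<phi>_def)
  have "linear \<phi>"
    by (rule linearI) (simp_all add: vec_eq_iff forall_2 ent linear_add[OF lin(1)] linear_add[OF lin(2)]
        linear_add[OF lin(3)] linear_scale[OF lin(1)] linear_scale[OF lin(2)] linear_scale[OF lin(3)]
        algebra_simps add_divide_distrib diff_divide_distrib)
  moreover have "bij_betw \<phi> UNIV sl2"
  proof (rule bij_betwI[where g="\<lambda>M. (2 * M $ 1 $ 1) *\<^sub>R A + (M $ 1 $ 2) *\<^sub>R X + (2 * M $ 2 $ 1 / c) *\<^sub>R Y"])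
    show "\<phi> \<in> UNIV \<rightarrow> sl2" by (auto simp: sl2_def trace_def sum_2 ent)
    show "(2 * \<phi> Z $ 1 $ 1) *\<^sub>R A + (\<phi> Z $ 1 $ 2) *\<^sub>R X + (2 * \<phi> Z $ 2 $ 1 / c) *\<^sub>R Y = Z" for Z
      using coord[of Z] c by (simp add: ent)
    show "\<phi> ((2 * M $ 1 $ 1) *\<^sub>R A + (M $ 1 $ 2) *\<^sub>R X + (2 * M $ 2 $ 1 / c) *\<^sub>R Y) = M" if "M \<in> sl2" for M
      using that c by (auto simp: vec_eq_iff forall_2 ent ind sl2_def trace_def sum_2)
  qed auto
  moreover have "\<phi> (br Z Z') = commutator (\<phi> Z) (\<phi> Z')" for Z Z'
  proof -
    have E: "t (br Z Z') = c * (r Z * s Z' - s Z * r Z')" "r (br Z Z') = t Z * r Z' - r Z * t Z'"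
      "s (br Z Z') = s Z * t Z' - t Z * s Z'"
      by (simp_all only: br ind)
    show ?thesis
      by (simp add: commutator_def vec_eq_iff forall_2 matrix_matrix_mult_def sum_2 ent E)
        (simp add: field_simps)
  qed
  moreover have "\<phi> ` \<hh> = sl2_diag"
  proof (intro equalityI subsetI)
    fix M assume "M \<in> \<phi> ` \<hh>"
    then obtain k where "M = \<phi> (k *\<^sub>R A + 0 *\<^sub>R X + 0 *\<^sub>R Y)" by (auto simp: h span_singleton)
    then show "M \<in> sl2_diag"
      by (auto simp: sl2_diag_def sl2_def trace_def sum_2 ent ind forall_2 simp del: scaleR_zero_left)
  next
    fix M :: "real^2^2" assume M: "M \<in> sl2_diag"
    have "M = \<phi> ((2 * M $ 1 $ 1) *\<^sub>R A + 0 *\<^sub>R X + 0 *\<^sub>R Y)"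
      using M by (auto simp: vec_eq_iff forall_2 ent ind sl2_diag_def sl2_def trace_def sum_2 simp del: scaleR_zero_left)
    then show "M \<in> \<phi> ` \<hh>" by (auto simp: h span_singleton)
  qed
  ultimately show ?thesis unfolding lie_pair_iso_def by blast
qed

section \<open>The grading by the split part of the subalgebra\<close>

locale graded_pair = minimal_pair +
  fixes A X0 :: "'a::euclidean_space"
  assumes a_span: "\<aa> = span {A}" and A_h: "A \<in> \<hh>" and A_minus: "\<theta> A = - A"
    and X0: "X0 \<in> \<CC> \<inter> \<qq>" "X0 \<noteq> 0" "br A X0 = X0"
begin

abbreviation "\<gg> s \<equiv> gr A s"

lemma A_nonzero: "A \<noteq> 0" using X0 by (auto simp: br_simps)

lemma form_A_pos: "B A A > 0"
  using ip_pos[OF A_nonzero] by (simp add: ip_def A_minus form_simps)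

lemma A_gr: "A \<in> \<gg> 0" by (simp add: gr_def)

lemma X0_gr: "X0 \<in> \<gg> 1" using X0 by (simp add: gr_def)

text \<open>Such a P commutes with \<open>\<aa>\<close>, so it lies in \<open>\<aa>\<close> by
  maximality; the coefficient is read off by pairing with A.\<close>

lemma h_minus_gr_0:
  assumes "P \<in> \<hh>" "\<theta> P = - P" "P \<in> \<gg> 0"
  shows "P = (B P A / B A A) *\<^sub>R A"
proof -
  have "br P Y = 0" if "Y \<in> \<aa>" for Y
    using that assms(3) br_anti[of P A] by (auto simp: a_span span_singleton gr_def br_simps)
  then have "P \<in> \<aa>" using a_maximal assms by blast
  then obtain k where "P = k *\<^sub>R A" by (auto simp: a_span span_singleton)
  then show ?thesis using form_A_pos by (simp add: form_simps)
qed

text \<open>Thus y, \<theta> y and A span a copy of sl2 whenever y and s are nonzero, which prevents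
  y and \<theta> y from both killing a nonzero vector of nonzero degree.\<close>

lemma br_theta_self:
  assumes "y \<in> \<hh>" "y \<in> \<gg> s"
  shows "br y (\<theta> y) = - (s * ip y y / B A A) *\<^sub>R A"
proof -
  have th: "\<theta> y \<in> \<gg> (- s)" using gr_theta[OF A_minus assms(2)] .
  have "B (br y (\<theta> y)) A = B y (br (\<theta> y) A)" by (simp add: form_right)
  also have "br (\<theta> y) A = s *\<^sub>R \<theta> y" using th br_anti[of "\<theta> y" A] by (simp add: gr_def)
  finally have "B (br y (\<theta> y)) A = - s * ip y y" by (simp add: form_simps ip_def)
  moreover have "br y (\<theta> y) = (B (br y (\<theta> y)) A / B A A) *\<^sub>R A"
  proof (rule h_minus_gr_0)
    show "br y (\<theta> y) \<in> \<hh>" using assms h_br h_theta by blast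
    show "\<theta> (br y (\<theta> y)) = - br y (\<theta> y)" using br_anti[of "\<theta> y" y] by (simp add: theta_br)
    show "br y (\<theta> y) \<in> \<gg> 0" using gr_br[OF assms(2) th] by simp
  qed
  ultimately show ?thesis by simp
qed

text \<open>Minimality under (c), restated for the single generator A. The weight is again extended
  to a linear function by a Rayleigh quotient.\<close>

lemma hull_A:
  assumes "cartan_form \<theta> B'" "\<And>X Y Z. B' (br X Y) Z = - B' Y (br X Z)"
    and X: "X \<in> \<CC> \<inter> perp B' \<hh>" "X \<noteq> 0" "X \<in> \<gg> s" "s \<noteq> 0"
    and V: "lie_subalgebra br V" "direct_sum V (V \<inter> \<hh>) (V \<inter> perp B' \<hh>)" "A \<in> V" "X \<in> V" "\<theta> X \<in> V"
  shows "V = UNIV"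
proof -
  define \<mu> where "\<mu> Z = ip (br Z X) X / ip X X" for Z
  have XX: "ip X X \<noteq> 0" using X(2) by (simp add: ip_eq_zero_iff)
  have lin: "linear \<mu>" unfolding \<mu>_def by (intro linearI) (simp_all add: br_simps ip_simps add_divide_distrib)
  have \<mu>: "br (k *\<^sub>R A) X = \<mu> (k *\<^sub>R A) *\<^sub>R X" for k
    using X(3) XX by (simp add: \<mu>_def gr_def br_simps ip_simps)
  have "\<mu> A = s" using X(3) XX by (simp add: \<mu>_def gr_def ip_simps)
  then have "\<exists>Y\<in>\<aa>. \<mu> Y \<noteq> 0" using X(4) by (auto simp: a_span intro!: bexI[of _ A] span_base)
  moreover have "br Y X = \<mu> Y *\<^sub>R X" if "Y \<in> \<aa>" for Y
    using that \<mu> by (auto simp: a_span span_singleton)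
  moreover have "\<aa> \<union> {X, \<theta> X} \<subseteq> V"
    using V span_minimal[of "{A}" V] by (auto simp: a_span lie_subalgebra_def)
  ultimately show ?thesis using hull_UNIV[OF assms(1,2) X(1,2) lin] V(1,2) by simp
qed

text \<open>The sum of the eigenspaces for integral multiples of s is a subalgebra compatible with
  \<open>\<hh>\<close> and \<open>\<qq>\<close> and contains A, X and \<theta> X. By minimality it
  is everything, while any other eigenvector would be orthogonal to it.\<close>

lemma weights_multiple:
  assumes X: "X \<in> \<CC> \<inter> \<qq>" "X \<noteq> 0" "X \<in> \<gg> s" "s \<noteq> 0" and v: "v \<in> \<gg> t" "v \<noteq> 0"
  shows "\<exists>n::int. t = of_int n * s"
proof (rule ccontr)
  assume neg: "\<not> ?thesis"
  define S where "S = {x. \<exists>n::int. x \<in> \<gg> (of_int n * s)}"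
  have SI: "x \<in> S" if "x \<in> \<gg> (of_int n * s)" for x and n :: int using that by (auto simp: S_def)
  have "lie_subalgebra br (span S)"
  proof (rule span_lie_subalgebra)
    fix x y assume "x \<in> S" "y \<in> S"
    then obtain m n :: int where "x \<in> \<gg> (of_int m * s)" "y \<in> \<gg> (of_int n * s)" by (auto simp: S_def)
    then have "br x y \<in> \<gg> (of_int (m + n) * s)" using gr_br by (simp add: distrib_right)
    then show "br x y \<in> span S" using SI span_base by blast
  qed
  moreover have "direct_sum (span S) (span S \<inter> \<hh>) (span S \<inter> \<qq>)"
    by (rule direct_sum_spanI) (auto simp: S_def intro!: span_base proj_h_gr[OF A_h])
  moreover have "A \<in> span S" "X \<in> span S" "\<theta> X \<in> span S"
    using SI[of A 0] A_gr SI[of X 1] X(3) SI[of "\<theta> X" "-1"] gr_theta[OF A_minus X(3)] by (auto intro: span_base)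
  ultimately have "span S = UNIV" using hull_A[OF form invariant X] by blast
  then have "ip v v = 0"
  proof (intro ip_span_zero[of v S])
    fix x assume "x \<in> S"
    then obtain n :: int where "x \<in> \<gg> (of_int n * s)" by (auto simp: S_def)
    then show "ip x v = 0" using gr_orthogonal[OF A_minus _ v(1)] neg by metis
  qed simp
  then show False using v(2) by (simp add: ip_eq_zero_iff)
qed

lemma gr_integral: "v \<in> \<gg> t \<Longrightarrow> v \<noteq> 0 \<Longrightarrow> \<exists>n::int. t = of_int n"
  using weights_multiple[OF X0(1,2) X0_gr, of v t] by simp

lemma C_weight:
  assumes "X \<in> \<CC> \<inter> \<qq>" "X \<noteq> 0" "X \<in> \<gg> (of_int n)" "n \<noteq> 0"
  shows "\<bar>n\<bar> = 1"
proof -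
  obtain m :: int where "1 = of_int m * real_of_int n"
    using weights_multiple[OF assms(1-3) _ X0_gr X0(2)] assms(4) by auto
  then have "m * n = 1" by (metis of_int_mult of_int_eq_1_iff)
  then show ?thesis using zmult_eq_1_iff[of m n] by auto
qed

text \<open>The choice \<epsilon> = t - s makes t dominant whichever of s and t is larger.\<close>

lemma extreme_pair_C:
  assumes "x + y \<in> \<CC>" "x \<in> \<gg> s" "y \<in> \<gg> t" "s \<noteq> t"
  shows "y \<in> \<CC>"
proof -
  have "(if t = t then y else x) \<in> \<CC>"
    by (rule extreme_component_in_cone[OF br_bilinear, where S="{s, t}" and k="\<lambda>r. r" and X=A
          and \<epsilon>="t - s" and c="\<lambda>r. if r = t then y else x"])
      (use assms C_closed C_cone C_exp in \<open>auto simp: gr_def mult_less_cancel_left_disj mult_less_cancel_left linorder_neq_iff\<close>)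
  then show ?thesis by simp
qed

text \<open>Derivatives of the curves exp(t ad Z) w show that the span is an ideal, and reduction
  (a) leaves no proper ideal containing \<open>\<CC>\<close>.\<close>

lemma span_C_UNIV: "span \<CC> = UNIV"
proof (rule C_ideal)
  have *: "br Z w \<in> span \<CC>" if "w \<in> \<CC>" for Z w
    by (rule has_vector_derivative_in_subspace[OF exp_ad_has_vector_derivative[OF br_bilinear]])
      (auto intro: span_base C_exp that)
  have "br Z w \<in> span \<CC>" if "w \<in> span \<CC>" for Z w
    using that by (induction rule: span_induct_alt) (auto simp: br_simps * intro!: span_add span_scale span_zero)
  then show "lie_ideal br UNIV (span \<CC>)" by (simp add: lie_ideal_def)
qed (rule span_superset)

text \<open>Since \<open>\<CC>\<close> spans, some w in it has a component along k; its component of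
  top degree is extreme and stays in \<open>\<CC>\<close>.\<close>

lemma top_weight_C:
  assumes "k \<in> \<gg> N" "k \<noteq> 0" and top: "\<forall>v s. v \<in> \<gg> s \<longrightarrow> v \<noteq> 0 \<longrightarrow> s \<le> N"
  obtains x where "x \<in> \<CC>" "x \<in> \<gg> N" "x \<noteq> 0"
proof -
  have "\<exists>w\<in>\<CC>. ip w k \<noteq> 0"
    using ip_span_zero[of k \<CC> k] span_C_UNIV assms(2) by (auto simp: ip_eq_zero_iff)
  then obtain w where w: "w \<in> \<CC>" "ip w k \<noteq> 0" by blast
  obtain S c where S: "finite S" "w = (\<Sum>s\<in>S. c s)" "\<And>s. s \<in> S \<Longrightarrow> br A (c s) = s *\<^sub>R c s"
    "\<And>s. s \<in> S \<Longrightarrow> c s \<noteq> 0"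
    using eigen_decomposition[OF br_linear_right ip_br_minus[OF A_minus], of w] by metis
  have "N \<in> S"
  proof (rule ccontr)
    assume "N \<notin> S"
    then have "ip (c s) k = 0" if "s \<in> S" for s
      using gr_orthogonal[OF A_minus _ assms(1), of "c s" s] S(3)[OF that] that by (auto simp: gr_def)
    then show False using w(2) S(2) by (simp add: ip_sum_left)
  qed
  have "c N \<in> \<CC>"
  proof (rule extreme_component_in_cone[OF br_bilinear S(1) \<open>N \<in> S\<close>, where k="\<lambda>r. r" and X=A and \<epsilon>=1])
    show "1 * s < 1 * N" if "s \<in> S" "s \<noteq> N" for s
      using top[rule_format, of "c s" s] S(3,4)[OF that(1)] that(2) by (auto simp: gr_def)
    show "exp_ad br (t *\<^sub>R A) (sum c S) \<in> \<CC>" for t using w(1) S(2) C_exp by simp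
  qed (use S C_closed C_cone in auto)
  then show thesis using that[of "c N"] S(3,4)[OF \<open>N \<in> S\<close>] by (simp add: gr_def)
qed

lemma gr_bounded: "\<exists>K. \<forall>v s. v \<in> \<gg> s \<longrightarrow> v \<noteq> 0 \<longrightarrow> \<bar>s\<bar> \<le> K"
proof -
  obtain K where K: "\<And>x. norm (br A x) \<le> K * norm x" using linear_bounded[OF br_linear_right] by blast
  have "\<bar>s\<bar> \<le> K" if "v \<in> \<gg> s" "v \<noteq> 0" for v s
    using K[of v] that by (simp add: gr_def)
  then show ?thesis by blast
qed

text \<open>For a top degree N of at least 3, a top vector of \<open>\<CC>\<close> cannot lie in
  \<open>\<qq>\<close>, so it has a nonzero projection y to \<open>\<hh>\<close>. Then
  [\<theta> y, X0] is a nonzero vector of \<open>\<CC> \<inter> \<qq>\<close> of degree 1 - N,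
  contrary to \<open>C_weight\<close>. For N = 2 that degree would be the admissible -1.\<close>

lemma gr_ge_3:
  assumes "v \<in> \<gg> s" "s \<ge> 3"
  shows "v = 0"
proof (rule ccontr)
  assume "v \<noteq> 0"
  define E where "E = {n::int. \<exists>v\<in>\<gg> (of_int n). v \<noteq> 0}"
  obtain K where K: "\<And>v s. v \<in> \<gg> s \<Longrightarrow> v \<noteq> 0 \<Longrightarrow> \<bar>s\<bar> \<le> K" using gr_bounded by blast
  have "E \<subseteq> {- \<lceil>K\<rceil>..\<lceil>K\<rceil>}"
  proof
    fix n assume "n \<in> E"
    then have "\<bar>real_of_int n\<bar> \<le> K" using K by (auto simp: E_def)
    then show "n \<in> {- \<lceil>K\<rceil>..\<lceil>K\<rceil>}" by (simp add: abs_le_iff) linarith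
  qed
  then have finE: "finite E" using finite_subset by blast
  obtain n0 :: int where n0: "s = of_int n0" using gr_integral assms \<open>v \<noteq> 0\<close> by blast
  then have n0E: "n0 \<in> E" using assms \<open>v \<noteq> 0\<close> by (auto simp: E_def)
  define N where "N = Max E"
  have NE: "N \<in> E" and N3: "N \<ge> 3"
    using Max_in[OF finE] Max_ge[OF finE n0E] n0E n0 assms(2) by (auto simp: N_def)
  have top: "t \<le> of_int N" if w: "w \<in> \<gg> t" "w \<noteq> 0" for w t
  proof -
    obtain m :: int where m: "t = of_int m" using gr_integral[OF w] by blast
    then have "m \<in> E" using w by (auto simp: E_def)
    then show ?thesis using m finE Max_ge[of E m] by (simp add: N_def)
  qed
  have low: "w = 0" if "w \<in> \<gg> t" "t < - of_int N" for w t
    using top[OF gr_theta[OF A_minus that(1)]] that(2) by (auto simp: theta_eq_0_iff)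
  obtain k where k: "k \<in> \<gg> (of_int N)" "k \<noteq> 0" using NE by (auto simp: E_def)
  obtain x where x: "x \<in> \<CC>" "x \<in> \<gg> (of_int N)" "x \<noteq> 0"
    using top_weight_C[OF k] top by metis
  have "x \<notin> \<qq>" using C_weight[of x N] x N3 by auto
  then have y0: "proj \<hh> x \<noteq> 0" using proj_h_zero_iff by blast
  define y where "y = proj \<hh> x"
  have y: "y \<in> \<hh>" "y \<in> \<gg> (of_int N)" "y \<noteq> 0"
    using y0 proj_h_in proj_h_gr[OF A_h x(2)] by (auto simp: y_def)
  have "br y X0 = 0" using top[OF gr_br[OF y(2) X0_gr]] by fastforce
  then have "br y (br (\<theta> y) X0) = - (of_int N * ip y y / B A A) *\<^sub>R X0"
    using jacobi[of y "\<theta> y" X0] br_theta_self[OF y(1,2)] X0(3) by (simp add: br_simps)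
  then have X1: "br (\<theta> y) X0 \<noteq> 0"
    using X0(2) ip_pos[OF y(3)] form_A_pos N3 by (auto simp: br_simps)
  have ty: "\<theta> y \<in> \<gg> (- of_int N)" using gr_theta[OF A_minus y(2)] .
  have g1: "br (\<theta> y) X0 \<in> \<gg> (of_int (1 - N))" using gr_br[OF ty X0_gr] by simp
  \<comment> \<open>The degree is 1 - 2 N, below the lowest degree - N, so the exponential series
    stops after the linear term.\<close>
  have "br (\<theta> y) (br (\<theta> y) X0) = 0"
    by (rule low[OF gr_br[OF ty g1]]) (use N3 in simp)
  then have "X0 + br (\<theta> y) X0 \<in> \<CC>"
    using exp_ad_two_terms[OF br_bilinear] C_exp[of X0 "\<theta> y"] X0(1) by simp
  then have "br (\<theta> y) X0 \<in> \<CC>" using extreme_pair_C[OF _ X0_gr g1] N3 by simp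
  moreover have "br (\<theta> y) X0 \<in> \<qq>" using br_h_q h_theta y(1) X0(1) by blast
  ultimately have "\<bar>1 - N\<bar> = 1" using C_weight[OF _ X1 g1] N3 by auto
  then show False using N3 by simp
qed

text \<open>Degree 3 vanishes, so exp(ad Z) X = X + [Z, X], and its part of degree 2 stays in
  \<open>\<CC>\<close>. In \<open>\<CC> \<inter> \<qq>\<close> degree 2 does not occur.\<close>

lemma br_gr_1_in_q:
  assumes X: "X \<in> \<CC> \<inter> \<qq>" "X \<in> \<gg> 1" and Z: "Z \<in> \<gg> 1" "br Z X \<in> \<qq>"
  shows "br Z X = 0"
proof (rule ccontr)
  assume n: "br Z X \<noteq> 0"
  have g2: "br Z X \<in> \<gg> (of_int 2)" using gr_br[OF Z(1) X(2)] by simp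
  have "br Z (br Z X) = 0" by (rule gr_ge_3[OF gr_br[OF Z(1) g2]]) simp
  then have "X + br Z X \<in> \<CC>" using exp_ad_two_terms[OF br_bilinear] C_exp[of X Z] X(1) by simp
  then have "br Z X \<in> \<CC>" using extreme_pair_C[OF _ X(2) g2] by simp
  then show False using C_weight[OF _ n g2] Z(2) by simp
qed

text \<open>The form B' is kept separate from B because the final step applies this to a rescaled
  form, while the grading and \<open>\<CC> \<inter> \<qq>\<close> refer to B.\<close>

lemma sl2_case:
  assumes B': "cartan_form \<theta> B'" "\<And>X Y Z. B' (br X Y) Z = - B' Y (br X Z)"
    and X: "X \<in> \<CC> \<inter> perp B' \<hh>" "X \<noteq> 0" "X \<in> \<gg> 1" and c: "br (br X (\<theta> X)) X = c *\<^sub>R X"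
  shows "lie_pair_iso br UNIV \<hh> commutator sl2 sl2_diag"
proof -
  interpret P': lie_pair br \<theta> B' \<hh>
    by unfold_locales (use lie theta_br B' h_subalgebra h_theta_image in \<open>auto simp: theta_simps\<close>)
  define \<beta> where "\<beta> = br X (\<theta> X)"
  have tX: "\<theta> X \<in> \<gg> (- 1)" using gr_theta[OF A_minus X(3)] .
  have \<beta>0: "\<beta> \<in> \<gg> 0" using gr_br[OF X(3) tX] by (simp add: \<beta>_def)
  have \<beta>m: "\<theta> \<beta> = - \<beta>" using br_anti[of "\<theta> X" X] by (simp add: \<beta>_def theta_br)
  have b1: "br A X = X" "br A (\<theta> X) = - \<theta> X" "br A \<beta> = 0" using X(3) tX \<beta>0 by (auto simp: gr_def)
  have b2: "br \<beta> X = c *\<^sub>R X" using c by (simp add: \<beta>_def)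
  have "c *\<^sub>R \<theta> X = - br \<beta> (\<theta> X)"
    using theta_br[of \<beta> X] by (simp add: b2 \<beta>m br_simps theta_simps)
  then have b3: "br \<beta> (\<theta> X) = - (c *\<^sub>R \<theta> X)" by simp
  define S where "S = {A, X, \<theta> X, \<beta>}"
  have Sm: "A \<in> span S" "X \<in> span S" "\<theta> X \<in> span S" "\<beta> \<in> span S" by (auto simp: S_def intro: span_base)
  have "lie_subalgebra br (span S)"
  proof (rule span_lie_subalgebra)
    fix x y assume "x \<in> S" "y \<in> S"
    then have "x \<in> {A, X, \<theta> X, \<beta>}" "y \<in> {A, X, \<theta> X, \<beta>}" by (simp_all add: S_def)
    then show "br x y \<in> span S"
      using b1 b2 b3 br_anti[of X A] br_anti[of "\<theta> X" A] br_anti[of \<beta> A] br_anti[of X \<beta>]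
        br_anti[of "\<theta> X" \<beta>] br_anti[of "\<theta> X" X] \<beta>_def[symmetric] Sm
      by (auto simp: span_zero intro!: span_neg span_scale)
  qed
  moreover have "direct_sum (span S) (span S \<inter> \<hh>) (span S \<inter> perp B' \<hh>)"
  proof (rule P'.direct_sum_spanI)
    fix x assume "x \<in> S"
    moreover have "P'.proj \<hh> A = A" using P'.proj_id[OF h_subspace A_h] .
    moreover have "P'.proj \<hh> X = 0" "P'.proj \<hh> (\<theta> X) = 0" using X(1) P'.proj_h_q P'.q_theta by auto
    moreover have "P'.proj \<hh> \<beta> \<in> span S"
    proof -
      have "P'.proj \<hh> \<beta> = (B (P'.proj \<hh> \<beta>) A / B A A) *\<^sub>R A"
      proof (rule h_minus_gr_0)
        show "\<theta> (P'.proj \<hh> \<beta>) = - P'.proj \<hh> \<beta>"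
          using P'.proj_h_theta[of \<beta>] linear_neg[OF P'.proj_linear[OF h_subspace]] by (simp add: \<beta>m)
        show "P'.proj \<hh> \<beta> \<in> \<gg> 0" using P'.proj_h_gr[OF A_h, of \<beta> 0] \<beta>0 by (simp add: gr_def P'.gr_def)
      qed (rule P'.proj_h_in)
      then show ?thesis using Sm(1) span_scale by metis
    qed
    ultimately show "P'.proj \<hh> x \<in> span S" using Sm span_zero by (auto simp: S_def)
  qed
  ultimately have U: "span S = UNIV" using hull_A[OF B' X(1,2,3)] Sm by simp
  \<comment> \<open>\<beta> and c A act identically on the four generators, so their difference is
    central and hence zero; the four generators shrink to three.\<close>
  have "br (\<beta> - c *\<^sub>R A) Y = 0" for Y
  proof (rule centralizer_of_span[of Y S])
    show "br (\<beta> - c *\<^sub>R A) s = 0" if "s \<in> S" for s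
      using that b1 b2 b3 br_anti[of \<beta> A] by (auto simp: S_def br_simps)
  qed (simp add: U)
  then have \<beta>A: "\<beta> = c *\<^sub>R A" using center_trivial[of "\<beta> - c *\<^sub>R A"] by simp
  \<comment> \<open>This yields c nonzero, which the model needs: otherwise [X, \<theta> X] would
    vanish.\<close>
  have cneg: "c * B A A < 0"
  proof -
    have "B \<beta> A = B X (br (\<theta> X) A)" by (simp add: \<beta>_def form_right)
    also have "br (\<theta> X) A = \<theta> X" using b1(2) br_anti[of "\<theta> X" A] by simp
    finally have "c * B A A = - ip X X" by (simp add: \<beta>A form_simps ip_def)
    then show ?thesis using ip_pos[OF X(2)] by simp
  qed
  have o: "ip A X = 0" "ip X A = 0" "ip A (\<theta> X) = 0" "ip (\<theta> X) A = 0" "ip X (\<theta> X) = 0" "ip (\<theta> X) X = 0"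
    using gr_orthogonal[OF A_minus] A_gr X(3) tX by auto
  have nz: "ip A A \<noteq> 0" "ip X X \<noteq> 0" "ip (\<theta> X) (\<theta> X) \<noteq> 0"
    using A_nonzero X(2) by (simp_all add: ip_eq_zero_iff theta_eq_0_iff)
  define t r s where "t Z = ip Z A / ip A A" and "r Z = ip Z X / ip X X"
    and "s Z = ip Z (\<theta> X) / ip (\<theta> X) (\<theta> X)" for Z
  have lin: "linear t" "linear r" "linear s"
    unfolding t_def r_def s_def by (auto intro!: linearI simp: ip_simps add_divide_distrib)
  have ind: "t (a *\<^sub>R A + b *\<^sub>R X + d *\<^sub>R \<theta> X) = a" "r (a *\<^sub>R A + b *\<^sub>R X + d *\<^sub>R \<theta> X) = b"
    "s (a *\<^sub>R A + b *\<^sub>R X + d *\<^sub>R \<theta> X) = d" for a b d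
    using o nz by (simp_all add: t_def r_def s_def ip_simps)
  have coord: "Z = t Z *\<^sub>R A + r Z *\<^sub>R X + s Z *\<^sub>R \<theta> X" for Z
  proof -
    have "Z \<in> span S" by (simp add: U)
    then have "\<exists>a b d. Z = a *\<^sub>R A + b *\<^sub>R X + d *\<^sub>R \<theta> X"
    proof (induction rule: span_induct_alt)
      case base
      show ?case by (intro exI[of _ 0]) simp
    next
      case (step k x y)
      then obtain a b d where y: "y = a *\<^sub>R A + b *\<^sub>R X + d *\<^sub>R \<theta> X" by blast
      have "\<exists>a b d. x = a *\<^sub>R A + b *\<^sub>R X + d *\<^sub>R \<theta> X"
      proof -
        have "A = 1 *\<^sub>R A + 0 *\<^sub>R X + 0 *\<^sub>R \<theta> X" "X = 0 *\<^sub>R A + 1 *\<^sub>R X + 0 *\<^sub>R \<theta> X"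
          "\<theta> X = 0 *\<^sub>R A + 0 *\<^sub>R X + 1 *\<^sub>R \<theta> X" "\<beta> = c *\<^sub>R A + 0 *\<^sub>R X + 0 *\<^sub>R \<theta> X" by (simp_all add: \<beta>A)
        then show ?thesis using step(1) unfolding S_def by blast
      qed
      then obtain a' b' d' where x: "x = a' *\<^sub>R A + b' *\<^sub>R X + d' *\<^sub>R \<theta> X" by blast
      have "k *\<^sub>R x + y = (k * a' + a) *\<^sub>R A + (k * b' + b) *\<^sub>R X + (k * d' + d) *\<^sub>R \<theta> X"
        unfolding x y by (simp add: algebra_simps)
      then show ?case by blast
    qed
    then show ?thesis using ind by metis
  qed
  have hA: "\<hh> = span {A}"
  proof (intro equalityI subsetI)
    fix Z assume Z: "Z \<in> \<hh>"
    have "r Z *\<^sub>R X + s Z *\<^sub>R \<theta> X = Z - t Z *\<^sub>R A" using coord[of Z] by (simp add: algebra_simps)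
    moreover have "Z - t Z *\<^sub>R A \<in> \<hh>" using Z A_h h_subspace by (simp add: subspace_diff subspace_scale)
    moreover have "r Z *\<^sub>R X + s Z *\<^sub>R \<theta> X \<in> perp B' \<hh>"
      using X(1) P'.q_theta by (intro subspace_add[OF P'.q_subspace] subspace_scale[OF P'.q_subspace]) auto
    ultimately have "Z - t Z *\<^sub>R A = 0" using P'.h_q_disjoint by metis
    then show "Z \<in> span {A}" unfolding span_singleton by (metis eq_iff_diff_eq_0 rangeI)
  next
    fix Z assume "Z \<in> span {A}"
    then show "Z \<in> \<hh>" using A_h h_subspace by (auto simp: span_singleton subspace_scale)
  qed
  show ?thesis
  proof (rule sl2_pair_iso[OF lin coord ind _ _ hA])
    show "c \<noteq> 0" using cneg by auto
    fix Z Z'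
    have "br Z Z' = br (t Z *\<^sub>R A + r Z *\<^sub>R X + s Z *\<^sub>R \<theta> X) (t Z' *\<^sub>R A + r Z' *\<^sub>R X + s Z' *\<^sub>R \<theta> X)"
      using coord[of Z] coord[of Z'] by (rule arg_cong2)
    also have "\<dots> = (c * (r Z * s Z' - s Z * r Z')) *\<^sub>R A
        + (t Z * r Z' - r Z * t Z') *\<^sub>R X + (s Z * t Z' - t Z * s Z') *\<^sub>R \<theta> X"
      using b1(1,2) br_anti[of X A] br_anti[of "\<theta> X" A] br_anti[of "\<theta> X" X] \<beta>A \<beta>_def
      by (simp add: br_simps algebra_simps)
    finally show "br Z Z' = (c * (r Z * s Z' - s Z * r Z')) *\<^sub>R A
        + (t Z * r Z' - r Z * t Z') *\<^sub>R X + (s Z * t Z' - t Z * s Z') *\<^sub>R \<theta> X" .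
  qed
qed

end

section \<open>A penalised variational problem\<close>

context graded_pair begin

text \<open>These are the two halves of the product rule for the squared length of \<beta> =
  [x, \<theta> x] in direction \<delta>; both give the gradient [\<beta>, x] up to sign.\<close>

lemma form_moment_derivative:
  assumes "\<theta> \<beta> = - \<beta>"
  shows "B \<beta> (br \<delta> (\<theta> x)) = - ip \<delta> (br \<beta> x)" "B \<beta> (br x (\<theta> \<delta>)) = - ip \<delta> (br \<beta> x)"
proof -
  have t: "\<theta> (br \<beta> x) = - br \<beta> (\<theta> x)" using assms by (simp add: theta_br br_simps)
  have "B \<beta> (br \<delta> (\<theta> x)) = B \<delta> (br (\<theta> x) \<beta>)" using form_commute[of \<beta> "br \<delta> (\<theta> x)"] form_right[of \<delta> "\<theta> x" \<beta>] by simp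
  also have "br (\<theta> x) \<beta> = \<theta> (br \<beta> x)" using br_anti[of "\<theta> x" \<beta>] t by simp
  finally show "B \<beta> (br \<delta> (\<theta> x)) = - ip \<delta> (br \<beta> x)" by (simp add: ip_def)
  have "B \<beta> (br x (\<theta> \<delta>)) = B (br \<beta> x) (\<theta> \<delta>)" by (rule form_right)
  then show "B \<beta> (br x (\<theta> \<delta>)) = - ip \<delta> (br \<beta> x)" using ip_commute[of \<delta> "br \<beta> x"] by (simp add: ip_def)
qed

text \<open>The bracket W = [\<theta> x, Y] itself has degree zero, so it is an admissible test
  element, and testing with it gives the squared length of W.\<close>

lemma gr_1_stationary:
  assumes x: "x \<in> \<gg> 1" and Y: "Y \<in> \<gg> 1" and orth: "\<And>Z. Z \<in> \<gg> 0 \<Longrightarrow> ip (br Z x) Y = 0"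
  shows "br (\<theta> x) Y = 0"
proof -
  define W where "W = br (\<theta> x) Y"
  have W: "W \<in> \<gg> 0" using gr_br[OF gr_theta[OF A_minus x] Y] by (simp add: W_def)
  have "ip (br W x) Y = - ip (br x W) Y" using br_anti[of W x] by (simp add: ip_simps)
  also have "\<dots> = ip W W" by (simp add: ip_br W_def)
  finally have "ip W W = 0" using orth[OF W] by simp
  then show ?thesis by (simp add: ip_eq_zero_iff W_def)
qed

text \<open>The functional is the squared length of [x, \<theta> x] plus a penalty for leaving
  \<open>\<qq>\<close>; the extra factor \<open>ip x x\<close> makes it homogeneous of degree 4. M
  is its value at the normalised X0, where the penalty is zero, so it bounds the minimum for every
  \<nu>.\<close>

lemma penalised_minimum:
  assumes \<nu>: "\<nu> \<ge> 0" and M: "M = B (br X0 (\<theta> X0)) (br X0 (\<theta> X0)) / (ip X0 X0)\<^sup>2"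
  obtains x c where "x \<in> \<CC>" "x \<in> \<gg> 1" "ip x x = 1" "\<bar>c\<bar> \<le> M" "\<nu> * ip (proj \<hh> x) (proj \<hh> x) \<le> M"
    "br (\<theta> x) (br (br x (\<theta> x)) x - c *\<^sub>R x - (\<nu> / 2) *\<^sub>R proj \<hh> x) = 0"
proof -
  define f where "f x = B (br x (\<theta> x)) (br x (\<theta> x)) + \<nu> * (ip (proj \<hh> x) (proj \<hh> x) * ip x x)" for x
  note pl = proj_linear[OF h_subspace]
  have bl: "bounded_linear \<theta>" "bounded_linear (proj \<hh>)"
    using theta_linear pl linear_conv_bounded_linear by auto
  have cl: "closed (\<CC> \<inter> \<gg> 1)" using C_closed closed_subspace[OF gr_subspace] by blast
  have "\<exists>x m. x \<in> \<CC> \<inter> \<gg> 1 \<and> ip x x = 1 \<and> f x = m \<and> (\<forall>z\<in>\<CC> \<inter> \<gg> 1. m * ip z z ^ 2 \<le> f z)"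
  proof (rule homogeneous_minimum[OF cl, where w=X0])
    show "t *\<^sub>R x \<in> \<CC> \<inter> \<gg> 1" if "x \<in> \<CC> \<inter> \<gg> 1" "t > 0" for x t
      using that C_cone subspace_scale[OF gr_subspace] by blast
    have c1: "continuous_on UNIV (\<lambda>x. br x (\<theta> x))"
      by (intro bilinear_continuous_on[OF br_bilinear] continuous_on_id linear_continuous_on bl)
    have c2: "continuous_on UNIV (\<lambda>x. ip (proj \<hh> x) (proj \<hh> x))"
      by (intro ip_continuous linear_continuous_on bl)
    have c3: "continuous_on UNIV (\<lambda>x. ip x x)" by (intro ip_continuous continuous_on_id)
    show "continuous_on UNIV f" unfolding f_def
      by (intro continuous_on_add continuous_on_mult continuous_on_const c2 c3
          bilinear_continuous_on[OF form_bilinear c1 c1])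
    show "f (t *\<^sub>R x) = t ^ (2 * 2) * f x" for t x
      by (simp add: f_def theta_simps linear_scale[OF pl] br_simps form_simps ip_simps power_numeral_reduce algebra_simps)
  qed (use X0 X0_gr in auto)
  then obtain x m where x: "x \<in> \<CC>" "x \<in> \<gg> 1" "ip x x = 1" "f x = m"
    and min: "\<And>z. z \<in> \<CC> \<inter> \<gg> 1 \<Longrightarrow> m * (ip z z)\<^sup>2 \<le> f z" by auto
  define \<beta> where "\<beta> = br x (\<theta> x)"
  have \<beta>m: "\<theta> \<beta> = - \<beta>" using br_anti[of "\<theta> x" x] by (simp add: \<beta>_def theta_br)
  have \<beta>0: "B \<beta> \<beta> \<ge> 0" using ip_nonneg[of \<beta>] by (simp add: ip_def \<beta>m form_simps)
  define q where "q = ip (proj \<hh> x) (proj \<hh> x)"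
  have q0: "q \<ge> 0" by (simp add: q_def ip_nonneg)
  have m: "m = B \<beta> \<beta> + \<nu> * q" using x(3,4) by (simp add: f_def \<beta>_def q_def)
  have "f X0 = M * (ip X0 X0)\<^sup>2" using X0 ip_pos[OF X0(2)] by (simp add: f_def proj_h_q ip_simps M)
  then have mM: "m \<le> M" using min[of X0] X0 X0_gr ip_pos[OF X0(2)] by simp
  \<comment> \<open>Collects the coefficient of x in the gradient: \<nu> q / 2 from the factor
    \<open>ip x x\<close> of the penalty and - m from the normalisation. As \<nu> q lies between 0
    and m, the absolute value of c is at most m.\<close>
  define c where "c = \<nu> * q / 2 - m"
  have \<nu>q: "0 \<le> \<nu> * q" "\<nu> * q \<le> m" using \<nu> q0 m \<beta>0 by auto
  define Y where "Y = br \<beta> x - c *\<^sub>R x - (\<nu> / 2) *\<^sub>R proj \<hh> x"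
  have pg: "proj \<hh> x \<in> \<gg> 1" using proj_h_gr[OF A_h x(2)] .
  have \<beta>g: "\<beta> \<in> \<gg> 0" using gr_br[OF x(2) gr_theta[OF A_minus x(2)]] by (simp add: \<beta>_def)
  have Yg: "Y \<in> \<gg> 1"
    unfolding Y_def using gr_br[OF \<beta>g x(2)] x(2) pg
    by (intro subspace_diff[OF gr_subspace] subspace_scale[OF gr_subspace]) auto
  have "ip (br Z x) Y = 0" if Z: "Z \<in> \<gg> 0" for Z
  proof -
    define \<delta> where "\<delta> = br Z x"
    define z where "z t = exp_ad br (t *\<^sub>R Z) x" for t :: real
    have z0: "z 0 = x" by (simp add: z_def exp_ad_zero[OF br_bilinear])
    have dz: "(z has_vector_derivative \<delta>) (at 0)"
      unfolding z_def \<delta>_def by (rule exp_ad_has_vector_derivative[OF br_bilinear])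
    have zC: "z t \<in> \<CC> \<inter> \<gg> 1" for t
    proof -
      have tZ: "t *\<^sub>R Z \<in> \<gg> 0" using Z gr_subspace subspace_scale by blast
      have "z t \<in> \<gg> 1" unfolding z_def
        by (rule exp_ad_in_subspace[OF br_bilinear gr_subspace _ x(2)]) (use gr_br[OF tZ] in auto)
      then show ?thesis using C_exp[OF x(1)] by (simp add: z_def)
    qed
    note bb = bilinear_conv_bounded_bilinear[THEN iffD1]
    note dth = bounded_linear.has_vector_derivative[OF bl(1) dz]
    note dp = bounded_linear.has_vector_derivative[OF bl(2) dz]
    note db = bounded_bilinear.has_vector_derivative[OF bb[OF br_bilinear] dz dth]
    note dB = bounded_bilinear.has_vector_derivative[OF bb[OF form_bilinear] db db]
    note dq = bounded_bilinear.has_vector_derivative[OF bb[OF ip_bilinear] dp dp]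
    note dn = bounded_bilinear.has_vector_derivative[OF bb[OF ip_bilinear] dz dz]
    note d1 = dB[folded has_real_derivative_iff_has_vector_derivative]
    note d2 = dq[folded has_real_derivative_iff_has_vector_derivative]
    note d3 = dn[folded has_real_derivative_iff_has_vector_derivative]
    note dT = DERIV_diff[OF DERIV_add[OF d1 DERIV_cmult[OF DERIV_mult[OF d2 d3], of \<nu>]]
        DERIV_cmult[OF DERIV_mult[OF d3 d3], of m]]
    have dG: "((\<lambda>t. f (z t) - m * (ip (z t) (z t) * ip (z t) (z t))) has_real_derivative
        (- 4 * ip \<delta> Y)) (at 0)"
      unfolding f_def
    proof (rule DERIV_cong[OF dT])
      have s1: "ip (proj \<hh> x) (proj \<hh> \<delta>) = ip \<delta> (proj \<hh> x)"
        using proj_perp[OF h_subspace proj_h_in, of \<delta> x] ip_commute by (simp add: ip_simps)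
      have s2: "ip (proj \<hh> \<delta>) (proj \<hh> x) = ip \<delta> (proj \<hh> x)" using s1 ip_commute by metis
      have "B \<beta> (br x (\<theta> \<delta>) + br \<delta> (\<theta> x)) = - 2 * ip \<delta> (br \<beta> x)"
        using form_moment_derivative[OF \<beta>m] by (simp add: form_simps)
      moreover have "B (br x (\<theta> \<delta>) + br \<delta> (\<theta> x)) \<beta> = - 2 * ip \<delta> (br \<beta> x)"
        using calculation form_commute by metis
      moreover have "ip \<delta> Y = ip \<delta> (br \<beta> x) - c * ip \<delta> x - \<nu> / 2 * ip \<delta> (proj \<hh> x)"
        by (simp add: Y_def ip_simps)
      ultimately show "B (br (z 0) (\<theta> (z 0))) (br (z 0) (\<theta> \<delta>) + br \<delta> (\<theta> (z 0))) +
          B (br (z 0) (\<theta> \<delta>) + br \<delta> (\<theta> (z 0))) (br (z 0) (\<theta> (z 0))) +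
          \<nu> * ((ip (proj \<hh> (z 0)) (proj \<hh> \<delta>) + ip (proj \<hh> \<delta>) (proj \<hh> (z 0))) * ip (z 0) (z 0) +
            (ip (z 0) \<delta> + ip \<delta> (z 0)) * ip (proj \<hh> (z 0)) (proj \<hh> (z 0))) -
          m * ((ip (z 0) \<delta> + ip \<delta> (z 0)) * ip (z 0) (z 0) + (ip (z 0) \<delta> + ip \<delta> (z 0)) * ip (z 0) (z 0)) =
          - 4 * ip \<delta> Y"
        unfolding z0 \<beta>_def[symmetric] q_def[symmetric] s1 s2 ip_commute[of x \<delta>] x(3)
        by (simp add: c_def algebra_simps)
    qed
    have "- 4 * ip \<delta> Y = 0"
    proof (rule DERIV_local_min[OF dG, of 1])
      show "\<forall>t. \<bar>0 - t\<bar> < 1 \<longrightarrow> f (z 0) - m * (ip (z 0) (z 0) * ip (z 0) (z 0))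
          \<le> f (z t) - m * (ip (z t) (z t) * ip (z t) (z t))"
        using min[OF zC] x(3,4) by (simp add: z0 power2_eq_square)
    qed simp
    then show ?thesis by (simp add: \<delta>_def)
  qed
  then have "br (\<theta> x) Y = 0" using gr_1_stationary[OF x(2) Yg] by blast
  moreover have "\<bar>c\<bar> \<le> M" "\<nu> * q \<le> M" using \<nu>q mM by (auto simp: c_def abs_le_iff)
  ultimately show thesis using that[of x c] x by (simp add: Y_def \<beta>_def q_def)
qed

lemma h_1_commutes:
  assumes "X \<in> \<CC> \<inter> \<qq>" "X \<in> \<gg> 1" "y \<in> \<hh>" "y \<in> \<gg> 1"
  shows "br y X = 0"
  using br_gr_1_in_q[OF assms(1,2,4)] br_h_q[OF assms(3)] assms(1) by blast

text \<open>If [\<theta> X, y] = 0, then both y and \<theta> y kill X, hence so does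
  [y, \<theta> y]. But that is a nonzero multiple of A, which fixes X.\<close>

lemma br_theta_h_1_injective:
  assumes X: "X \<in> \<CC> \<inter> \<qq>" "X \<in> \<gg> 1" "X \<noteq> 0" and y: "y \<in> \<hh>" "y \<in> \<gg> 1" and z: "br (\<theta> X) y = 0"
  shows "y = 0"
proof (rule ccontr)
  assume n: "y \<noteq> 0"
  have "br (\<theta> y) X = \<theta> (br y (\<theta> X))" by (simp add: theta_br)
  also have "\<dots> = 0" using z br_anti[of y "\<theta> X"] by (simp add: theta_simps)
  finally have "br (br y (\<theta> y)) X = 0"
    using jacobi[of y "\<theta> y" X] h_1_commutes[OF X(1,2) y] by (simp add: br_simps)
  then have "(ip y y / B A A) *\<^sub>R X = 0"
    using br_theta_self[OF y] X(2) by (simp add: br_simps gr_def)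
  then show False using X(3) ip_pos[OF n] form_A_pos by simp
qed

text \<open>The minimisers for penalty \<open>n\<close> converge, along a subsequence, to an element of \<open>\<qq>\<close>; the penalty
  terms stay bounded because \<open>ad (\<theta> X)\<close> is injective on the degree one part of \<open>\<hh>\<close>, and their
  limit is a Lagrange multiplier.\<close>

lemma critical_vector:
  obtains X y c where "X \<in> \<CC> \<inter> \<qq>" "X \<in> \<gg> 1" "X \<noteq> 0" "y \<in> \<hh>" "y \<in> \<gg> 1"
    "br (\<theta> X) (br (br X (\<theta> X)) X - c *\<^sub>R X - y) = 0"
proof -
  define M where "M = B (br X0 (\<theta> X0)) (br X0 (\<theta> X0)) / (ip X0 X0)\<^sup>2"
  define P where "P n x c \<longleftrightarrow> x \<in> \<CC> \<and> x \<in> \<gg> 1 \<and> ip x x = 1 \<and> \<bar>c\<bar> \<le> M \<and> real n * ip (proj \<hh> x) (proj \<hh> x) \<le> M \<and>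
    br (\<theta> x) (br (br x (\<theta> x)) x - c *\<^sub>R x - (real n / 2) *\<^sub>R proj \<hh> x) = 0" for n :: nat and x c
  have "\<exists>x c. P n x c" for n
    using penalised_minimum[OF of_nat_0_le_iff M_def, of n] unfolding P_def by metis
  then obtain x c where P: "\<And>n. P n (x n) (c n)" by metis
  note pl = proj_linear[OF h_subspace]
  define K where "K = {x \<in> \<gg> 1. x \<in> \<CC> \<and> ip x x = 1}"
  have "compact K"
  proof -
    \<comment> \<open>Comparison of \<open>ip\<close> with the Euclidean norm, obtained by
      minimising \<open>ip\<close> itself on the Euclidean sphere; it makes the unit sphere of
      \<open>ip\<close> bounded.\<close>
    obtain e where e: "e > 0" "\<And>x. ip x x = 1 \<Longrightarrow> e * norm x \<le> 1"
    proof -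
      interpret E: inner_form "(\<bullet>) :: 'a \<Rightarrow> 'a \<Rightarrow> real"
        by unfold_locales (auto simp: bilinear_def inner_commute inner_add_left inner_add_right intro!: linearI)
      have "\<exists>x m. x \<in> (UNIV :: 'a set) \<and> x \<bullet> x = 1 \<and> ip x x = m \<and> (\<forall>z\<in>UNIV. m * (z \<bullet> z) ^ 1 \<le> ip z z)"
        by (rule E.homogeneous_minimum[where w=A])
          (auto simp: A_nonzero ip_simps power2_eq_square intro!: ip_continuous continuous_on_id)
      then obtain x0 where x0: "x0 \<bullet> x0 = 1" "\<And>z. ip x0 x0 * (z \<bullet> z) \<le> ip z z" by auto
      have "x0 \<noteq> 0" using x0(1) by auto
      then have "ip x0 x0 > 0" by (rule ip_pos)
      moreover have "sqrt (ip x0 x0) * norm z \<le> 1" if "ip z z = 1" for z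
        using x0(2)[of z] that real_sqrt_le_mono[of "ip x0 x0 * (z \<bullet> z)" 1]
        by (simp add: real_sqrt_mult norm_eq_sqrt_inner)
      ultimately show thesis using that[of "sqrt (ip x0 x0)"] by simp
    qed
    have "norm z \<le> 1 / e" if "z \<in> K" for z using e that by (auto simp: K_def field_simps)
    then have "bounded K" unfolding bounded_iff by blast
    moreover have "closed K"
    proof -
      have "closed {x. ip x x = 1}"
        by (intro closed_Collect_eq ip_continuous continuous_on_id continuous_on_const)
      moreover have "K = \<gg> 1 \<inter> \<CC> \<inter> {x. ip x x = 1}" by (auto simp: K_def)
      ultimately show ?thesis using C_closed closed_subspace[OF gr_subspace] by auto
    qed
    ultimately show ?thesis by (simp add: compact_eq_bounded_closed)
  qed
  then have "compact (K \<times> {-M..M})" by (intro compact_Times) auto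
  moreover have "\<forall>n. (x n, c n) \<in> K \<times> {-M..M}" 
  proof
    fix n show "(x n, c n) \<in> K \<times> {-M..M}" using P[of n] by (auto simp: P_def K_def abs_le_iff)
  qed
  ultimately have "\<exists>l\<in>K \<times> {-M..M}. \<exists>r. strict_mono r \<and> ((\<lambda>n. (x n, c n)) \<circ> r) \<longlonglongrightarrow> l"
    unfolding compact_def by simp
  then obtain l r where l: "l \<in> K \<times> {-M..M}" and r: "strict_mono r"
    and lim: "((\<lambda>n. (x n, c n)) \<circ> r) \<longlonglongrightarrow> l"
    by blast
  obtain X d where ld: "l = (X, d)" by (cases l)
  have xl: "(\<lambda>n. x (r n)) \<longlonglongrightarrow> X" and dl: "(\<lambda>n. c (r n)) \<longlonglongrightarrow> d"
    using tendsto_fst[OF lim] tendsto_snd[OF lim] by (simp_all add: ld o_def)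
  have X: "X \<in> \<gg> 1" "X \<in> \<CC>" "ip X X = 1" using l by (auto simp: ld K_def)
  then have Xn: "X \<noteq> 0" by (auto simp: ip_simps)
  have tl: "(\<lambda>n. f (g n)) \<longlonglongrightarrow> f L" if "linear f" "g \<longlonglongrightarrow> L" for f :: "'a \<Rightarrow> 'a" and g L
    by (rule bounded_linear.tendsto[OF linear_conv_bounded_linear[THEN iffD1, OF that(1)] that(2)])
  note tb = bounded_bilinear.tendsto[OF bilinear_conv_bounded_bilinear[THEN iffD1]]
  have Xq: "X \<in> \<qq>"
  proof -
    have "(\<lambda>n. ip (proj \<hh> (x (r n))) (proj \<hh> (x (r n)))) \<longlonglongrightarrow> ip (proj \<hh> X) (proj \<hh> X)"
      by (intro tb[OF ip_bilinear] tl[OF pl] xl)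
    moreover have "(\<lambda>n. ip (proj \<hh> (x (r n))) (proj \<hh> (x (r n)))) \<longlonglongrightarrow> 0"
    proof (rule tendsto_sandwich[of "\<lambda>_. 0" _ _ "\<lambda>n. M * inverse (real n)"])
      show "\<forall>\<^sub>F n in sequentially. ip (proj \<hh> (x (r n))) (proj \<hh> (x (r n))) \<le> M * inverse (real n)"
      proof (rule eventually_sequentiallyI[of 1])
        fix n :: nat assume n: "1 \<le> n"
        have "n \<le> r n" using r by (rule seq_suble)
        then have "real n * ip (proj \<hh> (x (r n))) (proj \<hh> (x (r n))) \<le> real (r n) * ip (proj \<hh> (x (r n))) (proj \<hh> (x (r n)))"
          by (intro mult_right_mono) (auto simp: ip_nonneg)
        also have "\<dots> \<le> M" using P[of "r n"] by (simp add: P_def)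
        finally show "ip (proj \<hh> (x (r n))) (proj \<hh> (x (r n))) \<le> M * inverse (real n)"
          using n by (simp add: field_simps)
      qed
      show "(\<lambda>n. M * inverse (real n)) \<longlonglongrightarrow> 0"
        using tendsto_mult[OF tendsto_const lim_inverse_n, of M] by simp
    qed (auto simp: ip_nonneg)
    ultimately have "ip (proj \<hh> X) (proj \<hh> X) = 0" by (rule LIMSEQ_unique)
    then show ?thesis using proj_h_zero_iff by (simp add: ip_eq_zero_iff)
  qed
  define y where "y n = (real (r n) / 2) *\<^sub>R proj \<hh> (x (r n))" for n
  define b where "b n = br (\<theta> (x (r n))) (br (br (x (r n)) (\<theta> (x (r n)))) (x (r n)) - c (r n) *\<^sub>R x (r n))" for n
  define bX where "bX = br (\<theta> X) (br (br X (\<theta> X)) X - d *\<^sub>R X)"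
  have bl: "b \<longlonglongrightarrow> bX" unfolding b_def bX_def
    by (intro tb[OF br_bilinear] tl[OF theta_linear] tendsto_diff tendsto_scaleR xl dl)
  have by_eq: "br (\<theta> (x (r n))) (y n) = b n" for n
    using P[of "r n"] by (simp add: P_def b_def y_def br_diff_right)
  define W where "W = \<hh> \<inter> \<gg> 1"
  have W: "subspace W" using h_subspace gr_subspace by (simp add: W_def subspace_inter)
  have yW: "y n \<in> W" for n unfolding y_def using P[of "r n"] proj_h_in proj_h_gr[OF A_h] W
    by (intro subspace_scale[OF W]) (auto simp: W_def P_def)
  have "\<exists>e>0. \<forall>w\<in>W. norm (br (\<theta> X) w) \<ge> e * norm w"
    by (rule injective_imp_isometric[OF closed_subspace[OF W] W])
      (use br_linear_right br_theta_h_1_injective[of X] X Xq Xn in \<open>auto simp: W_def linear_conv_bounded_linear[symmetric]\<close>)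
  then obtain e where e: "e > 0" "\<And>w. w \<in> W \<Longrightarrow> norm (br (\<theta> X) w) \<ge> e * norm w" by blast
  obtain k where k: "k > 0" "\<And>v w. norm (br v w) \<le> norm v * norm w * k"
    using bounded_bilinear.pos_bounded[OF bilinear_conv_bounded_bilinear[THEN iffD1, OF br_bilinear]] by blast
  define \<epsilon> where "\<epsilon> n = norm (\<theta> X - \<theta> (x (r n)))" for n
  have \<epsilon>l: "\<epsilon> \<longlonglongrightarrow> 0" unfolding \<epsilon>_def
    by (rule tendsto_norm_zero) (use tendsto_diff[OF tendsto_const tl[OF theta_linear xl], of "\<theta> X"] in simp)
  have diff: "norm (br (\<theta> X) (y n) - b n) \<le> \<epsilon> n * norm (y n) * k" for n
    using k(2)[of "\<theta> X - \<theta> (x (r n))" "y n"] by (simp add: by_eq[symmetric] br_diff_left \<epsilon>_def)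
  have "\<forall>\<^sub>F n in sequentially. \<epsilon> n < e / (2 * k)"
    using order_tendstoD(2)[OF \<epsilon>l, of "e / (2 * k)"] e k by simp
  moreover have "\<forall>\<^sub>F n in sequentially. norm (b n) < norm bX + 1"
    using order_tendstoD(2)[OF tendsto_norm[OF bl], of "norm bX + 1"] by simp
  \<comment> \<open>Replacing \<theta> X by \<theta> of the minimiser eventually costs at most half
    of the lower bound e, which leaves a uniform bound on the multipliers.\<close>
  ultimately have yb: "\<forall>\<^sub>F n in sequentially. norm (y n) \<le> 2 / e * (norm bX + 1)"
  proof eventually_elim
    case (elim n)
    have "e * norm (y n) \<le> norm (br (\<theta> X) (y n))" by (rule e(2)[OF yW])
    also have "\<dots> \<le> norm (b n) + norm (br (\<theta> X) (y n) - b n)" by (rule norm_triangle_sub)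
    also have "\<dots> \<le> (norm bX + 1) + e / (2 * k) * norm (y n) * k"
      using diff[of n] elim k(1) mult_right_mono[of "\<epsilon> n" "e / (2 * k)" "norm (y n) * k"] by (simp add: mult.assoc)
    also have "e / (2 * k) * norm (y n) * k = e / 2 * norm (y n)" using k by simp
    finally show ?case using e(1) by (simp add: field_simps)
  qed
  have "(\<lambda>n. br (\<theta> X) (y n) - b n) \<longlonglongrightarrow> 0"
  proof (rule Lim_null_comparison)
    show "\<forall>\<^sub>F n in sequentially. norm (br (\<theta> X) (y n) - b n) \<le> \<epsilon> n * (2 / e * (norm bX + 1) * k)"
      using yb
    proof eventually_elim
      case (elim n)
      have "\<epsilon> n * norm (y n) * k \<le> \<epsilon> n * (2 / e * (norm bX + 1)) * k"
        using elim k(1) by (intro mult_right_mono mult_left_mono) (auto simp: \<epsilon>_def)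
      then show ?case using diff[of n] by (simp add: mult.assoc)
    qed
    show "(\<lambda>n. \<epsilon> n * (2 / e * (norm bX + 1) * k)) \<longlonglongrightarrow> 0" by (rule tendsto_mult_left_zero[OF \<epsilon>l])
  qed
  from tendsto_add[OF this bl] have "(\<lambda>n. br (\<theta> X) (y n)) \<longlonglongrightarrow> bX" by simp
  then have lim_bX: "(\<lambda>n. br (\<theta> X) (y n)) \<longlonglongrightarrow> bX" .
  \<comment> \<open>The multipliers themselves are not shown to converge: their images under
    ad(\<theta> X) do, and the closed image of W contains the limit.\<close>
  have "closed (br (\<theta> X) ` W)" by (rule closed_subspace[OF linear_subspace_image[OF br_linear_right W]])
  moreover have "br (\<theta> X) (y n) \<in> br (\<theta> X) ` W" for n using yW by blast
  ultimately have "bX \<in> br (\<theta> X) ` W" using lim_bX by (rule closed_sequentially)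
  then obtain w where w: "w \<in> W" "bX = br (\<theta> X) w" by blast
  then have "br (\<theta> X) (br (br X (\<theta> X)) X - d *\<^sub>R X - w) = 0" by (simp add: bX_def br_diff_right)
  then show thesis using that[of X w d] X Xq Xn w(1) by (simp add: W_def)
qed

end

text \<open>The projection to an invariant subspace commutes with a self-adjoint f, so projecting
  the sum projects each eigencomponent separately.\<close>

lemma (in inner_form) eigencomponent_in_subspace:
  assumes "linear f" and sa: "\<And>x y. ip (f x) y = ip x (f y)" and F: "subspace F" "\<And>x. x \<in> F \<Longrightarrow> f x \<in> F"
    and S: "finite S" "(\<Sum>s\<in>S. e s) \<in> F" "\<And>s. s \<in> S \<Longrightarrow> f (e s) = s *\<^sub>R e s" and t: "t \<in> S"
  shows "e t \<in> F"
proof -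
  have fp: "proj F (f x) = f (proj F x)" for x
  proof (rule proj_unique[OF F(1)])
    show "f (proj F x) \<in> F" using F proj_in by blast
    show "ip (f x - f (proj F x)) v = 0" if "v \<in> F" for v
      using proj_perp[OF F(1) F(2)[OF that], of x] by (simp add: linear_diff[OF assms(1), symmetric] sa)
  qed
  note pl = proj_linear[OF F(1)]
  have "e t - proj F (e t) = 0"
  proof (rule eigenvectors_sum_zero[OF sa S(1) _ _ t])
    show "f (e s - proj F (e s)) = s *\<^sub>R (e s - proj F (e s))" if "s \<in> S" for s
      using S(3)[OF that] by (simp add: linear_diff[OF assms(1)] fp[symmetric] linear_scale[OF pl] scaleR_diff_right)
    show "(\<Sum>s\<in>S. e s - proj F (e s)) = 0"
      using proj_id[OF F(1) S(2)] by (simp add: sum_subtractf linear_sum[OF pl])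
  qed
  then show ?thesis using proj_in[OF F(1), of "e t"] by simp
qed

context lie_cartan begin

text \<open>This is B multiplied by w on I and unchanged on its complement. For an ideal stable
  under \<theta> the projection commutes with \<theta> and with ad, which keeps symmetry and
  invariance; w > 0 keeps positivity.\<close>

lemma rescaled_form:
  assumes I: "lie_ideal br UNIV I" "\<And>x. x \<in> I \<Longrightarrow> \<theta> x \<in> I" and w: "w > 0"
  shows "cartan_form \<theta> (\<lambda>P Q. B P Q + (w - 1) * B (proj I P) Q)" (is "cartan_form \<theta> ?B'")
    and "B (br X Y) Z + (w - 1) * B (proj I (br X Y)) Z = - (B Y (br X Z) + (w - 1) * B (proj I Y) (br X Z))"
proof -
  have s: "subspace I" and id: "\<And>x y. y \<in> I \<Longrightarrow> br x y \<in> I" using I(1) by (auto simp: lie_ideal_def)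
  note pl = proj_linear[OF s] and pi = proj_in[OF s] and pp = proj_perp[OF s]
  have ip_proj: "ip (proj I P) Q = ip (proj I P) (proj I Q)" for P Q
    using pp[OF pi, of Q P] ip_commute[of "proj I P" "Q - proj I Q"] by (simp add: ip_simps)
  have pt: "proj I (\<theta> P) = \<theta> (proj I P)" for P
  proof (rule proj_unique[OF s I(2)[OF pi]])
    show "ip (\<theta> P - \<theta> (proj I P)) v = 0" if "v \<in> I" for v
      using pp[OF I(2)[OF that], of P] ip_theta[of "P - proj I P" "\<theta> v"] by (simp add: theta_simps)
  qed
  have pb: "proj I (br X Y) = br X (proj I Y)" for X Y
  proof (rule proj_unique[OF s id[OF pi]])
    show "ip (br X Y - br X (proj I Y)) v = 0" if "v \<in> I" for v
      using pp[OF id[OF that], of Y "\<theta> X"] by (simp add: br_diff_right[symmetric] ip_br)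
  qed
  have sw: "B (proj I P) Q = B P (proj I Q)" for P Q
    using ip_proj[of P "\<theta> Q"] ip_proj[of "\<theta> Q" P] ip_commute[of "proj I P" "proj I (\<theta> Q)"]
      ip_commute[of "proj I (\<theta> Q)" P] by (simp add: ip_def pt)
  have pos: "- ?B' P (\<theta> P) > 0" if "P \<noteq> 0" for P
  proof -
    have "- ?B' P (\<theta> P) = ip P P + (w - 1) * ip (proj I P) P" by (simp add: ip_def algebra_simps)
    also have "\<dots> = ip (P - proj I P) (P - proj I P) + w * ip (proj I P) (proj I P)"
      using ip_proj[of P P] ip_commute[of P "proj I P"] by (simp add: ip_simps algebra_simps)
    also have "\<dots> > 0"
    proof (cases "proj I P = 0")
      case True
      then show ?thesis using ip_pos[OF that] by (simp add: ip_simps)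
    next
      case False
      then show ?thesis using w ip_pos[OF False] ip_nonneg[of "P - proj I P"] by (simp add: add_nonneg_pos)
    qed
    finally show ?thesis .
  qed
  show "cartan_form \<theta> ?B'"
    unfolding cartan_form_def
  proof (intro conjI allI impI)
    show "bilinear ?B'"
      unfolding bilinear_def by (auto intro!: linearI simp: form_simps linear_add[OF pl] linear_scale[OF pl] algebra_simps)
    show "?B' P Q = ?B' Q P" for P Q using sw[of P Q] form_commute by metis
    show "P = 0" if "\<forall>Q. ?B' P Q = 0" for P using pos[of P] that by fastforce
    show "- ?B' P (\<theta> Q) = - ?B' Q (\<theta> P)" for P Q
      using sw[of P "\<theta> Q"] pt[of Q] form_theta_swap[of P Q] form_theta_swap[of "proj I Q" P] form_commute
      by (metis form_theta_swap)
    show "P \<noteq> 0 \<Longrightarrow> - ?B' P (\<theta> P) > 0" for P by (rule pos)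
  qed
  show "B (br X Y) Z + (w - 1) * B (proj I (br X Y)) Z = - (B Y (br X Z) + (w - 1) * B (proj I Y) (br X Z))"
    by (simp add: pb invariant algebra_simps)
qed

end

section \<open>Critical vectors with a nonzero multiplier\<close>

locale critical_pair = graded_pair +
  fixes X y :: "'a::euclidean_space" and c :: real
  assumes X: "X \<in> \<CC> \<inter> \<qq>" "X \<in> gr A 1" "X \<noteq> 0" and y: "y \<in> \<hh>" "y \<in> gr A 1" "y \<noteq> 0"
    and crit: "br (\<theta> X) (br (br X (\<theta> X)) X - c *\<^sub>R X - y) = 0"
begin

definition "\<beta> = br X (\<theta> X)"
definition "y1 = br \<beta> X - c *\<^sub>R X"
text \<open>The assumption \<open>crit\<close> says that y2 commutes with \<theta> X. It will turn
  out to commute with X, y1 and their images under \<theta>, so it splits off.\<close>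

definition "y2 = y - y1"
definition "u = br y (\<theta> X)"
text \<open>The constant in [y, \<theta> y] = - \<kappa> A, and later the common scale of all the
  copies of sl2.\<close>

definition "\<kappa> = ip y y / B A A"
definition "v = br u X"

section \<open>Brackets of \<open>X\<close>, \<open>y\<close> and \<open>u\<close>\<close>

lemma \<kappa>_pos: "\<kappa> > 0"
  using ip_pos[OF y(3)] form_A_pos by (simp add: \<kappa>_def)

lemma y_split: "y1 + y2 = y" by (simp add: y2_def)

lemma y_splits: "br y W = br y1 W + br y2 W" "br W y = br W y1 + br W y2" "\<theta> y = \<theta> y1 + \<theta> y2"
  using br_add_left[of y1 y2 W] br_add_right[of W y1 y2] linear_add[OF theta_linear, of y1 y2]
  by (simp_all add: y_split)

lemma br_y_ty: "br y (\<theta> y) = - \<kappa> *\<^sub>R A" "br (\<theta> y) y = \<kappa> *\<^sub>R A"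
  using br_theta_self[OF y(1,2)] br_anti[of "\<theta> y" y] by (simp_all add: \<kappa>_def)

lemma tX: "\<theta> X \<in> \<gg> (- 1)" and ty: "\<theta> y \<in> \<gg> (- 1)"
  using gr_theta[OF A_minus] X(2) y(2) by auto

lemma br_A: "br A X = X" "br X A = - X" "br A (\<theta> X) = - \<theta> X" "br (\<theta> X) A = \<theta> X"
  using X(2) tX br_anti[of X A] br_anti[of "\<theta> X" A] by (auto simp: gr_def)

lemma theta_\<beta>: "\<theta> \<beta> = - \<beta>"
  using br_anti[of "\<theta> X" X] by (simp add: \<beta>_def theta_br)

lemma \<beta>_gr: "\<beta> \<in> \<gg> 0" using gr_br[OF X(2) tX] by (simp add: \<beta>_def)

lemma y1_gr: "y1 \<in> \<gg> 1"
  unfolding y1_def using gr_br[OF \<beta>_gr X(2)] X(2) gr_subspace by (simp add: subspace_diff subspace_scale)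

lemma y2_gr: "y2 \<in> \<gg> 1"
  unfolding y2_def using y(2) y1_gr gr_subspace by (simp add: subspace_diff)

lemma u_gr: "u \<in> \<gg> 0" using gr_br[OF y(2) tX] by (simp add: u_def)

lemma v_gr: "v \<in> \<gg> 1" using gr_br[OF u_gr X(2)] by (simp add: v_def)

lemma br_y_X: "br y X = 0" "br X y = 0" "br (\<theta> y) (\<theta> X) = 0"
  using h_1_commutes[OF X(1,2) y(1,2)] br_anti[of X y] theta_br[of y X] by (simp_all add: theta_simps)

lemma br_y2_tX: "br (\<theta> X) y2 = 0" "br y2 (\<theta> X) = 0" "br X (\<theta> y2) = 0" "br (\<theta> y2) X = 0"
proof -
  have e: "y2 = - (br (br X (\<theta> X)) X - c *\<^sub>R X - y)" by (simp add: y2_def y1_def \<beta>_def)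
  show 1: "br (\<theta> X) y2 = 0" unfolding e br_minus_right crit by simp
  then show 2: "br y2 (\<theta> X) = 0" using br_anti[of y2 "\<theta> X"] by simp
  show "br X (\<theta> y2) = 0" using theta_br[of "\<theta> X" y2] 1 by (simp add: theta_simps)
  show "br (\<theta> y2) X = 0" using theta_br[of y2 "\<theta> X"] 2 by (simp add: theta_simps)
qed

lemma u_eq1: "u = br y1 (\<theta> X)"
  by (simp add: u_def y_splits(1) br_y2_tX)

text \<open>As y2 commutes with \<theta> X, u = [[\<beta>, X], \<theta> X] - c \<beta>. Expanding
  [\<beta>, \<beta>] = 0 by the Jacobi identity shows that \<theta> negates the first term too.
  Hence ad u is self-adjoint.\<close>

lemma theta_u: "\<theta> u = - u"
proof -
  have "u = br (br \<beta> X) (\<theta> X) - c *\<^sub>R \<beta>" by (simp add: u_eq1 y1_def br_simps \<beta>_def)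
  moreover have "\<theta> (br (br \<beta> X) (\<theta> X)) = - br (br \<beta> X) (\<theta> X)"
  proof -
    have "\<theta> (br (br \<beta> X) (\<theta> X)) = - br (br \<beta> (\<theta> X)) X" by (simp add: theta_br theta_\<beta> br_simps)
    moreover have "br \<beta> \<beta> = br (br \<beta> X) (\<theta> X) + br X (br \<beta> (\<theta> X))"
      using jacobi[of \<beta> X "\<theta> X"] by (simp add: \<beta>_def)
    then have "br (br \<beta> X) (\<theta> X) = br (br \<beta> (\<theta> X)) X"
      using br_anti[of X "br \<beta> (\<theta> X)"] by simp
    ultimately show ?thesis by simp
  qed
  ultimately show ?thesis by (simp add: theta_simps theta_\<beta>)
qed

lemma u_eq2: "u = br X (\<theta> y)" "br (\<theta> y) X = - u"
proof -
  have "\<theta> u = br (\<theta> y) X" by (simp add: u_def theta_br)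
  then show "br (\<theta> y) X = - u" using theta_u by simp
  then show "u = br X (\<theta> y)" using br_anti[of X "\<theta> y"] by simp
qed

lemma u_theta: "br u (\<theta> Z) = - \<theta> (br u Z)"
  by (simp add: theta_br theta_u br_simps)

lemma br_u_y: "br u y = - \<kappa> *\<^sub>R X" "br u (\<theta> y) = \<kappa> *\<^sub>R \<theta> X"
proof -
  show "br u y = - \<kappa> *\<^sub>R X"
    using jacobi_left[of X "\<theta> y" y] br_y_ty br_y_X br_A by (simp add: u_eq2(1)[symmetric] br_simps)
  then show "br u (\<theta> y) = \<kappa> *\<^sub>R \<theta> X" by (simp add: u_theta theta_simps)
qed

text \<open>Brackets with \<theta> y bring z down to degree one and to degree zero in
  \<open>\<hh>\<close>, where elements commute with X or are controlled by A. The second claim is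
  what makes [[\<beta>, X], X] vanish.\<close>

lemma h_degree_2:
  assumes z: "z \<in> \<hh>" "z \<in> \<gg> 2"
  shows "br u z = 0" and "ip z (br X (br \<beta> X)) = 0"
proof -
  have tyz: "br (\<theta> y) z \<in> \<hh>" "br (\<theta> y) z \<in> \<gg> 1" using h_br h_theta y(1) z gr_br[OF ty z(2)] by auto
  have Xz: "br X z = 0" by (rule gr_ge_3[OF gr_br[OF X(2) z(2)]]) simp
  have "br X (br (\<theta> y) z) = 0"
    using h_1_commutes[OF X(1,2) tyz] br_anti[of X "br (\<theta> y) z"] by simp
  then show uz: "br u z = 0" using jacobi_left[of X "\<theta> y" z] Xz by (simp add: u_eq2(1) br_simps)
  define w where "w = br z (\<theta> y)"
  have wh: "w \<in> \<hh>" and wg: "w \<in> \<gg> 1" using h_br h_theta y(1) z gr_br[OF z(2) ty] by (auto simp: w_def)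
  define D where "D = br w (\<theta> y)"
  have Dh: "D \<in> \<hh>" and Dg: "D \<in> \<gg> 0" using h_br h_theta y(1) wh gr_br[OF wg ty] by (auto simp: D_def)
  have "br (\<theta> y) A = \<theta> y" using ty br_anti[of "\<theta> y" A] by (simp add: gr_def)
  then have "B D A = B w (\<theta> y)" by (simp add: D_def form_right[symmetric])
  also have "\<dots> = 0" by (simp add: w_def form_right[symmetric] form_simps)
  finally have DA: "B D A = 0" .
  \<comment> \<open>D is B-orthogonal to A, so this difference is zero and \<theta> fixes D. Then ad
    D commutes with \<theta>, and invariance of B makes the squared length of \<beta> stationary
    along [D, X], which is \<kappa> [z, \<theta> X].\<close>
  have "D - \<theta> D = (B (D - \<theta> D) A / B A A) *\<^sub>R A"
    by (rule h_minus_gr_0)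
      (use Dh Dg h_theta h_subspace gr_theta[OF A_minus Dg] gr_subspace in \<open>auto simp: theta_simps subspace_diff\<close>)
  also have "B (D - \<theta> D) A = 0" using DA by (simp add: form_simps form_theta_swap A_minus)
  finally have tD: "\<theta> D = D" by simp
  have "br D X = br w (br (\<theta> y) X) - br (\<theta> y) (br w X)" unfolding D_def by (rule jacobi_left)
  also have "br w X = 0" by (rule h_1_commutes[OF X(1,2) wh wg])
  finally have "br D X = br u w" using br_anti[of u w] by (simp add: u_eq2 br_simps)
  also have "br u w = \<kappa> *\<^sub>R br z (\<theta> X)"
    using jacobi[of u z "\<theta> y"] uz by (simp add: w_def br_u_y br_simps)
  finally have DX: "br D X = \<kappa> *\<^sub>R br z (\<theta> X)" .
  have "br D \<beta> = br (br D X) (\<theta> X) + br X (\<theta> (br D X))"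
    using jacobi[of D X "\<theta> X"] tD by (simp add: \<beta>_def theta_br)
  then have "B \<beta> (br D \<beta>) = B \<beta> (br (br D X) (\<theta> X)) + B \<beta> (br X (\<theta> (br D X)))"
    by (simp only: form_simps)
  moreover have "B \<beta> (br D \<beta>) = 0"
    using invariant[of D \<beta> \<beta>] form_commute[of \<beta> "br D \<beta>"] by simp
  ultimately have "ip (br D X) (br \<beta> X) = 0"
    using form_moment_derivative(1)[OF theta_\<beta>, of "br D X" X]
      form_moment_derivative(2)[OF theta_\<beta>, of X "br D X"] by simp
  then have "ip (br z (\<theta> X)) (br \<beta> X) = 0" using \<kappa>_pos by (simp add: DX ip_simps)
  then have "ip (br (\<theta> X) z) (br \<beta> X) = 0" using br_anti[of z "\<theta> X"] by (simp add: ip_simps)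
  then show "ip z (br X (br \<beta> X)) = 0" by (simp add: ip_br)
qed

section \<open>Vanishing brackets in degree two and closure under ad u\<close>

lemma gr_2_in_q:
  assumes w: "w \<in> \<gg> 2" "\<And>z. z \<in> \<hh> \<Longrightarrow> z \<in> \<gg> 2 \<Longrightarrow> ip z w = 0"
  shows "w \<in> \<qq>"
proof -
  have "ip (proj \<hh> w) w = 0" using w(2)[OF proj_h_in proj_h_gr[OF A_h w(1)]] .
  moreover have "ip (w - proj \<hh> w) (proj \<hh> w) = 0" by (rule proj_perp[OF h_subspace proj_h_in])
  ultimately have "ip (proj \<hh> w) (proj \<hh> w) = 0" using ip_commute[of w] by (simp add: ip_simps)
  then show ?thesis by (simp add: ip_eq_zero_iff proj_h_zero_iff)
qed

lemma br_gr_1_zero: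
  assumes Z: "Z \<in> \<gg> 1" "\<And>z. z \<in> \<hh> \<Longrightarrow> z \<in> \<gg> 2 \<Longrightarrow> ip z (br Z X) = 0"
  shows "br Z X = 0"
  by (rule br_gr_1_in_q[OF X(1,2) Z(1) gr_2_in_q[OF _ Z(2)]]) (use gr_br[OF Z(1) X(2)] in auto)

lemma br_\<beta>X_X: "br (br \<beta> X) X = 0"
  by (rule br_gr_1_zero) (use gr_br[OF \<beta>_gr X(2)] h_degree_2(2) br_anti[of "br \<beta> X" X] in \<open>auto simp: ip_simps\<close>)

lemma y12_X: "br y1 X = 0" "br X y1 = 0" "br y2 X = 0" "br X y2 = 0" "br (\<theta> y2) (\<theta> X) = 0"
proof -
  show 1: "br y1 X = 0" by (simp add: y1_def br_simps br_\<beta>X_X)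
  then show "br X y1 = 0" using br_anti[of X y1] by simp
  show 2: "br y2 X = 0" using 1 br_y_X(1) by (simp add: y2_def br_simps)
  then show "br X y2 = 0" using br_anti[of X y2] by simp
  show "br (\<theta> y2) (\<theta> X) = 0" using 2 theta_br[of y2 X] by (simp add: theta_simps)
qed

text \<open>y2 and \<theta> y2 commute with X and \<theta> X, hence by the Jacobi identity with
  everything these two generate, in particular with \<beta>, y1 and u.\<close>

lemma y2_commutes: "br y2 y1 = 0" "br (\<theta> y2) y1 = 0" "br y1 (\<theta> y2) = 0" "br y2 (\<theta> y1) = 0"
  "br y y1 = 0" "br u y2 = 0" "br u (\<theta> y2) = 0"
proof -
  have "br y2 \<beta> = 0" using jacobi[of y2 X "\<theta> X"] by (simp add: \<beta>_def y12_X br_y2_tX br_simps)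
  then have "br y2 (br \<beta> X) = 0" using jacobi[of y2 \<beta> X] by (simp add: y12_X br_simps)
  then show 1: "br y2 y1 = 0" by (simp add: y1_def br_simps y12_X)
  have "br (\<theta> y2) \<beta> = 0" using jacobi[of "\<theta> y2" X "\<theta> X"] by (simp add: \<beta>_def y12_X br_y2_tX br_simps)
  then have "br (\<theta> y2) (br \<beta> X) = 0" using jacobi[of "\<theta> y2" \<beta> X] by (simp add: br_y2_tX br_simps)
  then show 2: "br (\<theta> y2) y1 = 0" by (simp add: y1_def br_simps br_y2_tX)
  then show "br y1 (\<theta> y2) = 0" using br_anti[of y1 "\<theta> y2"] by simp
  show "br y2 (\<theta> y1) = 0" using theta_br[of "\<theta> y2" y1] 2 by (simp add: theta_simps)
  show "br y y1 = 0" by (simp add: y_splits(1) 1)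
  have "br y2 u = 0" using jacobi[of y2 y1 "\<theta> X"] by (simp add: u_eq1 1 br_y2_tX br_simps)
  then show 3: "br u y2 = 0" using br_anti[of u y2] by simp
  then show "br u (\<theta> y2) = 0" by (simp add: u_theta theta_simps)
qed

text \<open>By \<open>br_gr_1_zero\<close> it suffices to pair with degree two elements of
  \<open>\<hh>\<close>. Moving brackets across B until y stands alone, each term with [y, X] drops
  out, and the rest contains [y, [\<beta>, X]], which is zero.\<close>

lemma br_v_X: "br v X = 0" "br X v = 0"
proof -
  have "ip z (br v X) = 0" if z: "z \<in> \<hh>" "z \<in> \<gg> 2" for z
  proof -
    define Z P where "Z = \<theta> z" and "P = br X Z"
    have y0: "B y (br X Q) = 0" for Q using form_right[of y X Q] by (simp add: br_y_X form_simps)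
    have "B (br v X) Z = B u (br X P)"
      using form_right[of u X P] form_right[of v X Z] by (simp add: v_def P_def)
    also have "\<dots> = B y (br (\<theta> X) (br X P))" using form_right[of y "\<theta> X" "br X P"] by (simp add: u_def)
    also have "br (\<theta> X) (br X P) = - br \<beta> P + br X (br (\<theta> X) P)"
      using jacobi[of "\<theta> X" X P] br_anti[of "\<theta> X" X] by (simp add: \<beta>_def br_minus_left)
    also have "B y \<dots> = - B y (br \<beta> P)" by (simp add: form_simps y0)
    also have "br \<beta> P = br (br \<beta> X) Z + br X (br \<beta> Z)" unfolding P_def by (rule jacobi)
    also have "- B y \<dots> = - B (br y (br \<beta> X)) Z"
      using form_right[of y "br \<beta> X" Z] by (simp add: form_simps y0)
    also have "br y (br \<beta> X) = 0"
    proof -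
      have "br \<beta> X = y1 + c *\<^sub>R X" by (simp add: y1_def)
      then show ?thesis using y2_commutes(5) br_y_X(1) by (simp add: br_add_right br_scale_right)
    qed
    finally have "ip (br v X) z = 0" by (simp add: ip_def Z_def form_simps)
    then show ?thesis using ip_commute[of z "br v X"] by simp
  qed
  then show "br v X = 0" by (rule br_gr_1_zero[OF v_gr])
  then show "br X v = 0" using br_anti[of X v] by simp
qed

lemma br_u_y1: "br u y1 = - \<kappa> *\<^sub>R X"
  using br_u_y(1) y2_commutes(6) y_splits(2)[of u] by simp

lemma br_y12_v: "br y1 v = 0" "br y2 v = 0" "br (\<theta> y2) v = 0"
proof -
  show "br y1 v = 0" using jacobi[of u y1 X] br_u_y1 by (simp add: y12_X br_simps v_def)
  have "br y2 u = 0" using y2_commutes(6) br_anti[of y2 u] by simp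
  then show "br y2 v = 0" using jacobi[of y2 u X] by (simp add: y12_X br_simps v_def)
  have "br (\<theta> y2) u = 0" using y2_commutes(7) br_anti[of "\<theta> y2" u] by simp
  then show "br (\<theta> y2) v = 0" using jacobi[of "\<theta> y2" u X] by (simp add: br_y2_tX br_simps v_def)
qed

lemma br_v_ty: "br v (\<theta> y) = - \<kappa> *\<^sub>R \<beta>"
proof -
  have "\<kappa> *\<^sub>R \<beta> = br X (br u (\<theta> y))" by (simp add: br_u_y \<beta>_def br_simps)
  also have "\<dots> = br (br X u) (\<theta> y) + br u (br X (\<theta> y))" by (rule jacobi)
  also have "\<dots> = - br v (\<theta> y)" using br_anti[of X u] by (simp add: u_eq2(1)[symmetric] v_def br_simps)
  finally show ?thesis by simp
qed

text \<open>This closes the list: ad u sends y1 to a multiple of X, X to v, and v back to the span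
  of y1 and X, while it kills y2.\<close>

lemma br_u_v: "br u v = - \<kappa> *\<^sub>R (y1 + c *\<^sub>R X)"
proof -
  have "- \<kappa> *\<^sub>R br \<beta> X = br (br v (\<theta> y)) X" by (simp add: br_v_ty br_simps)
  also have "\<dots> = br v (br (\<theta> y) X) - br (\<theta> y) (br v X)" by (rule jacobi_left)
  also have "\<dots> = br u v" using br_anti[of v u] by (simp add: u_eq2(2) br_v_X br_simps)
  finally show ?thesis by (simp add: y1_def)
qed

text \<open>On the span of \<open>y1\<close>, \<open>X\<close>, \<open>v\<close> and \<open>y2\<close> the operator \<open>ad u\<close> acts like multiplication by \<open>X\<close>
  in a formally real Jordan algebra with unit proportional to \<open>y\<close>; its eigencomponents of \<open>y\<close> are the
  orthogonal idempotents.\<close>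

definition "F = span {y1, X, v, y2}"

lemma F_subspace: "subspace F" by (simp add: F_def)

lemma F_gr: "P \<in> F \<Longrightarrow> P \<in> \<gg> 1"
  unfolding F_def using span_minimal[OF _ gr_subspace, of "{y1, X, v, y2}" A 1] X(2) y1_gr y2_gr v_gr by blast

lemma F_stable: assumes "P \<in> F" shows "br u P \<in> F"
proof -
  have g: "br u y1 \<in> F" "br u X \<in> F" "br u v \<in> F" "br u y2 \<in> F"
    unfolding br_u_y1 br_u_v y2_commutes(6) v_def[symmetric] F_def
    by (auto intro!: span_neg span_scale span_add span_zero intro: span_base)
  show ?thesis using assms unfolding F_def
  proof (induction rule: span_induct_alt)
    case (step k p q)
    then show ?case using g by (auto simp: br_simps F_def intro!: span_add span_scale)
  qed (simp add: br_simps span_zero)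
qed

lemma F_bilinear_zero:
  assumes h: "bilinear h" and g: "\<And>p q. p \<in> {y1, X, v, y2} \<Longrightarrow> q \<in> {y1, X, v, y2} \<Longrightarrow> h p q = 0"
    and PQ: "P \<in> F" "Q \<in> F"
  shows "h P Q = (0::'a)"
proof -
  have "h p Q = 0" if "p \<in> {y1, X, v, y2}" for p
    using linear_eq_0_on_span[of "h p" "{y1, X, v, y2}" Q] h g[OF that] PQ(2) by (auto simp: F_def bilinear_def)
  then show ?thesis
    using linear_eq_0_on_span[of "\<lambda>p. h p Q" "{y1, X, v, y2}" P] h PQ(1) by (auto simp: F_def bilinear_def)
qed

lemma F_abelian: "P \<in> F \<Longrightarrow> Q \<in> F \<Longrightarrow> br P Q = 0"
  by (rule F_bilinear_zero[OF br_bilinear])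
    (use y12_X y2_commutes br_v_X br_y12_v br_anti[of y1 y2] br_anti[of v y1] br_anti[of v y2] in auto)

text \<open>The hard case is m = [v, \<theta> X]. Computing [u, \<beta>] from \<beta> =
  [X, \<theta> X] gives m + \<theta> m; computing it from [v, \<theta> y] = - \<kappa> \<beta> gives
  p - m with \<theta> p = - p. Comparing this equation with its image under \<theta> yields 3 (m +
  \<theta> m) = 0.\<close>

lemma F_minus_generators:
  "\<theta> (br X (\<theta> y1)) = - br X (\<theta> y1)" "\<theta> (br v (\<theta> y1)) = - br v (\<theta> y1)" "\<theta> (br v (\<theta> X)) = - br v (\<theta> X)"
proof -
  have "br X (\<theta> y1) = u" by (simp add: u_eq2(1) y_splits(3) br_add_right br_y2_tX)
  then show "\<theta> (br X (\<theta> y1)) = - br X (\<theta> y1)" using theta_u by simp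
  have "br v (\<theta> y2) = 0" using br_y12_v(3) br_anti[of v "\<theta> y2"] by simp
  then have "br v (\<theta> y1) = - \<kappa> *\<^sub>R \<beta>" using br_v_ty by (simp add: y_splits(3) br_add_right)
  then show "\<theta> (br v (\<theta> y1)) = - br v (\<theta> y1)" by (simp add: theta_simps theta_\<beta>)
  define m q1 where "m = br v (\<theta> X)" and "q1 = br y1 (\<theta> y1)"
  have q1: "\<theta> q1 = - q1" using br_anti[of "\<theta> y1" y1] by (simp add: q1_def theta_br)
  have "\<theta> m = br (\<theta> v) X" by (simp add: m_def theta_br)
  then have "br X (\<theta> v) = - \<theta> m" using br_anti[of X "\<theta> v"] by simp
  then have e1: "br u \<beta> = m + \<theta> m"
    using jacobi[of u X "\<theta> X"] by (simp add: \<beta>_def m_def u_theta v_def[symmetric] br_simps)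
  have "br (y1 + c *\<^sub>R X) (\<theta> y) = q1 + c *\<^sub>R u"
    by (simp add: br_simps u_eq2(1)[symmetric] q1_def) (simp add: y_splits(3) br_add_right y2_commutes)
  then have "br u (br v (\<theta> y)) = - \<kappa> *\<^sub>R (q1 + c *\<^sub>R u) + \<kappa> *\<^sub>R m"
    unfolding jacobi[of u v "\<theta> y"] br_u_v br_u_y(2) by (simp only: br_simps m_def)
  then have "\<kappa> *\<^sub>R br u \<beta> = \<kappa> *\<^sub>R (q1 + c *\<^sub>R u - m)"
    by (simp add: br_v_ty br_simps algebra_simps)
  then have e2: "br u \<beta> = q1 + c *\<^sub>R u - m" using \<kappa>_pos by simp
  define p where "p = q1 + c *\<^sub>R u"
  have p: "\<theta> p = - p" by (simp add: p_def theta_simps q1 theta_u)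
  have E: "m + \<theta> m = p - m" using e1 e2 by (simp add: p_def)
  then have "\<theta> (m + \<theta> m) = \<theta> (p - m)" by simp
  then have E': "\<theta> m + m = - p - \<theta> m" by (simp add: theta_simps p)
  have "3 *\<^sub>R (m + \<theta> m) = (m + \<theta> m) + (m + \<theta> m) + (m + \<theta> m)" 
    using scaleR_add_left[of 1 2 "m + \<theta> m"] scaleR_2[of "m + \<theta> m"] by (simp add: add.assoc)
  also have "\<dots> = (p - m) + (- p - \<theta> m) + (m + \<theta> m)" using E E' by (simp add: add.commute)
  also have "\<dots> = 0" by simp
  finally have "m + \<theta> m = 0" by simp
  then show "\<theta> (br v (\<theta> X)) = - br v (\<theta> X)" by (simp add: m_def[symmetric] eq_neg_iff_add_eq_0 add.commute)
qed

text \<open>The symmetry of [P, \<theta> Q] in P and Q is the Jordan-type property behind the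
  orthogonality of the later pieces: it makes their mixed brackets vanish.\<close>

lemma F_minus:
  assumes "P \<in> F" "Q \<in> F"
  shows "\<theta> (br P (\<theta> Q)) = - br P (\<theta> Q)" "br P (\<theta> Q) = br Q (\<theta> P)"
proof -
  have sym: "\<theta> (br q (\<theta> p)) = - br q (\<theta> p)" if "\<theta> (br p (\<theta> q)) = - br p (\<theta> q)" for p q
  proof -
    have "\<theta> (br q (\<theta> p)) = - br p (\<theta> q)" using br_anti[of "\<theta> q" p] by (simp add: theta_br)
    also have "\<dots> = \<theta> (br p (\<theta> q))" using that by simp
    also have "\<dots> = - br q (\<theta> p)" using br_anti[of "\<theta> p" q] by (simp add: theta_br)
    finally show ?thesis .
  qed
  have self: "\<theta> (br p (\<theta> p)) = - br p (\<theta> p)" for p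
    using br_anti[of "\<theta> p" p] by (simp add: theta_br)
  have z: "br y2 (\<theta> v) = 0" using br_y12_v(3) theta_br[of "\<theta> y2" v] by (simp add: theta_simps)
  have "\<theta> (br P (\<theta> Q)) + br P (\<theta> Q) = 0"
  proof (rule F_bilinear_zero[OF _ _ assms])
    show "bilinear (\<lambda>P Q. \<theta> (br P (\<theta> Q)) + br P (\<theta> Q))"
      unfolding bilinear_def by (auto intro!: linearI simp: br_simps theta_simps algebra_simps)
    have "\<theta> (br p (\<theta> q)) = - br p (\<theta> q)"
      if "(p, q) \<in> {(X, y1), (v, y1), (v, X), (y2, y1), (y2, X), (y2, v)}" for p q
      using that F_minus_generators z y2_commutes(4) br_y2_tX(2) by (auto simp: theta_simps)
    then show "\<theta> (br p (\<theta> q)) + br p (\<theta> q) = 0" if "p \<in> {y1, X, v, y2}" "q \<in> {y1, X, v, y2}" for p q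
      using that sym self by (auto simp: eq_neg_iff_add_eq_0[symmetric])
  qed
  then show 1: "\<theta> (br P (\<theta> Q)) = - br P (\<theta> Q)" by (simp add: eq_neg_iff_add_eq_0)
  have "\<theta> (br P (\<theta> Q)) = - br Q (\<theta> P)" using br_anti[of "\<theta> P" Q] by (simp add: theta_br)
  then show "br P (\<theta> Q) = br Q (\<theta> P)" using 1 by simp
qed

text \<open>Every P in \<open>F\<close> is orthogonal to each degree one w in \<open>\<hh>\<close>
  with w orthogonal to y. For such w, [y, \<theta> w] has no component along A, so \<theta> fixes
  it, and [\<theta> y, w] = [y, \<theta> w].\<close>

lemma F_h_multiple:
  assumes P: "P \<in> F"
  shows "proj \<hh> P = (ip P y / ip y y) *\<^sub>R y"
proof -
  have yF: "y \<in> F" unfolding F_def by (subst y_split[symmetric], intro span_add) (auto intro: span_base)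
  have orth: "ip P w = 0" if w: "w \<in> \<hh>" "w \<in> \<gg> 1" "ip w y = 0" for w
  proof -
    have tw: "\<theta> w \<in> \<gg> (- 1)" using gr_theta[OF A_minus w(2)] .
    have twA: "br (\<theta> w) A = \<theta> w" "br A (\<theta> w) = - \<theta> w" using tw br_anti[of "\<theta> w" A] by (auto simp: gr_def)
    define N where "N = br y (\<theta> w)"
    have Nh: "N \<in> \<hh>" and Ng: "N \<in> \<gg> 0" using h_br h_theta y(1) w gr_br[OF y(2) tw] by (auto simp: N_def)
    have "B N A = B y (\<theta> w)" by (simp add: N_def form_right[symmetric] twA)
    also have "\<dots> = 0" using w(3) ip_commute[of w y] by (simp add: ip_def)
    finally have NA: "B N A = 0" .
    have "N - \<theta> N = (B (N - \<theta> N) A / B A A) *\<^sub>R A"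
      by (rule h_minus_gr_0)
        (use Nh Ng h_theta h_subspace gr_theta[OF A_minus Ng] gr_subspace in \<open>auto simp: theta_simps subspace_diff\<close>)
    also have "B (N - \<theta> N) A = 0" using NA by (simp add: form_simps form_theta_swap A_minus)
    finally have "\<theta> N = N" by simp
    then have N2: "br (\<theta> y) w = br y (\<theta> w)" by (simp add: N_def theta_br)
    have tPy: "br (\<theta> P) (\<theta> y) = 0" using theta_br[of P y] F_abelian[OF P yF] by (simp add: theta_simps)
    have tP: "br (\<theta> P) A = \<theta> P" using gr_theta[OF A_minus F_gr[OF P]] br_anti[of "\<theta> P" A] by (simp add: gr_def)
    \<comment> \<open>The same number is computed twice, acting once on w and once on P; the results
      \<kappa> B(P, \<theta> w) and its negative must agree.\<close>
    have "B P (br (\<theta> y) (br (\<theta> y) w)) = B P (br (\<theta> y) (br y (\<theta> w)))" by (simp add: N2)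
    also have "br (\<theta> y) (br y (\<theta> w)) = br (br (\<theta> y) y) (\<theta> w) + br y (br (\<theta> y) (\<theta> w))" by (rule jacobi)
    also have "B P \<dots> = - \<kappa> * B P (\<theta> w)"
      by (simp add: br_y_ty br_simps form_simps twA form_right[of P y] F_abelian[OF P yF])
    finally have e1: "B P (br (\<theta> y) (br (\<theta> y) w)) = - \<kappa> * B P (\<theta> w)" .
    have "B P (br (\<theta> y) (br (\<theta> y) w)) = B (br (br P (\<theta> y)) (\<theta> y)) w" by (simp add: form_right)
    also have "br P (\<theta> y) = br y (\<theta> P)" by (rule F_minus(2)[OF P yF])
    also have "br (br y (\<theta> P)) (\<theta> y) = br y (br (\<theta> P) (\<theta> y)) - br (\<theta> P) (br y (\<theta> y))" by (rule jacobi_left)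
    also have "\<dots> = \<kappa> *\<^sub>R \<theta> P" by (simp add: tPy br_y_ty br_simps tP)
    finally have "B P (br (\<theta> y) (br (\<theta> y) w)) = \<kappa> * B P (\<theta> w)" by (simp add: form_simps form_theta_swap)
    then have "\<kappa> * B P (\<theta> w) = 0" using e1 by simp
    then show ?thesis using \<kappa>_pos by (simp add: ip_def)
  qed
  define k where "k = ip P y / ip y y"
  define z where "z = proj \<hh> P - k *\<^sub>R y"
  have yy: "ip y y \<noteq> 0" using y(3) by (simp add: ip_eq_zero_iff)
  have pp: "ip (proj \<hh> P) w = ip P w" if "w \<in> \<hh>" for w
    using proj_perp[OF h_subspace that, of P] by (simp add: ip_simps)
  have z: "z \<in> \<hh>" "z \<in> \<gg> 1" unfolding z_def
    using proj_h_in proj_h_gr[OF A_h F_gr[OF P]] y h_subspace gr_subspace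
    by (auto intro!: subspace_diff subspace_scale)
  have zy: "ip z y = 0" using pp[OF y(1)] yy by (simp add: z_def k_def ip_simps)
  have "ip z z = ip (proj \<hh> P) z - k * ip y z" by (subst (1) z_def) (simp only: ip_diff_left ip_scale_left)
  also have "\<dots> = 0" using pp[OF z(1)] orth[OF z zy] zy ip_commute[of y z] by simp
  finally show ?thesis by (simp add: ip_eq_zero_iff z_def k_def)
qed

text \<open>The eigencomponents \<open>e s\<close> of y under ad u span commuting copies of sl2,
  with X = - (1 / \<kappa>) times the sum of the s \<open>e s\<close>. The torus spanned by the
  \<open>H s\<close> rescales each term by a positive factor, so the signs of the coefficients are
  the only obstruction to reaching a given combination.\<close>

lemma critical_pair_is_model: "lie_pair_iso br UNIV \<hh> commutator sl2 sl2_diag"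
proof -
  note sa = ip_br_minus[OF theta_u]
  obtain S e where S: "finite S" "y = (\<Sum>s\<in>S. e s)" "\<And>s. s \<in> S \<Longrightarrow> br u (e s) = s *\<^sub>R e s"
    "\<And>s. s \<in> S \<Longrightarrow> e s \<noteq> 0"
    using eigen_decomposition[OF br_linear_right sa] by blast
  have yF: "y \<in> F" unfolding F_def by (subst y_split[symmetric], intro span_add) (auto intro: span_base)
  have eF: "e s \<in> F" if "s \<in> S" for s
    by (rule eigencomponent_in_subspace[OF br_linear_right sa F_subspace F_stable S(1)
          subst[where P="\<lambda>z. z \<in> F", OF S(2) yF] S(3) that])
  have eg: "e s \<in> \<gg> 1" "\<theta> (e s) \<in> \<gg> (- 1)" if "s \<in> S" for s
    using F_gr[OF eF[OF that]] gr_theta[OF A_minus] by auto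
  have oe: "ip (e s) (e t) = 0" if "s \<in> S" "t \<in> S" "s \<noteq> t" for s t
    using eigenvectors_orthogonal[OF sa S(3)[OF that(1)] S(3)[OF that(2)] that(3)] .
  have ee: "br (e s) (e t) = 0" "br (\<theta> (e s)) (\<theta> (e t)) = 0" if "s \<in> S" "t \<in> S" for s t
    using F_abelian[OF eF eF, OF that] theta_br[of "e s" "e t"] by (auto simp: theta_simps)
  have ete: "br (e s) (\<theta> (e t)) = 0" "br (\<theta> (e s)) (e t) = 0" if st: "s \<in> S" "t \<in> S" "s \<noteq> t" for s t
  proof -
    have w: "br u (br (e s) (\<theta> (e t))) = (s - t) *\<^sub>R br (e s) (\<theta> (e t))" if "s \<in> S" "t \<in> S" for s t
      using S(3)[OF that(1)] S(3)[OF that(2)]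
      by (simp add: jacobi[of u] u_theta theta_simps br_simps algebra_simps)
    \<comment> \<open>By this symmetry the mixed bracket is an eigenvector of ad u for both s - t
      and t - s, hence zero.\<close>
    have "br (e t) (\<theta> (e s)) = br (e s) (\<theta> (e t))" by (rule F_minus(2)[OF eF[OF st(2)] eF[OF st(1)]])
    from trans[OF w[OF st(1,2), symmetric] w[OF st(2,1), unfolded this]]
    have "(s - t - (t - s)) *\<^sub>R br (e s) (\<theta> (e t)) = 0" by (simp only: scaleR_left_diff_distrib) simp
    then show 1: "br (e s) (\<theta> (e t)) = 0" using st(3) by simp
    show "br (\<theta> (e s)) (e t) = 0" using theta_br[of "e s" "\<theta> (e t)"] 1 by (simp add: theta_simps)
  qed
  define H where "H s = br (e s) (\<theta> (e s))" for s
  have tH: "\<theta> (H s) = - H s" for s using br_anti[of "\<theta> (e s)" "e s"] by (simp add: H_def theta_br)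
  have Hg: "H s \<in> \<gg> 0" if "s \<in> S" for s using gr_br[OF eg[OF that]] by (simp add: H_def)
  have Hy: "br (e s) (\<theta> y) = H s" if "s \<in> S" for s
  proof -
    have "br (e s) (\<theta> y) = (\<Sum>t\<in>S. br (e s) (\<theta> (e t)))"
      by (simp add: S(2) linear_sum[OF theta_linear] br_sum_right)
    also have "\<dots> = (\<Sum>t\<in>S. if t = s then H s else 0)"
      by (rule sum.cong) (use ete that in \<open>auto simp: H_def\<close>)
    also have "\<dots> = H s" using S(1) that by simp
    finally show ?thesis .
  qed
  have Hsum: "(\<Sum>s\<in>S. H s) = - \<kappa> *\<^sub>R A"
  proof -
    have "br y (\<theta> y) = (\<Sum>s\<in>S. br (e s) (\<theta> y))" by (subst S(2)) (rule br_sum_left)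
    then show ?thesis using Hy br_y_ty by simp
  qed
  have Het: "br (H s) (e t) = 0" "br (H s) (\<theta> (e t)) = 0" if st: "s \<in> S" "t \<in> S" "s \<noteq> t" for s t
    unfolding H_def jacobi_left using ee ete st by (auto simp: br_simps)
  have Hee: "br (H s) (e s) = - \<kappa> *\<^sub>R e s" if "s \<in> S" for s
  proof -
    \<comment> \<open>The \<open>H t\<close> add up to - \<kappa> A and only \<open>H s\<close> acts
      on \<open>e s\<close>, so all copies of sl2 get the same scale \<kappa>.\<close>
    have "br (\<Sum>t\<in>S. H t) (e s) = (\<Sum>t\<in>S. if t = s then br (H s) (e s) else 0)"
      unfolding br_sum_left by (rule sum.cong) (use Het that in auto)
    also have "\<dots> = br (H s) (e s)" using S(1) that by simp
    finally show ?thesis using eg(1)[OF that] by (simp add: Hsum br_simps gr_def)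
  qed
  have Htee: "br (H s) (\<theta> (e s)) = \<kappa> *\<^sub>R \<theta> (e s)" if "s \<in> S" for s
  proof -
    have "\<theta> (br (H s) (e s)) = - br (H s) (\<theta> (e s))" by (simp add: theta_br tH br_simps)
    then show ?thesis using Hee[OF that] by (simp add: theta_simps)
  qed
  have HH: "br (H s) (H t) = 0" if "s \<in> S" "t \<in> S" for s t
    using Het that jacobi[of "H s" "e t" "\<theta> (e t)"] by (cases "s = t") (auto simp: H_def[of t] br_simps)
  define K where "K s = {e s, \<theta> (e s), H s}" for s
  have closed: "br p q \<in> span (K s)" if s: "s \<in> S" "q \<in> K s" and t: "t \<in> S" "p \<in> K t" for p q s t
  proof -
    have m: "e s \<in> span (K s)" "\<theta> (e s) \<in> span (K s)" "H s \<in> span (K s)" by (auto simp: K_def intro: span_base)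
    have p: "p \<in> {e t, \<theta> (e t), H t}" and q: "q \<in> {e s, \<theta> (e s), H s}" using s t by (auto simp: K_def)
    have a: "br (e s) (\<theta> (e s)) = H s" "br (\<theta> (e s)) (e s) = - H s"
      "br (e s) (H s) = \<kappa> *\<^sub>R e s" "br (\<theta> (e s)) (H s) = - \<kappa> *\<^sub>R \<theta> (e s)"
      using br_anti[of "\<theta> (e s)" "e s"] br_anti[of "e s" "H s"] br_anti[of "\<theta> (e s)" "H s"] Hee[OF s(1)] Htee[OF s(1)]
      by (auto simp: H_def)
    show ?thesis
    proof (cases "s = t")
      case True
      then show ?thesis using p q m a ee[OF s(1) s(1)] Hee[OF s(1)] Htee[OF s(1)] HH[OF s(1) s(1)]
        by (auto simp: span_zero intro!: span_neg span_scale)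
    next
      case False
      then have "br p q = 0"
        using p q ee[OF t(1) s(1)] ete[OF t(1) s(1)] Het[OF t(1) s(1)] Het[OF s(1) t(1)] HH[OF t(1) s(1)]
          br_anti[of "e t" "H s"] br_anti[of "\<theta> (e t)" "H s"] by auto
      then show ?thesis by (simp add: span_zero)
    qed
  qed
  define U where "U = (\<Union>s\<in>S. K s)"
  have KU: "span (K s) \<subseteq> span U" if "s \<in> S" for s by (rule span_mono) (use that in \<open>auto simp: U_def\<close>)
  have Um: "e s \<in> span U" "\<theta> (e s) \<in> span U" "H s \<in> span U" if "s \<in> S" for s
    using that by (auto simp: U_def K_def intro!: span_base)
  have uy: "br u y = (\<Sum>s\<in>S. s *\<^sub>R e s)"
  proof -
    have "br u y = br u (\<Sum>s\<in>S. e s)" by (rule arg_cong[OF S(2)])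
    also have "\<dots> = (\<Sum>s\<in>S. br u (e s))" by (rule br_sum_right)
    also have "\<dots> = (\<Sum>s\<in>S. s *\<^sub>R e s)" by (rule sum.cong) (use S(3) in auto)
    finally show ?thesis .
  qed
  have XS: "X = - (1 / \<kappa>) *\<^sub>R (\<Sum>s\<in>S. s *\<^sub>R e s)"
    unfolding uy[symmetric] br_u_y(1) using \<kappa>_pos by simp
  have "lie_subalgebra br (span U)"
    by (rule span_lie_subalgebra) (use closed KU in \<open>fastforce simp: U_def\<close>)
  moreover have AU: "A \<in> span U"
  proof -
    have "A = (- 1 / \<kappa>) *\<^sub>R (\<Sum>s\<in>S. H s)" using Hsum \<kappa>_pos by simp
    then show ?thesis using Um by (metis (no_types, lifting) span_scale span_sum)
  qed
  moreover have XU: "X \<in> span U" unfolding XS by (intro span_scale span_sum) (use Um in auto)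
  moreover have "\<theta> X \<in> span U" unfolding XS theta_simps linear_sum[OF theta_linear]
    by (intro span_neg span_scale span_sum) (use Um in auto)
  moreover have "direct_sum (span U) (span U \<inter> \<hh>) (span U \<inter> \<qq>)"
  proof (rule direct_sum_spanI)
    fix x assume "x \<in> U"
    then obtain s where s: "s \<in> S" "x \<in> K s" by (auto simp: U_def)
    have yU: "y \<in> span U" "\<theta> y \<in> span U"
      by (auto simp: S(2) linear_sum[OF theta_linear] intro!: span_sum Um)
    have "proj \<hh> (e s) \<in> span U" using F_h_multiple[OF eF[OF s(1)]] yU by (simp add: span_scale)
    moreover have "proj \<hh> (\<theta> (e s)) \<in> span U"
      using F_h_multiple[OF eF[OF s(1)]] yU by (simp add: proj_h_theta theta_simps span_scale)
    moreover have "proj \<hh> (H s) \<in> span U"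
    proof -
      have "proj \<hh> (H s) = (B (proj \<hh> (H s)) A / B A A) *\<^sub>R A"
        by (rule h_minus_gr_0[OF proj_h_in _ proj_h_gr[OF A_h Hg[OF s(1)]]])
          (simp add: proj_h_theta[symmetric] tH linear_neg[OF proj_linear[OF h_subspace]])
      then show ?thesis using AU span_scale by metis
    qed
    ultimately show "proj \<hh> x \<in> span U" using s(2) by (auto simp: K_def)
  qed
  ultimately have UU: "span U = UNIV" using hull_A[OF form invariant X(1,3,2)] by simp
  have ey: "ip (e s) y = ip (e s) (e s)" if s: "s \<in> S" for s
  proof -
    have "ip (e s) y = ip (e s) (\<Sum>t\<in>S. e t)" by (rule arg_cong[OF S(2)])
    also have "\<dots> = (\<Sum>t\<in>S. if t = s then ip (e s) (e s) else 0)"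
      unfolding ip_sum_right by (rule sum.cong) (use oe s in auto)
    also have "\<dots> = ip (e s) (e s)" using S(1) s by simp
    finally show ?thesis .
  qed
  have sum0: "(\<Sum>s\<in>S. s * ip (e s) (e s)) = 0"
  proof -
    \<comment> \<open>[u, y] is a multiple of X, which is orthogonal to \<open>\<hh>\<close>; so the
      eigenvalues, weighted by squared lengths, cancel and both signs occur.\<close>
    have "ip (br u y) y = 0"
      using X(1) y(1) by (auto simp: br_u_y ip_simps q_iff_ip)
    moreover have "ip (br u y) y = (\<Sum>s\<in>S. s * ip (e s) (e s))"
    proof -
      have "ip (br u y) y = (\<Sum>s\<in>S. ip (s *\<^sub>R e s) y)"
        unfolding uy by (rule ip_sum_left)
      also have "\<dots> = (\<Sum>s\<in>S. s * ip (e s) (e s))"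
        by (rule sum.cong) (simp_all add: ey ip_scale_left)
      finally show ?thesis .
    qed
    ultimately show ?thesis by simp
  qed
  have epos: "ip (e s) (e s) > 0" if "s \<in> S" for s using ip_pos[OF S(4)[OF that]] .
  have nz: "\<exists>s\<in>S. s \<noteq> 0"
  proof (rule ccontr)
    assume "\<not> ?thesis"
    then have "(\<Sum>s\<in>S. s *\<^sub>R e s) = 0" by (intro sum.neutral) auto
    then show False using X(3) XS by simp
  qed
  obtain p where p: "p \<in> S" "p > 0"
  proof (rule ccontr)
    assume neg: "\<not> thesis"
    then have "\<forall>s\<in>S. 0 \<le> - (s * ip (e s) (e s))"
      using that epos by (fastforce simp: mult_le_0_iff not_less)
    moreover have "(\<Sum>s\<in>S. - (s * ip (e s) (e s))) = 0" using sum0 by (simp add: sum_negf)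
    ultimately have "\<forall>s\<in>S. - (s * ip (e s) (e s)) = 0" using S(1) by (simp add: sum_nonneg_eq_0_iff)
    then show False using nz epos by fastforce
  qed
  obtain n where n: "n \<in> S" "n < 0"
  proof (rule ccontr)
    assume neg: "\<not> thesis"
    then have "\<forall>s\<in>S. 0 \<le> s * ip (e s) (e s)"
      using that epos by (fastforce simp: zero_le_mult_iff not_less)
    then have "\<forall>s\<in>S. s * ip (e s) (e s) = 0" using S(1) sum0 by (simp add: sum_nonneg_eq_0_iff)
    then show False using nz epos by fastforce
  qed
  have pn: "p \<noteq> n" using p n by auto
  define X' where "X' = e n - e p"
  have X'C: "X' \<in> \<CC>"
  proof -
    \<comment> \<open>\<open>H s\<close> scales \<open>e s\<close> by exp(- \<kappa> \<tau>). The
      logarithms turn the coefficient - p / \<kappa> into -1 and - n / \<kappa> into 1; every other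
      coefficient gets the factor exp(- m) and tends to zero.\<close>
    define \<tau> where "\<tau> m s = (if s = p then - ln (\<kappa> / p) / \<kappa> else if s = n then - ln (\<kappa> / (- n)) / \<kappa> else real m / \<kappa>)"
      for m :: nat and s
    define Z where "Z m = (\<Sum>s\<in>S. \<tau> m s *\<^sub>R H s)" for m
    have ev: "br (Z m) ((- s / \<kappa>) *\<^sub>R e s) = (- \<kappa> * \<tau> m s) *\<^sub>R ((- s / \<kappa>) *\<^sub>R e s)" if "s \<in> S" for m s
    proof -
      have "br (Z m) (e s) = (\<Sum>t\<in>S. if t = s then (- \<kappa> * \<tau> m s) *\<^sub>R e s else 0)"
        unfolding Z_def br_sum_left by (rule sum.cong) (use Het Hee that in \<open>auto simp: br_simps\<close>)
      also have "\<dots> = (- \<kappa> * \<tau> m s) *\<^sub>R e s" using S(1) that by simp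
      finally show ?thesis by (simp add: br_simps)
    qed
    have XS': "X = (\<Sum>s\<in>S. (- s / \<kappa>) *\<^sub>R e s)" by (subst XS) (simp add: scaleR_sum_right sum_negf[symmetric])
    define a where "a m s = exp (- \<kappa> * \<tau> m s) * (- s / \<kappa>)" for m s
    have ex: "exp_ad br (Z m) X = (\<Sum>s\<in>S. a m s *\<^sub>R e s)" for m
    proof -
      have "exp_ad br (1 *\<^sub>R Z m) (\<Sum>s\<in>S. (- s / \<kappa>) *\<^sub>R e s)
          = (\<Sum>s\<in>S. exp (1 * (- \<kappa> * \<tau> m s)) *\<^sub>R ((- s / \<kappa>) *\<^sub>R e s))"
        by (rule exp_ad_sum_eigenvectors[OF br_bilinear]) (rule ev)
      then show ?thesis unfolding XS'[symmetric] by (simp add: a_def)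
    qed
    have al: "(\<lambda>m. a m s) \<longlonglongrightarrow> (if s = n then 1 else if s = p then - 1 else 0)" if "s \<in> S" for s
    proof -
      have "a m p = - 1" "a m n = 1" for m
      proof -
        have "- (\<kappa> / n) > 0" using n(2) \<kappa>_pos by (simp add: divide_pos_neg)
        then have "exp (ln (- (\<kappa> / n))) = - (\<kappa> / n)" by (rule exp_ln)
        then show "a m p = - 1" "a m n = 1" using p n \<kappa>_pos pn by (simp_all add: a_def \<tau>_def)
      qed
      moreover have "(\<lambda>m. a m s) \<longlonglongrightarrow> 0" if "s \<noteq> n" "s \<noteq> p"
      proof -
        have "(\<lambda>m. exp (- 1) ^ m * (- s / \<kappa>)) \<longlonglongrightarrow> 0"
          by (intro tendsto_mult_left_zero LIMSEQ_power_zero) simp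
        moreover have "a m s = exp (- 1) ^ m * (- s / \<kappa>)" for m
          using that \<kappa>_pos by (simp add: a_def \<tau>_def exp_of_nat_mult[symmetric])
        ultimately show ?thesis by simp
      qed
      ultimately show ?thesis using pn by auto
    qed
    have "(\<Sum>s\<in>S. (if s = n then 1 else if s = p then - 1 else 0) *\<^sub>R e s)
        = (\<Sum>s\<in>S. (if s = n then e n else 0) + (if s = p then - e p else 0))"
      by (rule sum.cong) (use pn in auto)
    also have "\<dots> = X'" using S(1) p(1) n(1) by (simp add: sum.distrib X'_def)
    finally have X'_sum: "(\<Sum>s\<in>S. (if s = n then 1 else if s = p then - 1 else 0) *\<^sub>R e s) = X'" .
    have "(\<lambda>m. exp_ad br (Z m) X) \<longlonglongrightarrow> (\<Sum>s\<in>S. (if s = n then 1 else if s = p then - 1 else 0) *\<^sub>R e s)"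
      unfolding ex by (intro tendsto_sum tendsto_scaleR al tendsto_const)
    then have lim: "(\<lambda>m. exp_ad br (Z m) X) \<longlonglongrightarrow> X'" unfolding X'_sum .
    show ?thesis by (rule closed_sequentially[OF C_closed _ lim]) (use C_exp X(1) in simp)
  qed
  define I where "I = span (K p)"
  have "br x q \<in> I" if "q \<in> I" for x q
  proof -
    have 1: "br z q \<in> I" if z: "z \<in> U" for z
    proof -
      obtain t where t: "t \<in> S" "z \<in> K t" using z by (auto simp: U_def)
      have c: "br z k \<in> span (K p)" if "k \<in> K p" for k using closed[OF p(1) that t] .
      show ?thesis using \<open>q \<in> I\<close> unfolding I_def
      proof (induction rule: span_induct_alt)
        case (step r a b)
        then show ?case using c by (simp add: br_add_right br_scale_right span_add span_scale)
      qed (simp add: br_zero_right span_zero)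
    qed
    have "x \<in> span U" by (simp add: UU)
    then show ?thesis
    proof (induction rule: span_induct_alt)
      case (step r a b)
      then show ?case using 1[OF step(1)] by (simp add: br_add_left br_scale_left I_def span_add span_scale)
    qed (simp add: br_zero_left I_def span_zero)
  qed
  then have Iid: "lie_ideal br UNIV I" by (simp add: lie_ideal_def I_def)
  have It: "\<theta> x \<in> I" if "x \<in> I" for x
    using that unfolding I_def
  proof (induction rule: span_induct_alt)
    case (step k a b)
    then have "\<theta> a \<in> span (K p)" using tH by (auto simp: K_def intro!: span_neg intro: span_base)
    then show ?case using step by (simp add: theta_simps span_add span_scale)
  qed (simp add: theta_simps span_zero)
  \<comment> \<open>On \<open>\<hh>\<close> both \<open>e n\<close> and \<open>e p\<close> pair like
    y, with weights proportional to their squared lengths; multiplying the form on the ideal of p by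
    this ratio makes the pairings of the difference cancel.\<close>
  define w where "w = ip (e n) (e n) / ip (e p) (e p)"
  have w: "w > 0" using epos p n by (simp add: w_def)
  define B' where "B' P Q = B P Q + (w - 1) * B (proj I P) Q" for P Q
  have cf: "cartan_form \<theta> B'" and inv': "\<And>X Y Z. B' (br X Y) Z = - B' Y (br X Z)"
    unfolding B'_def using rescaled_form[OF Iid It w] by auto
  have "X' \<in> perp B' \<hh>"
  proof -
    have Is: "subspace I" by (simp add: I_def)
    have pe: "proj I (e p) = e p" by (rule proj_id[OF Is]) (auto simp: I_def K_def intro: span_base)
    have ne: "proj I (e n) = 0"
    proof (rule proj_unique[OF Is subspace_0[OF Is]])
      fix x assume "x \<in> I"
      then have "ip x (e n) = 0" unfolding I_def
      proof (rule ip_span_zero)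
        fix k assume "k \<in> K p"
        then show "ip k (e n) = 0"
          using oe[OF p(1) n(1) pn] gr_orthogonal[OF A_minus _ eg(1)[OF n(1)]] eg(2)[OF p(1)] Hg[OF p(1)]
          by (auto simp: K_def)
      qed
      then show "ip (e n - 0) x = 0" using ip_commute[of x "e n"] by simp
    qed
    have Be: "B (e s) Z = - (ip (e s) (e s) / ip y y) * ip y (\<theta> Z)" if "s \<in> S" "Z \<in> \<hh>" for s Z
    proof -
      have "ip (e s) (\<theta> Z) = ip (proj \<hh> (e s)) (\<theta> Z)"
        using proj_perp[OF h_subspace h_theta[OF that(2)], of "e s"] by (simp add: ip_simps)
      then show ?thesis using F_h_multiple[OF eF[OF that(1)]] ey[OF that(1)] by (simp add: form_eq_ip ip_simps)
    qed
    have "B' X' Z = 0" if Z: "Z \<in> \<hh>" for Z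
    proof -
      have "B' X' Z = B (e n) Z - w * B (e p) Z"
        by (simp add: B'_def X'_def linear_diff[OF proj_linear[OF Is]] pe ne form_simps algebra_simps)
      also have "\<dots> = 0" using epos[OF p(1)] by (simp add: Be[OF n(1) Z] Be[OF p(1) Z] w_def)
      finally show ?thesis .
    qed
    then show ?thesis by (simp add: perp_def)
  qed
  moreover have "X' \<noteq> 0"
  proof
    assume "X' = 0"
    then have "e n = e p" by (simp add: X'_def)
    then show False using oe[OF p(1) n(1) pn] epos[OF p(1)] by simp
  qed
  moreover have "X' \<in> \<gg> 1" unfolding X'_def using eg p(1) n(1) gr_subspace by (simp add: subspace_diff)
  moreover have "br (br X' (\<theta> X')) X' = - \<kappa> *\<^sub>R X'"
  proof -
    have "br X' (\<theta> X') = H n + H p"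
      using ete[OF p(1) n(1) pn] ete[OF n(1) p(1)] pn by (simp add: X'_def theta_simps br_simps H_def)
    then show ?thesis
      using Het[OF p(1) n(1) pn] Het[OF n(1) p(1)] pn Hee[OF p(1)] Hee[OF n(1)]
      by (simp add: X'_def br_simps algebra_simps)
  qed
  ultimately show ?thesis using sl2_case[OF cf inv', of X' "- \<kappa>"] X'C by blast
qed

end

context graded_pair begin

lemma graded_pair_is_model: "lie_pair_iso br UNIV \<hh> commutator sl2 sl2_diag"
proof -
  obtain X y c where X: "X \<in> \<CC> \<inter> \<qq>" "X \<in> \<gg> 1" "X \<noteq> 0" and y: "y \<in> \<hh>" "y \<in> \<gg> 1"
    and crit: "br (\<theta> X) (br (br X (\<theta> X)) X - c *\<^sub>R X - y) = 0"
    using critical_vector by blast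
  show ?thesis
  proof (cases "y = 0")
    case True
    define Y where "Y = br (br X (\<theta> X)) X - c *\<^sub>R X"
    have AX: "br A X = X" using X(2) by (simp add: gr_def)
    \<comment> \<open>Writing c X as [c A, X] puts Y into the image of ad X, while
      \<open>crit\<close> puts it into the kernel of ad(\<theta> X); these are orthogonal.\<close>
    have "Y = br (br X (\<theta> X) - c *\<^sub>R A) X" by (simp add: Y_def br_simps AX)
    then have "Y = - br X (br X (\<theta> X) - c *\<^sub>R A)" using br_anti by metis
    then have "ip Y Y = ip (br X (\<theta> X) - c *\<^sub>R A) (br (\<theta> X) Y)"
      using ip_br[of X "br X (\<theta> X) - c *\<^sub>R A" Y] by (simp add: ip_minus_left)
    also have "\<dots> = 0" using crit True by (simp add: Y_def ip_simps)
    finally have "br (br X (\<theta> X)) X = c *\<^sub>R X" by (simp add: ip_eq_zero_iff Y_def)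
    then show ?thesis using sl2_case[OF form invariant X(1,3,2)] by blast
  next
    case False
    interpret critical_pair br \<theta> B \<hh> \<aa> \<CC> A X0 X y c
      by unfold_locales (use X y False crit in auto)
    show ?thesis by (rule critical_pair_is_model)
  qed
qed

end

lemma (in minimal_pair) minimal_pair_is_model: "lie_pair_iso br UNIV \<hh> commutator sl2 sl2_diag"
proof -
  obtain A X where A: "\<aa> = span {A}" "A \<in> \<hh>" "\<theta> A = - A" "X \<in> \<CC> \<inter> \<qq>" "X \<noteq> 0" "br A X = X"
    using a_one_dimensional by blast
  interpret graded_pair br \<theta> B \<hh> \<aa> \<CC> A X
    by unfold_locales (use A in auto)
  show ?thesis by (rule graded_pair_is_model)
qed

section \<open>Connected Lie groups\<close>

locale connected_lie =
  fixes br :: "'a::euclidean_space \<Rightarrow> 'a \<Rightarrow> 'a" and G :: "'b monoid" and T :: "'b topology"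
    and Exp :: "'a \<Rightarrow> 'b" and Ad :: "'b \<Rightarrow> 'a \<Rightarrow> 'a"
  assumes br_bil: "bilinear br" and clg: "connected_lie_group br G T Exp Ad"
begin

lemma grp: "group G" and top_carrier: "topspace T = carrier G"
  and mult_continuous: "continuous_map (prod_topology T T) T (\<lambda>(a, b). a \<otimes>\<^bsub>G\<^esub> b)"
  and conn: "connected_space T" and Exp_carrier: "Exp X \<in> carrier G"
  and Exp_add: "Exp ((s + t) *\<^sub>R X) = Exp (s *\<^sub>R X) \<otimes>\<^bsub>G\<^esub> Exp (t *\<^sub>R X)"
  and Ad_linear: "a \<in> carrier G \<Longrightarrow> linear (Ad a)"
  and conj_Exp: "a \<in> carrier G \<Longrightarrow> a \<otimes>\<^bsub>G\<^esub> Exp X \<otimes>\<^bsub>G\<^esub> inv\<^bsub>G\<^esub> a = Exp (Ad a X)"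
  and Ad_Exp: "Ad (Exp X) Y = exp_ad br X Y"
  using clg by (auto simp: connected_lie_group_def topological_group_def)

lemma Exp_chart: obtains U where "open U" "0 \<in> U" "openin T (Exp ` U)" "inj_on Exp U"
proof -
  obtain U where U: "open U" "0 \<in> U" "openin T (Exp ` U)"
    "homeomorphic_map (top_of_set U) (subtopology T (Exp ` U)) Exp"
    using clg by (auto simp: connected_lie_group_def)
  then have "inj_on Exp U" by (simp add: homeomorphic_map_def)
  with U show thesis using that by blast
qed

interpretation G: group G by (rule grp)

lemma Exp_0: "Exp 0 = \<one>\<^bsub>G\<^esub>"
  using Exp_add[of 0 0 0] Exp_carrier[of 0] G.l_cancel_one by simp

lemma inv_Exp: "inv\<^bsub>G\<^esub> Exp X = Exp (- X)"
  using Exp_add[of "-1" 1 X] Exp_0 Exp_carrier by (intro G.inv_equality) auto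

text \<open>\<open>Exp\<close> is injective near 0 only, so X is first scaled until both images lie
  in the chart; linearity removes the factor again.\<close>

lemma linear_eq_by_Exp:
  assumes "linear f" "linear g" "\<And>X. Exp (f X) = Exp (g X)"
  shows "f = g"
proof
  fix X
  obtain U where U: "open U" "0 \<in> U" "inj_on Exp U" using Exp_chart by metis
  then obtain e where e: "e > 0" "ball 0 e \<subseteq> U" using open_contains_ball by blast
  define t where "t = e / (norm (f X) + norm (g X) + 1)"
  have d: "norm (f X) + norm (g X) + 1 > 0" by (simp add: add_nonneg_pos)
  have t: "t > 0" using e d by (simp add: t_def)
  have small: "t * r < e" if "r \<le> norm (f X) + norm (g X)" for r
  proof -
    have "t * r < t * (norm (f X) + norm (g X) + 1)" using t that by (intro mult_strict_left_mono) auto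
    then show ?thesis using d by (simp add: t_def)
  qed
  have "f (t *\<^sub>R X) \<in> U" "g (t *\<^sub>R X) \<in> U"
    using e(2) t small[of "norm (f X)"] small[of "norm (g X)"]
    by (auto simp: linear_scale assms(1,2) subset_iff)
  then have "f (t *\<^sub>R X) = g (t *\<^sub>R X)" using U(3) assms(3) by (auto dest: inj_onD)
  then show "f X = g X" using t by (simp add: linear_scale assms(1,2))
qed

lemma Ad_mult:
  assumes "a \<in> carrier G" "b \<in> carrier G"
  shows "Ad (a \<otimes>\<^bsub>G\<^esub> b) X = Ad a (Ad b X)"
proof -
  have "Ad (a \<otimes>\<^bsub>G\<^esub> b) = Ad a \<circ> Ad b"
  proof (rule linear_eq_by_Exp)
    show "linear (Ad a \<circ> Ad b)" using Ad_linear assms by (intro linear_compose) auto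
    fix X
    have "Exp (Ad (a \<otimes>\<^bsub>G\<^esub> b) X) = a \<otimes>\<^bsub>G\<^esub> b \<otimes>\<^bsub>G\<^esub> Exp X \<otimes>\<^bsub>G\<^esub> inv\<^bsub>G\<^esub> (a \<otimes>\<^bsub>G\<^esub> b)"
      using assms by (simp add: conj_Exp)
    also have "\<dots> = a \<otimes>\<^bsub>G\<^esub> (b \<otimes>\<^bsub>G\<^esub> Exp X \<otimes>\<^bsub>G\<^esub> inv\<^bsub>G\<^esub> b) \<otimes>\<^bsub>G\<^esub> inv\<^bsub>G\<^esub> a"
      using assms Exp_carrier[of X] by (simp add: G.inv_mult_group G.m_assoc)
    finally show "Exp (Ad (a \<otimes>\<^bsub>G\<^esub> b) X) = Exp ((Ad a \<circ> Ad b) X)" using assms by (simp add: conj_Exp)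
  qed (use assms Ad_linear in auto)
  then show ?thesis by simp
qed

text \<open>Follows from multiplicativity of \<open>Ad\<close> along a one-parameter subgroup, which
  avoids multiplying power series.\<close>

lemma exp_ad_add: "exp_ad br ((s + t) *\<^sub>R X) Y = exp_ad br (s *\<^sub>R X) (exp_ad br (t *\<^sub>R X) Y)"
  using Ad_mult[OF Exp_carrier Exp_carrier, of "s *\<^sub>R X" "t *\<^sub>R X" Y] by (simp add: Exp_add[symmetric] Ad_Exp)

lemma Ad_one: "Ad \<one>\<^bsub>G\<^esub> Y = Y"
  using Ad_Exp[of 0 Y] by (simp add: Exp_0 exp_ad_zero[OF br_bil])

lemma translate_chart:
  assumes "a \<in> carrier G"
  obtains V where "openin T V" "a \<in> V" "\<And>x. x \<in> V \<Longrightarrow> x \<in> carrier G \<and> (\<exists>X. inv\<^bsub>G\<^esub> a \<otimes>\<^bsub>G\<^esub> x = Exp X)"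
proof -
  obtain U where U: "0 \<in> U" "openin T (Exp ` U)" using Exp_chart by metis
  define V where "V = {x \<in> topspace T. inv\<^bsub>G\<^esub> a \<otimes>\<^bsub>G\<^esub> x \<in> Exp ` U}"
  have "continuous_map T T (\<lambda>x. (\<lambda>(a, b). a \<otimes>\<^bsub>G\<^esub> b) (inv\<^bsub>G\<^esub> a, x))"
    using continuous_map_compose[OF _ mult_continuous, of T "\<lambda>x. (inv\<^bsub>G\<^esub> a, x)"] assms
    by (simp add: o_def continuous_map_pairedI top_carrier)
  then have "continuous_map T T (\<lambda>x. inv\<^bsub>G\<^esub> a \<otimes>\<^bsub>G\<^esub> x)" by simp
  then have "openin T V" unfolding V_def by (rule openin_continuous_map_preimage) (rule U(2))
  moreover have "a \<in> V" using assms U(1) Exp_0 by (auto simp: V_def top_carrier image_iff intro!: bexI[of _ 0])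
  ultimately show thesis by (rule that) (auto simp: V_def top_carrier)
qed

text \<open>The subgroup generated by the chart is open, its complement is a union of translates of
  open sets, and a connected space has no other clopen sets than the trivial ones. This allows
  induction over words in exponentials.\<close>

lemma generated_by_Exp: "generate G (range Exp) = carrier G"
proof -
  define H where "H = generate G (range Exp)"
  have H: "subgroup H G" unfolding H_def using Exp_carrier by (intro G.generate_is_subgroup) auto
  have HE: "Exp X \<in> H" for X unfolding H_def by (rule generate.incl) simp
  have Hc: "H \<subseteq> carrier G" using H by (rule subgroup.subset)
  have "openin T H"
  proof (subst openin_subopen, intro ballI)
    fix a assume a: "a \<in> H"
    then have ac: "a \<in> carrier G" using Hc by blast
    obtain V where V: "openin T V" "a \<in> V" "\<And>x. x \<in> V \<Longrightarrow> x \<in> carrier G \<and> (\<exists>X. inv\<^bsub>G\<^esub> a \<otimes>\<^bsub>G\<^esub> x = Exp X)"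
      using translate_chart[OF ac] by metis
    have "x \<in> H" if x: "x \<in> V" for x
    proof -
      obtain X where X: "x \<in> carrier G" "inv\<^bsub>G\<^esub> a \<otimes>\<^bsub>G\<^esub> x = Exp X" using V(3)[OF x] by blast
      have "x = a \<otimes>\<^bsub>G\<^esub> Exp X" using X ac by (simp add: X(2)[symmetric] G.m_assoc[symmetric])
      then show ?thesis using subgroup.m_closed[OF H a HE] by simp
    qed
    then show "\<exists>V. openin T V \<and> a \<in> V \<and> V \<subseteq> H" using V by blast
  qed
  moreover have "openin T (topspace T - H)"
  proof (subst openin_subopen, intro ballI)
    fix a assume a: "a \<in> topspace T - H"
    then have ac: "a \<in> carrier G" by (simp add: top_carrier)
    obtain V where V: "openin T V" "a \<in> V" "\<And>x. x \<in> V \<Longrightarrow> x \<in> carrier G \<and> (\<exists>X. inv\<^bsub>G\<^esub> a \<otimes>\<^bsub>G\<^esub> x = Exp X)"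
      using translate_chart[OF ac] by metis
    have "x \<notin> H" if xV: "x \<in> V" for x
    proof
      assume x: "x \<in> H"
      obtain X where X: "x \<in> carrier G" "inv\<^bsub>G\<^esub> a \<otimes>\<^bsub>G\<^esub> x = Exp X" using V(3)[OF xV] by blast
      have "a = x \<otimes>\<^bsub>G\<^esub> inv\<^bsub>G\<^esub> (inv\<^bsub>G\<^esub> a \<otimes>\<^bsub>G\<^esub> x)"
        using X(1) ac by (simp add: G.inv_mult_group G.m_assoc[symmetric])
      also have "\<dots> \<in> H" unfolding X(2) by (intro subgroup.m_closed[OF H x] subgroup.m_inv_closed[OF H] HE)
      finally show False using a by simp
    qed
    then show "\<exists>V. openin T V \<and> a \<in> V \<and> V \<subseteq> topspace T - H"
      using V openin_subset[OF V(1)] by blast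
  qed
  then have "closedin T H" using Hc by (simp add: closedin_def top_carrier)
  ultimately have "H = {} \<or> H = topspace T" using conn unfolding connected_space_clopen_in by blast
  then show ?thesis using HE by (auto simp: H_def top_carrier)
qed

lemma Ad_induct [consumes 1, case_names one Exp Exp_minus mult]:
  assumes "a \<in> generate G (Exp ` s)" and "P \<one>\<^bsub>G\<^esub>" and E: "\<And>X. X \<in> s \<Longrightarrow> P (Exp X)" "\<And>X. X \<in> s \<Longrightarrow> P (Exp (- X))"
    and m: "\<And>a b. a \<in> carrier G \<Longrightarrow> b \<in> carrier G \<Longrightarrow> P a \<Longrightarrow> P b \<Longrightarrow> P (a \<otimes>\<^bsub>G\<^esub> b)"
  shows "P a"
  using assms(1)
proof (induction rule: generate.induct)
  case (eng a b)
  have "a \<in> carrier G" "b \<in> carrier G"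
    using eng(1,2) G.generate_incl[of "Exp ` s"] Exp_carrier by auto
  then show ?case using m eng by blast
qed (use assms(2) E inv_Exp in auto)

lemma Ad_in_subspace:
  assumes "a \<in> carrier G" "subspace W" "\<And>Z w. w \<in> W \<Longrightarrow> br Z w \<in> W" "w \<in> W"
  shows "Ad a w \<in> W"
proof -
  have "a \<in> generate G (Exp ` UNIV)" using assms(1) generated_by_Exp by simp
  then have "\<forall>w\<in>W. Ad a w \<in> W"
    by (induction rule: Ad_induct) (auto simp: Ad_one Ad_Exp Ad_mult intro: exp_ad_in_subspace[OF br_bil assms(2,3)])
  then show ?thesis using assms(4) by blast
qed

section \<open>Invariance of forms under the group and under its Lie algebra\<close>

lemma exp_ad_form_derivative:
  fixes B :: "'a \<Rightarrow> 'a \<Rightarrow> real"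
  assumes "bilinear B"
  shows "((\<lambda>t. B (exp_ad br (t *\<^sub>R X) Y) (exp_ad br (t *\<^sub>R X) Z)) has_real_derivative
    (B Y (br X Z) + B (br X Y) Z)) (at 0)"
  using bounded_bilinear.has_vector_derivative[OF bilinear_conv_bounded_bilinear[THEN iffD1, OF assms]
      exp_ad_has_vector_derivative[OF br_bil, of X Y] exp_ad_has_vector_derivative[OF br_bil, of X Z]]
  by (simp add: exp_ad_zero[OF br_bil] has_real_derivative_iff_has_vector_derivative)

lemma ad_invariant_of_Ad_invariant:
  fixes B :: "'a \<Rightarrow> 'a \<Rightarrow> real"
  assumes "bilinear B" "\<And>a X Y. a \<in> carrier G \<Longrightarrow> B (Ad a X) (Ad a Y) = B X Y"
  shows "B (br X Y) Z = - B Y (br X Z)"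
proof -
  have c: "B (exp_ad br (t *\<^sub>R X) Y) (exp_ad br (t *\<^sub>R X) Z) = B Y Z" for t
    using assms(2)[OF Exp_carrier] by (simp add: Ad_Exp)
  have "((\<lambda>t. B Y Z) has_real_derivative (B Y (br X Z) + B (br X Y) Z)) (at 0)"
    using exp_ad_form_derivative[OF assms(1), of X Y Z] unfolding c .
  then have "B Y (br X Z) + B (br X Y) Z = 0" using DERIV_unique DERIV_const by blast
  then show ?thesis by simp
qed

text \<open>Needed because the forms chosen for reduction (c) are built infinitesimally. Translation
  in t moves the derivative at 0 to every point, so the pairing is constant along one-parameter
  subgroups.\<close>

lemma Ad_invariant_of_ad_invariant:
  fixes B :: "'a \<Rightarrow> 'a \<Rightarrow> real"
  assumes B: "bilinear B" "\<And>X Y Z. B (br X Y) Z = - B Y (br X Z)" and a: "a \<in> carrier G"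
  shows "B (Ad a Y) (Ad a Z) = B Y Z"
proof -
  have E: "B (exp_ad br X Y) (exp_ad br X Z) = B Y Z" for X Y Z
  proof -
    define f where "f t = B (exp_ad br (t *\<^sub>R X) Y) (exp_ad br (t *\<^sub>R X) Z)" for t
    have "DERIV f t :> 0" for t
    proof -
      have "((\<lambda>s. f (s + t)) has_real_derivative 0) (at 0)"
        using exp_ad_form_derivative[OF B(1), of X "exp_ad br (t *\<^sub>R X) Y" "exp_ad br (t *\<^sub>R X) Z"] B(2)
        by (simp add: f_def exp_ad_add)
      then show ?thesis using DERIV_shift[of f 0 0 t] by simp
    qed
    then have "f 1 = f 0" by (intro DERIV_isconst_all) auto
    then show ?thesis by (simp add: f_def exp_ad_zero[OF br_bil])
  qed
  have "a \<in> generate G (Exp ` UNIV)" using a generated_by_Exp by simp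
  then have "\<forall>Y Z. B (Ad a Y) (Ad a Z) = B Y Z"
    by (induction rule: Ad_induct) (auto simp: Ad_one Ad_Exp Ad_mult E)
  then show ?thesis by blast
qed

end

text \<open>What remains is to derive the assumptions of \<open>minimal_pair\<close> for the closure
  of the orbit: the three reductions become statements about ideals and subalgebras, and the null
  cone condition becomes one about brackets.\<close>

theorem theorem3p12:
  fixes br :: "'a::euclidean_space \<Rightarrow> 'a \<Rightarrow> 'a"
    and \<theta> :: "'a \<Rightarrow> 'a"
    and G :: "'b monoid" and T :: "'b topology"
    and Exp :: "'a \<Rightarrow> 'b" and Ad :: "'b \<Rightarrow> 'a \<Rightarrow> 'a" and Theta :: "'b \<Rightarrow> 'b"
    and B :: "'a \<Rightarrow> 'a \<Rightarrow> real"
    and \<hh> \<aa> Orb :: "'a set"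
  assumes "lie_algebra br" and "lie_reductive br UNIV" and "cartan_involution br \<theta>"
    and "connected_lie_group br G T Exp Ad"
    and "group_cartan_involution \<theta> G T Exp Theta"
    and "invariant_cartan_form G Ad \<theta> B"
    and "ndd_tuple br \<theta> G Exp Ad B \<hh> Orb"
    and "max_abelian_subspace br (minus_space \<theta> \<hh>) \<aa>"
    and "ndd_minimal br \<theta> G Exp Ad B \<aa> \<hh> Orb"
  shows "lie_pair_iso br UNIV \<hh> commutator sl2 sl2_diag"
proof -
  have br_bil: "bilinear br" using assms(1) by (simp add: lie_algebra_def)
  interpret connected_lie br G T Exp Ad by unfold_locales (fact br_bil, fact assms(4))
  have form: "cartan_form \<theta> B" and B_bil: "bilinear B"
    and B_Ad: "\<And>a X Y. a \<in> carrier G \<Longrightarrow> B (Ad a X) (Ad a Y) = B X Y"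
    using assms(6) by (auto simp: invariant_cartan_form_def cartan_form_def)
  have th: "linear \<theta>" "\<And>X. \<theta> (\<theta> X) = X" "\<And>X Y. \<theta> (br X Y) = br (\<theta> X) (\<theta> Y)"
    using assms(3) by (auto simp: cartan_involution_def)
  have h: "lie_subalgebra br \<hh>" "\<theta> ` \<hh> = \<hh>" using assms(7) by (auto simp: ndd_tuple_def)
  interpret lie_pair br \<theta> B \<hh>
  proof unfold_locales
    show "\<theta> (x + y) = \<theta> x + \<theta> y" "\<theta> (c *\<^sub>R x) = c *\<^sub>R \<theta> x" for x y c
      using th(1) by (auto simp: linear_add linear_scale)
    show "B (br X Y) Z = - B Y (br X Z)" for X Y Z
      by (rule ad_invariant_of_Ad_invariant[OF B_bil B_Ad])
  qed (rule assms(1) th(2,3) form h)+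
  obtain N where N: "lie_nilpotent br N" and Orb: "Orb = orbit Ad (carrier G) N"
    using assms(7) by (auto simp: ndd_tuple_def)
  obtain D where D: "br D N = N" by (rule nilpotent_eq_bracket[OF N])
  define C where "C = closure Orb"
  have gc: "\<one>\<^bsub>G\<^esub> \<in> carrier G" using Exp_carrier[of 0] by (simp add: Exp_0)
  have mc: "a \<otimes>\<^bsub>G\<^esub> b \<in> carrier G" if "a \<in> carrier G" "b \<in> carrier G" for a b
    by (rule monoid.m_closed[OF group.is_monoid[OF grp] that])
  have Orb_cone: "t *\<^sub>R x \<in> Orb" if x: "x \<in> Orb" and t: "t > 0" for x t
  proof -
    obtain a where a: "a \<in> carrier G" "x = Ad a N" using x unfolding Orb orbit_def by blast
    \<comment> \<open>As [D, N] = N, the one-parameter group of D realises every positive scaling of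
      N inside the orbit.\<close>
    have "Ad (Exp (ln t *\<^sub>R D)) N = t *\<^sub>R N"
      using exp_ad_eigenvector[OF br_bilinear, of "ln t *\<^sub>R D" N "ln t"] D t by (simp add: Ad_Exp br_simps)
    then have "t *\<^sub>R x = Ad (a \<otimes>\<^bsub>G\<^esub> Exp (ln t *\<^sub>R D)) N"
      using a Exp_carrier by (simp add: Ad_mult linear_scale[OF Ad_linear])
    then show ?thesis using mc[OF a(1) Exp_carrier] by (simp add: Orb orbit_def)
  qed
  have C_cone: "t *\<^sub>R x \<in> C" if "x \<in> C" "t > 0" for x t
  proof -
    have "(*\<^sub>R) t ` Orb \<subseteq> Orb" using Orb_cone that(2) by auto
    then have "(*\<^sub>R) t ` closure Orb \<subseteq> closure Orb" unfolding closure_scaleR by (rule closure_mono)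
    then show ?thesis using that(1) by (auto simp: C_def)
  qed
  have C_exp: "exp_ad br Z x \<in> C" if "x \<in> C" for x Z
  proof -
    have "exp_ad br Z ` Orb \<subseteq> Orb"
    proof
      fix x assume "x \<in> exp_ad br Z ` Orb"
      then obtain a where a: "a \<in> carrier G" "x = exp_ad br Z (Ad a N)" unfolding Orb orbit_def by blast
      then have "x = Ad (Exp Z \<otimes>\<^bsub>G\<^esub> a) N" using Exp_carrier by (simp add: Ad_mult Ad_Exp)
      then show "x \<in> Orb" using mc[OF Exp_carrier a(1)] by (simp add: Orb orbit_def)
    qed
    then have "exp_ad br Z ` closure Orb \<subseteq> closure Orb"
      using closure_subset[of Orb]
      by (intro image_closure_subset linear_continuous_on
          linear_conv_bounded_linear[THEN iffD1, OF exp_ad_linear[OF br_bil]]) auto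
    then show ?thesis using that by (auto simp: C_def)
  qed
  have C_closed: "closed C" by (simp add: C_def)
  have NO: "N \<in> Orb" unfolding Orb orbit_def by (rule image_eqI[OF _ gc]) (simp add: Ad_one)
  have zero_C: "0 \<in> C"
  proof -
    have lim: "(\<lambda>n. inverse (real (Suc n)) *\<^sub>R N) \<longlonglongrightarrow> 0"
      using tendsto_scaleR[OF LIMSEQ_inverse_real_of_nat tendsto_const, of N] by simp
    have "inverse (real (Suc n)) *\<^sub>R N \<in> C" for n
      using C_cone[of N "inverse (real (Suc n))"] NO closure_subset[of Orb] by (auto simp: C_def)
    then show ?thesis by (rule closed_sequentially[OF C_closed _ lim])
  qed
  define L where "L = analytic_subgroup G Exp \<hh>"
  have L1: "\<one>\<^bsub>G\<^esub> \<in> L" by (simp add: L_def analytic_subgroup_def generate.one)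
  interpret minimal_pair br \<theta> B \<hh> \<aa> C
  proof unfold_locales
    show "C \<subseteq> span {br Y Z |Y Z. True}"
    proof -
      have "br Z w \<in> span {br Y Z |Y Z. True}" for Z w by (rule span_base) blast
      then have "Orb \<subseteq> span {br Y Z |Y Z. True}"
        using N Ad_in_subspace[OF _ subspace_span] by (auto simp: Orb orbit_def lie_nilpotent_def)
      then show ?thesis unfolding C_def by (rule closure_minimal) (rule closed_subspace[OF subspace_span])
    qed
    show "I = UNIV" if "lie_ideal br UNIV I" "C \<subseteq> I" for I
    proof -
      have "lie_ideal br UNIV hull Orb = UNIV"
        using assms(9) by (simp add: ndd_minimal_def reduction_a_def Let_def)
      moreover have "lie_ideal br UNIV hull Orb \<subseteq> I"
        by (rule hull_minimal) (use that closure_subset[of Orb] in \<open>auto simp: C_def\<close>)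
      ultimately show ?thesis by blast
    qed
    show "X = 0" if I: "lie_ideal br \<hh> I" "\<And>X. X \<in> I \<Longrightarrow> \<theta> X = X" "X \<in> I" for I X
    proof -
      have "\<hh> \<inter> perp B (compact_ideal_sum br \<theta> \<hh>) = \<hh>"
        using assms(9) by (simp add: ndd_minimal_def reduction_b_def)
      moreover have "X \<in> compact_ideal_sum br \<theta> \<hh>"
        unfolding compact_ideal_sum_def using I by (intro span_base) (auto simp: plus_space_def)
      moreover have "X \<in> \<hh>" using I by (auto simp: lie_ideal_def)
      ultimately have "B X X = 0" by (auto simp: perp_def)
      then show ?thesis using I(2)[OF I(3)] ip_eq_zero_iff[of X] by (simp add: ip_def)
    qed
    \<comment> \<open>Zero lies in both intersected sets, so the NDD inequality provides a nonzero
      v. If \<open>\<hh>\<close> killed it, its orbit under L would be a single point different from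
      0.\<close>
    show "\<exists>v\<in>C \<inter> \<qq>. \<exists>Z\<in>\<hh>. br Z v \<noteq> 0"
    proof (rule ccontr)
      assume neg: "\<not> ?thesis"
      have "Ad \<one>\<^bsub>G\<^esub> 0 = (0::'a)" by (rule Ad_one)
      then have "0 \<in> orbit Ad L 0" unfolding orbit_def by (intro image_eqI[OF _ L1]) simp
      then have "0 \<in> null_cone Ad \<qq> L"
        using closure_subset[of "orbit Ad L 0"] subspace_0[OF q_subspace] by (auto simp: null_cone_def)
      moreover have "C \<inter> null_cone Ad \<qq> L \<noteq> {0}" using assms(7) by (simp add: ndd_tuple_def C_def L_def)
      ultimately have "\<exists>v\<in>C \<inter> null_cone Ad \<qq> L. v \<noteq> 0" using zero_C by blast
      then obtain v where v: "v \<in> C" "v \<in> \<qq>" "0 \<in> closure (orbit Ad L v)" "v \<noteq> 0"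
        unfolding null_cone_def by blast
      have z: "br Z v = 0" if "Z \<in> \<hh>" for Z using neg v(1,2) that by blast
      have e: "Ad (Exp Z) v = v" if "Z \<in> \<hh>" for Z
        using exp_ad_two_terms[OF br_bil, of Z v] z[OF that] by (simp add: br_zero_right Ad_Exp)
      have "Ad a v = v" if "a \<in> L" for a
        using that unfolding L_def analytic_subgroup_def
      proof (induction rule: Ad_induct)
        case (mult a b)
        then show ?case by (simp add: Ad_mult)
      qed (simp_all add: Ad_one e subspace_neg[OF h_subspace])
      then have "orbit Ad L v \<subseteq> {v}" unfolding orbit_def by blast
      then have "closure (orbit Ad L v) \<subseteq> {v}" by (rule closure_minimal) simp
      then show False using v(3,4) by blast
    qed
    show "V = UNIV"
      if B': "cartan_form \<theta> B'" "\<And>X Y Z. B' (br X Y) Z = - B' Y (br X Z)"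
        and X: "X \<in> C \<inter> perp B' \<hh>" "X \<noteq> 0" "linear \<mu>" "\<And>Y. Y \<in> \<aa> \<Longrightarrow> br Y X = \<mu> Y *\<^sub>R X" "\<exists>Y\<in>\<aa>. \<mu> Y \<noteq> 0"
        and V: "lie_subalgebra br V" "direct_sum V (V \<inter> \<hh>) (V \<inter> perp B' \<hh>)" "\<aa> \<union> {X, \<theta> X} \<subseteq> V"
      for B' X \<mu> V
    proof -
      have "bilinear B'" using B'(1) by (simp add: cartan_form_def)
      then have "invariant_cartan_form G Ad \<theta> B'"
        unfolding invariant_cartan_form_def
        by (intro conjI ballI allI B'(1) Ad_invariant_of_ad_invariant[OF _ B'(2)])
      \<comment> \<open>A nonzero weight makes this automatic: some Y in \<open>\<aa>\<close>, which
        lies in \<open>\<hh>\<close>, contracts X to 0 along its one-parameter group.\<close>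
      moreover have "X \<in> null_cone Ad (perp B' \<hh>) (analytic_subgroup G Exp \<hh>)"
      proof -
        obtain Y where Y: "Y \<in> \<aa>" "\<mu> Y \<noteq> 0" using X(5) by blast
        have "\<aa> \<subseteq> minus_space \<theta> \<hh>" using assms(8) by (simp add: max_abelian_subspace_def Let_def)
        then have Yh: "Y \<in> \<hh>" using Y(1) unfolding minus_space_def by blast
        have e: "exp (- real n) *\<^sub>R X \<in> orbit Ad L X" for n
        proof -
          define Z where "Z = (- real n / \<mu> Y) *\<^sub>R Y"
          have "Ad (Exp Z) X = exp (- real n) *\<^sub>R X"
            using exp_ad_eigenvector[OF br_bil, of Z X "- real n"] X(4)[OF Y(1)] Y(2)
            by (simp add: Z_def Ad_Exp br_simps)
          then have eq: "exp (- real n) *\<^sub>R X = Ad (Exp Z) X" by (rule sym)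
          have "Z \<in> \<hh>" unfolding Z_def by (rule subspace_scale[OF h_subspace Yh])
          then have "Exp Z \<in> L" unfolding L_def analytic_subgroup_def by (intro generate.incl imageI)
          then show ?thesis by (simp add: orbit_def eq)
        qed
        have "(\<lambda>n. exp (- real n) *\<^sub>R X) \<longlonglongrightarrow> 0 *\<^sub>R X"
        proof (intro tendsto_scaleR tendsto_const)
          have "(\<lambda>n. exp (- 1 :: real) ^ n) \<longlonglongrightarrow> 0" by (rule LIMSEQ_power_zero) simp
          then show "(\<lambda>n. exp (- real n)) \<longlonglongrightarrow> 0" by (simp add: exp_of_nat_mult[symmetric])
        qed
        then have "0 \<in> closure (orbit Ad L X)" unfolding closure_sequential scaleR_zero_left
          using e by (intro exI[of _ "\<lambda>n. exp (- real n) *\<^sub>R X"] conjI allI)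
        then show ?thesis using X(1) by (simp add: null_cone_def L_def)
      qed
      moreover have "X \<in> closure Orb" using X(1) by (simp add: C_def)
      moreover have "weight_vector br \<aa> \<mu> X" unfolding weight_vector_def using X(2,3,4) by blast
      ultimately have "reduction_c_choice br \<theta> G Exp Ad \<aa> \<hh> Orb B' X"
        unfolding reduction_c_choice_def by (intro conjI IntI exI[of _ \<mu>] X(5))
      then have "reduction_c br \<theta> G Exp Ad \<aa> \<hh> B' X = (UNIV, \<hh>, Orb)"
        using assms(9) unfolding ndd_minimal_def by blast
      then have "(\<lambda>V. lie_subalgebra br V \<and> direct_sum V (V \<inter> \<hh>) (V \<inter> perp B' \<hh>)) hull (\<aa> \<union> {X, \<theta> X}) = UNIV"
        by (simp add: reduction_c_def Let_def)
      moreover have "(\<lambda>V. lie_subalgebra br V \<and> direct_sum V (V \<inter> \<hh>) (V \<inter> perp B' \<hh>)) hull (\<aa> \<union> {X, \<theta> X}) \<subseteq> V"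
        by (rule hull_minimal) (use V in auto)
      ultimately show ?thesis by blast
    qed
  qed (use assms(8) C_closed C_cone C_exp in auto)
  show ?thesis by (rule minimal_pair_is_model)
qed

end
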